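(* Let $1\le m<n$ be integers, $\Omega\subset\mathbb{C}^n$ an open set and $\varphi$ an $m$-subharmonic function on $\Omega$. Then the function $z\longmapsto\nu_\varphi(z)$ is upper semi-continuous on $\Omega$.
   Context: Conventions: $d=\partial+\overline\partial$, $d^c=\frac{i}{4\pi}(\overline\partial-\partial)$, so $dd^c=\frac{i}{2\pi}\partial\overline\partial$; $\beta=dd^c|z|^2$; $\mathbb{B}(z,r)=\{w\in\mathbb{C}^n: |w-z|<r\}$. A $(1,1)$-form $\alpha$ is $m$-positive if $\alpha^j\wedge\beta^{n-j}\ge 0$ for every $1\le j\le m$. A $(q,q)$-form is strongly $m$-positive if it is of the form $\sum_{k=1}^N a_k\,\alpha_{1,k}\wedge\dots\wedge\alpha_{q,k}$ with $N=\binom nq$, $a_k\ge0$ and all $\alpha_{j,k}$ $m$-positive $(1,1)$-forms. A function $\varphi:\Omega\to\mathbb{R}\cup\{-\infty\}$ is $m$-subharmonic if it is subharmonic (not identically $-\infty$ on any component) and $dd^c\varphi$ is $m$-positive, i.e. $\langle dd^c\varphi\wedge\beta^{n-m},\alpha\rangle\ge0$ for every strongly $m$-positive $(m-1,m-1)$-test form $\alpha$ on $\Omega$. The Lelong number of $\varphi$ at $z\in\Omega$ is $$\nu_\varphi(z)=\lim_{r\to0^+}\frac{1}{r^{\frac{2n}{m}(m-1)}}\int_{\mathbb{B}(z,r)}dd^c\varphi\wedge\beta^{n-1}$$ (the limit exists for $m$-subharmonic $\varphi$). *)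

theory Defs
  imports "HOL-Analysis.Analysis" "HOL-Combinatorics.Permutations"
begin

text \<open>
  \<open>\<complex>\<^sup>n\<close> is the type \<^typ>\<open>complex ^ 'n\<close>. A complex-valued \<open>k\<close>-covector is an alternating
  \<open>\<real>\<close>-multilinear function of \<open>k\<close> tangent vectors. The vectors are given as a sequence of which
  only the entries \<open>v 0, \<dots>, v (k - 1)\<close> matter; the degree \<open>k\<close> is passed explicitly to the
  operations that need it. The normalisation is \<open>(dx \<and> dy)(u, v) = dx(u) dy(v) - dy(u) dx(v)\<close>.
\<close>

type_synonym 'n covector = "(nat \<Rightarrow> complex ^ 'n) \<Rightarrow> complex"
type_synonym 'n dform = "complex ^ 'n \<Rightarrow> 'n covector"

definition wedge :: "nat \<Rightarrow> nat \<Rightarrow> 'n covector \<Rightarrow> 'n covector \<Rightarrow> 'n covector" where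
  "wedge p q \<alpha> \<gamma> = (\<lambda>v. (\<Sum>\<sigma> | \<sigma> permutes {..<p + q}.
      of_int (sign \<sigma>) * \<alpha> (\<lambda>i. v (\<sigma> i)) * \<gamma> (\<lambda>i. v (\<sigma> (p + i)))) / (fact p * fact q))"

text \<open>All members of the list are 2-covectors.\<close>

fun wedge_list :: "'n covector list \<Rightarrow> 'n covector" where
  "wedge_list [] = (\<lambda>v. 1)"
| "wedge_list (\<alpha> # \<alpha>s) = wedge 2 (2 * length \<alpha>s) \<alpha> (wedge_list \<alpha>s)"

definition wedge_power :: "'n covector \<Rightarrow> nat \<Rightarrow> 'n covector" where
  "wedge_power \<alpha> j = wedge_list (replicate j \<alpha>)"

definition dz :: "'n::finite \<Rightarrow> 'n covector" where
  "dz j = (\<lambda>v. v 0 $ j)"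

definition dzbar :: "'n::finite \<Rightarrow> 'n covector" where
  "dzbar j = (\<lambda>v. cnj (v 0 $ j))"

definition real_11_covector :: "'n::finite covector \<Rightarrow> bool" where
  "real_11_covector \<alpha> \<longleftrightarrow>
     (\<exists>a :: complex ^ 'n ^ 'n. \<alpha> = (\<lambda>v. \<Sum>j\<in>UNIV. \<Sum>k\<in>UNIV. a $ j $ k * wedge 1 1 (dz j) (dzbar k) v))
     \<and> (\<forall>v. \<alpha> v \<in> \<real>)"

text \<open>
  The coefficient of a top degree covector with respect to the Lebesgue volume form
  \<open>dx\<^sub>1 \<and> dy\<^sub>1 \<and> \<dots> \<and> dx\<^sub>n \<and> dy\<^sub>n\<close>, i.e. its value on \<open>(e\<^sub>1, i e\<^sub>1, \<dots>, e\<^sub>n, i e\<^sub>n)\<close>. It does not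
  depend on the enumeration of the index type, since 2-covectors commute.
\<close>

definition vol_coeff :: "'n::finite covector \<Rightarrow> complex" where
  "vol_coeff \<tau> = \<tau> (\<lambda>k. axis (from_nat_into UNIV (k div 2)) (if even k then 1 else \<i>))"

text \<open>
  For a \<open>k\<close>-form, \<open>\<partial>\<omega> = \<Sum>\<^sub>j dz\<^sub>j \<and> \<partial>\<omega>/\<partial>z\<^sub>j\<close> evaluated on \<open>v\<^sub>0, \<dots>, v\<^sub>k\<close> is the alternating sum over
  \<open>i\<close> of the \<open>\<complex>\<close>-linear part, at \<open>v\<^sub>i\<close>, of the differential of \<open>\<omega>(v\<^sub>0, \<dots>, v\<^sub>i\<^sub>-\<^sub>1, v\<^sub>i\<^sub>+\<^sub>1, \<dots>, v\<^sub>k)\<close>.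
  Likewise for \<open>\<partial>bar\<close> with the \<open>\<complex>\<close>-antilinear part.
\<close>

definition deriv_10 :: "(complex ^ 'n::finite \<Rightarrow> complex) \<Rightarrow> complex ^ 'n \<Rightarrow> complex ^ 'n \<Rightarrow> complex" where
  "deriv_10 f z u =
     (frechet_derivative f (at z) u - \<i> * frechet_derivative f (at z) (\<i> *s u)) / 2"

definition deriv_01 :: "(complex ^ 'n::finite \<Rightarrow> complex) \<Rightarrow> complex ^ 'n \<Rightarrow> complex ^ 'n \<Rightarrow> complex" where
  "deriv_01 f z u =
     (frechet_derivative f (at z) u + \<i> * frechet_derivative f (at z) (\<i> *s u)) / 2"

definition omit :: "nat \<Rightarrow> (nat \<Rightarrow> 'a) \<Rightarrow> nat \<Rightarrow> 'a" where
  "omit i v = (\<lambda>l. if l < i then v l else v (Suc l))"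

definition del :: "nat \<Rightarrow> 'n::finite dform \<Rightarrow> 'n dform" where
  "del k \<omega> = (\<lambda>z v. \<Sum>i\<le>k. (-1) ^ i * deriv_10 (\<lambda>w. \<omega> w (omit i v)) z (v i))"

definition delbar :: "nat \<Rightarrow> 'n::finite dform \<Rightarrow> 'n dform" where
  "delbar k \<omega> = (\<lambda>z v. \<Sum>i\<le>k. (-1) ^ i * deriv_01 (\<lambda>w. \<omega> w (omit i v)) z (v i))"

definition ext_d :: "nat \<Rightarrow> 'n::finite dform \<Rightarrow> 'n dform" where
  "ext_d k \<omega> = (\<lambda>z v. del k \<omega> z v + delbar k \<omega> z v)"

definition ext_dc :: "nat \<Rightarrow> 'n::finite dform \<Rightarrow> 'n dform" where
  "ext_dc k \<omega> = (\<lambda>z v. \<i> / (4 * of_real pi) * (delbar k \<omega> z v - del k \<omega> z v))"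

definition ddc :: "nat \<Rightarrow> 'n::finite dform \<Rightarrow> 'n dform" where
  "ddc k \<omega> = ext_d (Suc k) (ext_dc k \<omega>)"

definition beta :: "'n::finite dform" where
  "beta = ddc 0 (\<lambda>z v. of_real ((norm z)\<^sup>2))"

text \<open>
  \<open>m\<close>-positivity is a condition on real (1,1)-forms. It is pointwise, as is strong
  \<open>m\<close>-positivity: no regularity is imposed on the coefficients and factors of a decomposition.
\<close>

definition m_positive_on :: "(complex ^ 'n::finite) set \<Rightarrow> nat \<Rightarrow> 'n dform \<Rightarrow> bool" where
  "m_positive_on S m \<alpha> \<longleftrightarrow> (\<forall>z\<in>S. real_11_covector (\<alpha> z) \<and>
     (\<forall>j\<in>{1..m}. vol_coeff (wedge (2 * j) (2 * (CARD('n) - j))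
         (wedge_power (\<alpha> z) j) (wedge_power (beta z) (CARD('n) - j))) \<in> \<real>\<^sub>\<ge>\<^sub>0))"

definition strongly_m_positive_on ::
    "(complex ^ 'n::finite) set \<Rightarrow> nat \<Rightarrow> nat \<Rightarrow> 'n dform \<Rightarrow> bool" where
  "strongly_m_positive_on S m q \<omega> \<longleftrightarrow>
     (\<exists>(a :: nat \<Rightarrow> complex ^ 'n \<Rightarrow> real) (\<alpha> :: nat \<Rightarrow> nat \<Rightarrow> 'n dform).
        (\<forall>k < CARD('n) choose q. (\<forall>z\<in>S. 0 \<le> a k z) \<and> (\<forall>j<q. m_positive_on S m (\<alpha> j k))) \<and>
        (\<forall>z\<in>S. \<omega> z = (\<lambda>v. \<Sum>k < CARD('n) choose q.
            of_real (a k z) * wedge_list (map (\<lambda>j. \<alpha> j k z) [0..<q]) v)))"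

fun C_k :: "nat \<Rightarrow> ('a::real_normed_vector \<Rightarrow> 'b::real_normed_vector) \<Rightarrow> bool" where
  "C_k 0 f = continuous_on UNIV f"
| "C_k (Suc k) f = ((\<forall>x. f differentiable (at x)) \<and>
      (\<forall>u. C_k k (\<lambda>x. frechet_derivative f (at x) u)))"

definition smooth :: "('a::real_normed_vector \<Rightarrow> 'b::real_normed_vector) \<Rightarrow> bool" where
  "smooth f \<longleftrightarrow> (\<forall>k. C_k k f)"

definition test_form :: "(complex ^ 'n::finite) set \<Rightarrow> 'n dform \<Rightarrow> bool" where
  "test_form \<Omega> \<omega> \<longleftrightarrow> (\<forall>v. smooth (\<lambda>z. \<omega> z v)) \<and>
     (\<exists>K. compact K \<and> K \<subseteq> \<Omega> \<and> (\<forall>z. z \<notin> K \<longrightarrow> \<omega> z = (\<lambda>v. 0)))"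

definition test_function :: "(complex ^ 'n::finite) set \<Rightarrow> (complex ^ 'n \<Rightarrow> real) \<Rightarrow> bool" where
  "test_function \<Omega> f \<longleftrightarrow> smooth f \<and>
     (\<exists>K. compact K \<and> K \<subseteq> \<Omega> \<and> (\<forall>z. z \<notin> K \<longrightarrow> f z = 0))"

text \<open>
  \<open>\<langle>dd\<^sup>c\<phi>, \<gamma>\<rangle> = \<integral> \<phi> dd\<^sup>c\<gamma>\<close> for a test form \<open>\<gamma>\<close> of degree \<open>2n - 2\<close>. The conversion to \<^typ>\<open>real\<close>
  sends \<open>-\<infinity>\<close> to 0, which only changes a locally integrable \<open>\<phi>\<close> on a null set.
\<close>

definition ddc_pairing ::
    "(complex ^ 'n::finite) set \<Rightarrow> (complex ^ 'n \<Rightarrow> ereal) \<Rightarrow> 'n dform \<Rightarrow> complex" where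
  "ddc_pairing \<Omega> \<phi> \<gamma> =
     (LINT z:\<Omega>|lborel. of_real (real_of_ereal (\<phi> z)) * vol_coeff (ddc (2 * CARD('n) - 2) \<gamma> z))"

text \<open>\<open>\<langle>dd\<^sup>c\<phi> \<and> \<beta>\<^sup>p, \<alpha>\<rangle> = \<langle>dd\<^sup>c\<phi>, \<beta>\<^sup>p \<and> \<alpha>\<rangle>\<close> for a test form \<open>\<alpha>\<close> of degree \<open>2(n - 1 - p)\<close>.\<close>

definition ddc_beta_pairing ::
    "(complex ^ 'n::finite) set \<Rightarrow> (complex ^ 'n \<Rightarrow> ereal) \<Rightarrow> nat \<Rightarrow> 'n dform \<Rightarrow> complex" where
  "ddc_beta_pairing \<Omega> \<phi> p \<alpha> = ddc_pairing \<Omega> \<phi>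
     (\<lambda>z. wedge (2 * p) (2 * (CARD('n) - 1 - p)) (wedge_power (beta z) p) (\<alpha> z))"

definition upper_semicontinuous_on ::
    "'a::topological_space set \<Rightarrow> ('a \<Rightarrow> 'b::linorder) \<Rightarrow> bool" where
  "upper_semicontinuous_on S f \<longleftrightarrow> (\<forall>x\<in>S. \<forall>c. f x < c \<longrightarrow> (\<forall>\<^sub>F y in at x within S. f y < c))"

text \<open>
  The mean over a closed ball, as positive part minus negative part
  (\<^const>\<open>e2ennreal\<close> sends negative values to 0). For \<open>f < \<infinity>\<close> upper semicontinuous on the ball the
  positive part is finite, and the mean is a number in \<open>[-\<infinity>, \<infinity>)\<close>.
\<close>

definition ball_mean :: "('a::euclidean_space \<Rightarrow> ereal) \<Rightarrow> 'a \<Rightarrow> real \<Rightarrow> ereal" where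
  "ball_mean f x r =
     enn2ereal (\<integral>\<^sup>+ y. e2ennreal (f y) \<partial>uniform_measure lborel (cball x r)) -
     enn2ereal (\<integral>\<^sup>+ y. e2ennreal (- f y) \<partial>uniform_measure lborel (cball x r))"

definition subharmonic_on :: "'a::euclidean_space set \<Rightarrow> ('a \<Rightarrow> ereal) \<Rightarrow> bool" where
  "subharmonic_on \<Omega> \<phi> \<longleftrightarrow>
     (\<forall>z\<in>\<Omega>. \<phi> z \<noteq> \<infinity>) \<and>
     upper_semicontinuous_on \<Omega> \<phi> \<and>
     (\<forall>z r. 0 < r \<and> cball z r \<subseteq> \<Omega> \<longrightarrow> \<phi> z \<le> ball_mean \<phi> z r) \<and>
     (\<forall>C\<in>components \<Omega>. \<exists>z\<in>C. \<phi> z \<noteq> -\<infinity>)"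

definition m_subharmonic_on ::
    "(complex ^ 'n::finite) set \<Rightarrow> nat \<Rightarrow> (complex ^ 'n \<Rightarrow> ereal) \<Rightarrow> bool" where
  "m_subharmonic_on \<Omega> m \<phi> \<longleftrightarrow> subharmonic_on \<Omega> \<phi> \<and>
     (\<forall>\<alpha>. test_form \<Omega> \<alpha> \<and> strongly_m_positive_on \<Omega> m (m - 1) \<alpha>
        \<longrightarrow> ddc_beta_pairing \<Omega> \<phi> (CARD('n) - m) \<alpha> \<in> \<real>\<^sub>\<ge>\<^sub>0)"

text \<open>
  The positive measure \<open>dd\<^sup>c\<phi> \<and> \<beta>\<^sup>n\<^sup>-\<^sup>1\<close> on \<open>\<Omega>\<close>, regarded as a Borel measure on \<open>\<complex>\<^sup>n\<close> that vanishes
  off \<open>\<Omega>\<close>: the unique such measure, finite on compact subsets of \<open>\<Omega>\<close>, that represents the current.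
\<close>

definition trace_measure ::
    "(complex ^ 'n::finite) set \<Rightarrow> (complex ^ 'n \<Rightarrow> ereal) \<Rightarrow> (complex ^ 'n) measure" where
  "trace_measure \<Omega> \<phi> = (THE \<mu>. sets \<mu> = sets borel \<and>
     emeasure \<mu> (- \<Omega>) = 0 \<and>
     (\<forall>K. compact K \<and> K \<subseteq> \<Omega> \<longrightarrow> emeasure \<mu> K < \<infinity>) \<and>
     (\<forall>f. test_function \<Omega> f \<longrightarrow>
        of_real (LINT z|\<mu>. f z) = ddc_beta_pairing \<Omega> \<phi> (CARD('n) - 1) (\<lambda>z v. of_real (f z))))"

definition lelong_number ::
    "(complex ^ 'n::finite) set \<Rightarrow> nat \<Rightarrow> (complex ^ 'n \<Rightarrow> ereal) \<Rightarrow> complex ^ 'n \<Rightarrow> real" where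
  "lelong_number \<Omega> m \<phi> z = Lim (at_right 0) (\<lambda>r.
     measure (trace_measure \<Omega> \<phi>) (ball z r)
       / r powr (2 * real CARD('n) / real m * (real m - 1)))"

end

theory Submission
  imports Defs
begin

text \<open>
  For \<open>\<phi>\<close> and its trace measure \<open>\<sigma>\<close>, the ratio \<open>\<sigma>(B(x, r)) / r\<^bsup>2q\<^esup>\<close>, \<open>q = (m - 1) n / m\<close>, is
  nondecreasing in \<open>r\<close>. Hence \<open>\<nu>(x)\<close> is its infimum, and comparing \<open>B(z, s)\<close> with \<open>B(x, t)\<close> for \<open>z\<close>
  near \<open>x\<close> and \<open>s\<close> slightly less than \<open>t\<close> gives upper semicontinuity.

  For the monotonicity put \<open>y = z - x\<close>, \<open>t = |y|\<^sup>2\<close> and let \<open>\<gamma>\<close> be the (1,1)-form that differs from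
  \<open>\<beta>\<close> only in the complex direction of \<open>y\<close>, where its eigenvalue is \<open>1 - n / m\<close>; this is the smallest
  value that keeps it \<open>m\<close>-positive. Testing \<open>dd\<^sup>c\<phi> \<and> \<beta>\<^sup>n\<^sup>-\<^sup>m\<close> against \<open>- t h'(t) \<gamma>\<^sup>m\<^sup>-\<^sup>1\<close> for a nonincreasing
  cut-off \<open>h\<close> and computing \<open>dd\<^sup>c\<close> of the test form gives \<open>q \<integral> h(t) d\<sigma> \<le> \<integral> - t h'(t) d\<sigma>\<close>.
  For \<open>h(t) = g(t / \<rho>)\<close> this says that \<open>\<rho>\<^sup>-\<^sup>q \<integral> g(t / \<rho>) d\<sigma>\<close> is nondecreasing in \<open>\<rho>\<close>, and \<open>g\<close> may tend
  to the indicator of \<open>[0, 1)\<close>. That \<open>\<sigma>\<close> exists is a Riesz representation theorem for positive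
  functionals on test functions.
\<close>

section \<open>Exterior algebra on lists of vectors\<close>

text \<open>With t = |z - x|^2 the form is \<gamma> = \<beta> - (n / (m t)) dt \<and> d^c t. The
  correction has square zero, so \<gamma>^(m-1) is affine in it, and the factor - t h'(t) cancels 1
  / t: the test form is smooth although \<gamma> is singular at x. Since dd^c t = \<beta>, one has
  dd^c(- h'(t) dt \<and> d^c t) = dd^c h(t) \<and> \<beta>, so the correction contributes (m - 1) n
  / m = q times dd^c h(t) \<and> \<beta>^(n-1); this is the origin of the exponent. All derivatives
  fall on the test form, so \<phi> is never regularised: only its local integrability and the
  positivity of the pairing enter.

  The obstacle is computational, since products are sums over permutations, derivatives are taken in
  real directions and top degree coefficients are values on a real frame. Therefore dd^c is
  rewritten with constant exterior factors inside the derivatives. The exterior algebra is then done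
  pointwise before differentiating, and what remains is calculus with real functions of |z -
  x|^2.\<close>

text \<open>
  Forms are functions of the list of their arguments. Contraction with \<open>v\<close> is
  \<open>\<lambda>A vs. A (v # vs)\<close>, so the defining equations of the exterior multiplications by a covector
  \<open>\<xi>\<close> and by a 2-form \<open>h\<close> are their commutation relations with contractions, and identities between
  them follow by induction on the argument list, without alternation or multilinearity.
\<close>

fun ewedge :: "('a \<Rightarrow> 'b::comm_ring_1) \<Rightarrow> ('a list \<Rightarrow> 'b) \<Rightarrow> 'a list \<Rightarrow> 'b" where
  "ewedge \<xi> A [] = 0"
| "ewedge \<xi> A (v # vs) = \<xi> v * A vs - ewedge \<xi> (\<lambda>ws. A (v # ws)) vs"

fun mwedge :: "('a \<Rightarrow> 'a \<Rightarrow> 'b::comm_ring_1) \<Rightarrow> ('a list \<Rightarrow> 'b) \<Rightarrow> 'a list \<Rightarrow> 'b" where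
  "mwedge h A [] = 0"
| "mwedge h A (v # vs) = ewedge (h v) A vs + mwedge h (\<lambda>ws. A (v # ws)) vs"

text \<open>The scalar 1 as a form of degree 0. It is nonzero on the empty list only, so whatever is
  built from it vanishes on lists of the wrong length: the degree is carried by the form
  itself.\<close>

definition vac :: "'a list \<Rightarrow> 'b::comm_ring_1" where
  "vac vs = (if vs = [] then 1 else 0)"

lemma ewedge_add: "ewedge \<xi> (\<lambda>ws. A ws + B ws) vs = ewedge \<xi> A vs + ewedge \<xi> B vs"
  by (induction vs arbitrary: A B) (auto simp: algebra_simps)

lemma ewedge_scale: "ewedge \<xi> (\<lambda>ws. c * A ws) vs = c * ewedge \<xi> A vs"
  by (induction vs arbitrary: A) (auto simp: algebra_simps)

lemma ewedge_diff: "ewedge \<xi> (\<lambda>ws. A ws - B ws) vs = ewedge \<xi> A vs - ewedge \<xi> B vs"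
  by (induction vs arbitrary: A B) (auto simp: algebra_simps)

lemma ewedge_zero [simp]: "ewedge \<xi> (\<lambda>ws. 0) vs = 0"
  by (induction vs) auto

lemma ewedge_minus: "ewedge \<xi> (\<lambda>ws. - A ws) vs = - ewedge \<xi> A vs"
  using ewedge_diff[of \<xi> "\<lambda>_. 0" A vs] by simp

lemma ewedge_covector_scale: "ewedge (\<lambda>v. c * \<xi> v) A vs = c * ewedge \<xi> A vs"
  by (induction vs arbitrary: A) (auto simp: algebra_simps)

lemma ewedge_covector_add: "ewedge (\<lambda>v. \<xi> v + \<zeta> v) A vs = ewedge \<xi> A vs + ewedge \<zeta> A vs"
  by (induction vs arbitrary: A) (auto simp: algebra_simps)

lemma ewedge_covector_diff: "ewedge (\<lambda>v. \<xi> v - \<zeta> v) A vs = ewedge \<xi> A vs - ewedge \<zeta> A vs"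
  by (induction vs arbitrary: A) (auto simp: algebra_simps)

lemma ewedge_vanish: "(\<And>v. v \<in> set vs \<Longrightarrow> \<xi> v = 0) \<Longrightarrow> ewedge \<xi> A vs = 0"
  by (induction vs arbitrary: A) auto

lemma ewedge_anticommute: "ewedge \<xi> (ewedge \<zeta> A) vs = - ewedge \<zeta> (ewedge \<xi> A) vs"
proof (induction vs arbitrary: A)
  case (Cons v vs)
  then show ?case
    by (simp only: ewedge.simps ewedge_diff ewedge_scale) (simp add: algebra_simps)
qed simp

lemma ewedge_ewedge_self:
  fixes \<xi> :: "'a \<Rightarrow> 'b::comm_ring_1"
  shows "ewedge \<xi> (ewedge \<xi> A) vs = 0"
proof (induction vs arbitrary: A)
  case (Cons v vs)
  then show ?case
    by (simp only: ewedge.simps ewedge_diff ewedge_scale) (simp add: algebra_simps)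
qed simp

lemma mwedge_add: "mwedge h (\<lambda>ws. A ws + B ws) vs = mwedge h A vs + mwedge h B vs"
  by (induction vs arbitrary: A B) (auto simp: algebra_simps ewedge_add)

lemma mwedge_diff: "mwedge h (\<lambda>ws. A ws - B ws) vs = mwedge h A vs - mwedge h B vs"
  by (induction vs arbitrary: A B) (auto simp: algebra_simps ewedge_diff)

lemma mwedge_scale: "mwedge h (\<lambda>ws. c * A ws) vs = c * mwedge h A vs"
  by (induction vs arbitrary: A) (auto simp: algebra_simps ewedge_scale)

lemma mwedge_zero [simp]: "mwedge h (\<lambda>ws. 0) vs = 0"
  by (induction vs) auto

text \<open>Contracting \<open>h\<close> with \<open>v\<close> leaves the covector
  \<open>h v\<close>, which anticommutes with \<xi>; the two sign changes cancel.\<close>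

lemma mwedge_ewedge: "mwedge h (ewedge \<xi> A) vs = ewedge \<xi> (mwedge h A) vs"
proof (induction vs arbitrary: A)
  case (Cons v vs)
  have "ewedge (h v) (ewedge \<xi> A) vs = - ewedge \<xi> (ewedge (h v) A) vs"
    by (rule ewedge_anticommute)
  with Cons show ?case
    by (simp only: ewedge.simps mwedge.simps mwedge_diff mwedge_scale ewedge_add) (simp add: algebra_simps)
qed simp

lemma mwedge_commute: "mwedge h (mwedge g A) vs = mwedge g (mwedge h A) vs"
proof (induction vs arbitrary: A)
  case (Cons v vs)
  then show ?case
    by (simp add: mwedge_add mwedge_ewedge algebra_simps)
qed simp

text \<open>The subtracted term is the 2-form \<xi> \<and> \<zeta> written out on two vectors;
  \<open>hgam\<close> arises from \<open>hbeta\<close> in this way.\<close>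

lemma mwedge_form_diff_scale:
  "mwedge (\<lambda>u w. h u w - c * (\<xi> u * \<zeta> w - \<zeta> u * \<xi> w)) A vs
    = mwedge h A vs - c * ewedge \<xi> (ewedge \<zeta> A) vs"
proof (induction vs arbitrary: A)
  case (Cons v vs)
  have "ewedge (\<lambda>w. h v w - c * (\<xi> v * \<zeta> w - \<zeta> v * \<xi> w)) A vs
      = ewedge (h v) A vs - c * (\<xi> v * ewedge \<zeta> A vs - \<zeta> v * ewedge \<xi> A vs)"
    by (simp only: ewedge_covector_diff ewedge_covector_scale)
  with Cons show ?case
    by (simp only: ewedge.simps mwedge.simps ewedge_diff ewedge_scale) (simp add: algebra_simps)
qed simp

section \<open>Alternating multilinear forms on lists\<close>

definition alt_lin :: "('a::real_vector list \<Rightarrow> complex) \<Rightarrow> bool" where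
  "alt_lin A \<longleftrightarrow> (\<forall>vs. linear (\<lambda>u. A (u # vs))) \<and>
     (\<forall>ws x y vs. A (ws @ x # y # vs) = - A (ws @ y # x # vs))"

lemma alt_lin_linear: "alt_lin A \<Longrightarrow> linear (\<lambda>u. A (u # vs))"
  unfolding alt_lin_def by blast

lemma alt_lin_swap:
  "alt_lin A \<Longrightarrow> \<forall>ws x y vs. A (ws @ x # y # vs) = - A (ws @ y # x # vs)"
  unfolding alt_lin_def by blast

lemma alt_lin_vac: "alt_lin vac"
  by (auto simp: alt_lin_def vac_def linear_iff)

lemma ewedge_swap:
  assumes "\<forall>ws x y vs. A (ws @ x # y # vs) = - A (ws @ y # x # vs)"
  shows "ewedge \<xi> A (ws @ x # y # vs) = - ewedge \<xi> A (ws @ y # x # vs)"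
  using assms
proof (induction ws arbitrary: A)
  case Nil
  have "(\<lambda>ws. A (x # y # ws)) = (\<lambda>ws. - A (y # x # ws))"
    using Nil[rule_format, of "[]" x y] by simp
  then show ?case by (simp add: ewedge_minus)
next
  case (Cons w ws)
  have *: "\<forall>ws x y vs. A (w # ws @ x # y # vs) = - A (w # ws @ y # x # vs)"
  proof (intro allI)
    fix us x y vs
    show "A (w # us @ x # y # vs) = - A (w # us @ y # x # vs)"
      using Cons.prems[rule_format, of "w # us" x y vs] by simp
  qed
  have "A (ws @ x # y # vs) = - A (ws @ y # x # vs)" using Cons.prems by blast
  moreover note Cons.IH[of "\<lambda>us. A (w # us)", OF *]
  ultimately show ?case by simp
qed

lemma mwedge_swap:
  assumes "\<forall>ws x y vs. A (ws @ x # y # vs) = - A (ws @ y # x # vs)"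
    and "\<And>u w. h u w = - h w u"
  shows "mwedge h A (ws @ x # y # vs) = - mwedge h A (ws @ y # x # vs)"
  using assms(1)
proof (induction ws arbitrary: A)
  case Nil
  have "(\<lambda>ws. A (x # y # ws)) = (\<lambda>ws. - A (y # x # ws))"
    using Nil[rule_format, of "[]" x y] by simp
  then have "mwedge h (\<lambda>ws. A (x # y # ws)) vs = - mwedge h (\<lambda>ws. A (y # x # ws)) vs"
    using mwedge_scale[of h "-1" "\<lambda>ws. A (y # x # ws)" vs] by simp
  then show ?case using assms(2)[of x y] by (simp add: algebra_simps)
next
  case (Cons w ws)
  have *: "\<forall>ws x y vs. A (w # ws @ x # y # vs) = - A (w # ws @ y # x # vs)"
  proof (intro allI)
    fix us x y vs
    show "A (w # us @ x # y # vs) = - A (w # us @ y # x # vs)"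
      using Cons.prems[rule_format, of "w # us" x y vs] by simp
  qed
  show ?case using Cons.IH[of "\<lambda>us. A (w # us)", OF *] ewedge_swap[OF Cons.prems, of "h w" ws x y vs] by simp
qed

lemma alt_lin_ewedge:
  assumes "linear \<xi>" "alt_lin A" shows "alt_lin (ewedge \<xi> A)"
proof -
  have l: "linear (\<lambda>u. A (u # vs))" for vs using assms(2) by (rule alt_lin_linear)
  have e1: "ewedge \<xi> (\<lambda>ws. A ((x + y) # ws)) vs
     = ewedge \<xi> (\<lambda>ws. A (x # ws)) vs + ewedge \<xi> (\<lambda>ws. A (y # ws)) vs" for x y vs
    by (subst ewedge_add[symmetric]) (simp add: linear_add[OF l])
  have e2: "ewedge \<xi> (\<lambda>ws. A ((c *\<^sub>R x) # ws)) vs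
     = c *\<^sub>R ewedge \<xi> (\<lambda>ws. A (x # ws)) vs" for c x vs
    by (simp add: linear_scale[OF l] scaleR_conv_of_real ewedge_scale)
  have sw: "\<forall>ws x y vs. A (ws @ x # y # vs) = - A (ws @ y # x # vs)"
    by (rule alt_lin_swap[OF assms(2)])
  have "linear (\<lambda>u. ewedge \<xi> A (u # vs))" for vs
    by (rule linearI)
      (simp_all add: e1 e2 linear_add[OF assms(1)] linear_scale[OF assms(1)] algebra_simps)
  then show ?thesis
    unfolding alt_lin_def using ewedge_swap[OF sw, of \<xi>] by blast
qed

lemma alt_lin_mwedge:
  assumes "\<And>u w. h u w = - h w u" "\<And>w. linear (\<lambda>u. h u w)" "alt_lin A"
  shows "alt_lin (mwedge h A)"
proof -
  have l: "linear (\<lambda>u. A (u # vs))" for vs using assms(3) by (rule alt_lin_linear)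
  have e1: "mwedge h (\<lambda>ws. A ((x + y) # ws)) vs
     = mwedge h (\<lambda>ws. A (x # ws)) vs + mwedge h (\<lambda>ws. A (y # ws)) vs" for x y vs
    by (subst mwedge_add[symmetric]) (simp add: linear_add[OF l])
  have e2: "mwedge h (\<lambda>ws. A ((c *\<^sub>R x) # ws)) vs
     = c *\<^sub>R mwedge h (\<lambda>ws. A (x # ws)) vs" for c x vs
    by (simp add: linear_scale[OF l] scaleR_conv_of_real mwedge_scale)
  have e3: "ewedge (h (x + y)) A vs = ewedge (h x) A vs + ewedge (h y) A vs" for x y vs
  proof -
    have "h (x + y) = (\<lambda>v. h x v + h y v)"
      by (simp add: linear_add[OF assms(2)] fun_eq_iff)
    then show ?thesis by (simp add: ewedge_covector_add)
  qed
  have e4: "ewedge (h (c *\<^sub>R x)) A vs = c *\<^sub>R ewedge (h x) A vs" for c x vs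
  proof -
    have "h (c *\<^sub>R x) = (\<lambda>v. of_real c * h x v)"
      by (simp add: linear_scale[OF assms(2)] scaleR_conv_of_real fun_eq_iff)
    then show ?thesis by (simp add: ewedge_covector_scale scaleR_conv_of_real)
  qed
  have sw: "\<forall>ws x y vs. A (ws @ x # y # vs) = - A (ws @ y # x # vs)"
    by (rule alt_lin_swap[OF assms(3)])
  have "linear (\<lambda>u. mwedge h A (u # vs))" for vs
    by (rule linearI) (simp_all add: e1 e2 e3 e4 algebra_simps)
  then show ?thesis
    unfolding alt_lin_def using mwedge_swap[OF sw, of h] assms(1) by blast
qed

lemma alt_lin_repeat:
  assumes "alt_lin A" "x \<in> set L" shows "A (x # L) = 0"
proof -
  have sw: "A (ws @ x # y # vs) = - A (ws @ y # x # vs)" for ws x y vs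
    using assms(1) unfolding alt_lin_def by blast
  have "A (ws @ x # ys @ x # zs) = 0" for ws ys zs
  proof (induction ys arbitrary: ws)
    case Nil
    then show ?case using sw[of ws x x zs] by (simp add: eq_neg_iff_add_eq_0)
  next
    case (Cons y ys)
    then show ?case using sw[of ws x y "ys @ x # zs"] Cons[of "ws @ [y]"] by simp
  qed
  from this[of "[]"] show ?thesis using assms(2) by (auto dest: split_list)
qed

text \<open>Expanding \<open>u\<close> in the vectors of \<open>L\<close> leaves only terms with a
  repeated argument. For a list that spans the space this replaces the comparison of degree and
  dimension.\<close>

lemma alt_lin_top:
  assumes "alt_lin A" "u \<in> span (set L)" shows "A (u # L) = 0"
proof -
  interpret linear "\<lambda>u. A (u # L)" using assms(1) by (rule alt_lin_linear)
  show ?thesis using assms(2)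
    by (induction rule: span_induct_alt) (auto simp: zero add scale alt_lin_repeat[OF assms(1)])
qed

section \<open>Powers of a 2-form and top degree relations\<close>

definition mpow :: "('a \<Rightarrow> 'a \<Rightarrow> 'b::comm_ring_1) \<Rightarrow> nat \<Rightarrow> 'a list \<Rightarrow> 'b" where
  "mpow h k = (mwedge h ^^ k) vac"

lemma mpow_Suc: "mpow h (Suc k) = mwedge h (mpow h k)"
  by (simp add: mpow_def)

text \<open>Leibniz rule: 2-forms commute with all factors, so the \<open>Suc k\<close> possible
  contractions contribute equally.\<close>

lemma mpow_Cons: "mpow h (Suc k) (u # vs) = of_nat (Suc k) * ewedge (h u) (mpow h k) vs"
proof (induction k arbitrary: vs)
  case 0
  have "mwedge h (\<lambda>ws. vac (u # ws)) vs = 0" by (simp add: vac_def)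
  then show ?case by (simp add: mpow_def)
next
  case (Suc k)
  have "mpow h (Suc (Suc k)) (u # vs)
      = ewedge (h u) (mpow h (Suc k)) vs + mwedge h (\<lambda>ws. of_nat (Suc k) * ewedge (h u) (mpow h k) ws) vs"
    by (subst mpow_Suc) (simp add: Suc)
  also have "\<dots> = ewedge (h u) (mpow h (Suc k)) vs + of_nat (Suc k) * ewedge (h u) (mpow h (Suc k)) vs"
    by (simp only: mwedge_scale mwedge_ewedge mpow_Suc)
  finally show ?case by (simp add: algebra_simps)
qed

lemma alt_lin_mpow:
  assumes "\<And>u w. h u w = - h w u" "\<And>w. linear (\<lambda>u. h u w)"
  shows "alt_lin (mpow h k)"
  by (induction k) (auto simp: mpow_Suc mpow_def[of _ 0] alt_lin_vac intro!: alt_lin_mwedge assms)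

locale volume_frame =
  fixes h :: "'a::real_vector \<Rightarrow> 'a \<Rightarrow> complex" and E :: "'a list"
  assumes h_antisym: "\<And>u w. h u w = - h w u"
    and h_linear: "\<And>w. linear (\<lambda>u. h u w)"
    and span_E: "span (set E) = UNIV"
begin

text \<open>
  A form whose degree exceeds the dimension vanishes; contracting \<open>\<xi> \<and> h\<^sup>k\<^sup>+\<^sup>1\<close> (and likewise
  \<open>\<xi>1 \<and> \<zeta>1 \<and> \<xi>2 \<and> h\<^sup>k\<^sup>+\<^sup>1\<close>) with \<open>u\<close> therefore gives a relation between top degree forms.
\<close>

lemma vol2:
  assumes "linear \<xi>" 
  shows "of_nat (Suc k) * ewedge \<xi> (ewedge (h u) (mpow h k)) E = \<xi> u * mpow h (Suc k) E"
proof -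
  have "alt_lin (ewedge \<xi> (mpow h (Suc k)))"
    by (intro alt_lin_ewedge assms alt_lin_mpow h_antisym h_linear)
  then have "ewedge \<xi> (mpow h (Suc k)) (u # E) = 0"
    using alt_lin_top span_E by blast
  then show ?thesis
    by (simp only: ewedge.simps mpow_Cons ewedge_scale) (simp add: algebra_simps del: of_nat_Suc)
qed

lemma vol4:
  assumes "linear \<xi>1" "linear \<zeta>1" "linear \<xi>2"
  shows "of_nat (Suc k) * ewedge \<xi>1 (ewedge \<zeta>1 (ewedge \<xi>2 (ewedge (h u) (mpow h k)))) E
    = \<xi>1 u * ewedge \<zeta>1 (ewedge \<xi>2 (mpow h (Suc k))) E
    - \<zeta>1 u * ewedge \<xi>1 (ewedge \<xi>2 (mpow h (Suc k))) E
    + \<xi>2 u * ewedge \<xi>1 (ewedge \<zeta>1 (mpow h (Suc k))) E"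
proof -
  have "alt_lin (ewedge \<xi>1 (ewedge \<zeta>1 (ewedge \<xi>2 (mpow h (Suc k)))))"
    by (intro alt_lin_ewedge assms alt_lin_mpow h_antisym h_linear)
  then have "ewedge \<xi>1 (ewedge \<zeta>1 (ewedge \<xi>2 (mpow h (Suc k)))) (u # E) = 0"
    using alt_lin_top span_E by blast
  then show ?thesis
    by (simp only: ewedge.simps mpow_Cons ewedge_scale ewedge_diff) (simp add: algebra_simps del: of_nat_Suc)
qed

end

section \<open>Exterior multiplication as a sum over omitted arguments\<close>

lemma omit_0: "omit 0 v = (\<lambda>i. v (Suc i))"
  by (simp add: omit_def fun_eq_iff)

lemma map_omit_Suc:
  "map (omit (Suc i) v) [0..<Suc k] = v 0 # map (omit i (\<lambda>i. v (Suc i))) [0..<k]"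
  unfolding map_upt_Suc by (simp add: omit_def)

text \<open>Unfolded recursion: the argument with index \<open>i\<close> passes \<open>i\<close>
  others on its way to \<xi>. This is the shape of the sums in \<open>del\<close> and
  \<open>delbar\<close>.\<close>

lemma ewedge_map_upt:
  "ewedge \<xi> A (map v [0..<Suc k]) = (\<Sum>i\<le>k. (-1) ^ i * \<xi> (v i) * A (map (omit i v) [0..<k]))"
proof (induction k arbitrary: v A)
  case 0
  then show ?case by simp
next
  case (Suc k)
  note mp = map_upt_Suc[of v "Suc k"]
  show ?case
    unfolding mp ewedge.simps(2) Suc
    by (subst sum.atMost_Suc_shift) (simp add: omit_0 map_omit_Suc sum_negf[symmetric] del: upt_Suc)
qed

text \<open>Every pair of arguments reaches \<open>h\<close> twice, once in each order; by
  antisymmetry of \<open>h\<close> the two contributions agree, hence the factor 2.\<close>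

lemma mwedge_map_upt:
  assumes "\<And>u w. h u w = - h w u"
  shows "(\<Sum>i\<le>k. (-1) ^ i * ewedge (h (v i)) A (map (omit i v) [0..<k])) = 2 * mwedge h A (map v [0..<Suc k])"
proof (induction k arbitrary: v A)
  case 0
  then show ?case by simp
next
  case (Suc k)
  note mp = map_upt_Suc[of v "Suc k"]
  let ?w = "\<lambda>i. v (Suc i)"
  let ?A = "\<lambda>ws. A (v 0 # ws)"
  have t: "(-1) ^ Suc i * ewedge (h (v (Suc i))) A (map (omit (Suc i) v) [0..<Suc k])
     = (-1) ^ i * h (v 0) (?w i) * A (map (omit i ?w) [0..<k])
       + (-1) ^ i * ewedge (h (?w i)) ?A (map (omit i ?w) [0..<k])" for i
    unfolding map_omit_Suc ewedge.simps(2) using assms[of "v (Suc i)" "v 0"] by (simp add: algebra_simps)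
  have "(\<Sum>i\<le>Suc k. (-1) ^ i * ewedge (h (v i)) A (map (omit i v) [0..<Suc k]))
     = ewedge (h (v 0)) A (map ?w [0..<Suc k])
     + (\<Sum>i\<le>k. (-1) ^ Suc i * ewedge (h (v (Suc i))) A (map (omit (Suc i) v) [0..<Suc k]))"
    by (subst sum.atMost_Suc_shift) (simp add: omit_0 del: upt_Suc)
  also have "\<dots> = ewedge (h (v 0)) A (map ?w [0..<Suc k]) + ewedge (h (v 0)) A (map ?w [0..<Suc k])
     + 2 * mwedge h ?A (map ?w [0..<Suc k])"
    unfolding t sum.distrib Suc
    using ewedge_map_upt[of "h (v 0)" A ?w k] by (simp del: upt_Suc)
  also have "\<dots> = 2 * mwedge h A (map v [0..<Suc (Suc k)])"
    unfolding mp mwedge.simps(2) by simp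
  finally show ?case .
qed

section \<open>Wedge products of two-covectors\<close>

definition Alt :: "nat \<Rightarrow> ((nat \<Rightarrow> 'a) \<Rightarrow> complex) \<Rightarrow> (nat \<Rightarrow> 'a) \<Rightarrow> complex" where
  "Alt k F v = (\<Sum>\<sigma> | \<sigma> permutes {..<k}. of_int (sign \<sigma>) * F (\<lambda>i. v (\<sigma> i)))"

definition skip :: "nat \<Rightarrow> nat \<Rightarrow> nat" where
  "skip i l = (if l < i then l else Suc l)"

definition lift_perm :: "(nat \<Rightarrow> nat) \<Rightarrow> nat \<Rightarrow> nat" where
  "lift_perm \<tau> = case_nat 0 (\<lambda>j. Suc (\<tau> j))"

text \<open>The cycle that sends 0 to \<open>i\<close> and shifts 1, ..., i down by one.\<close>

definition cyc :: "nat \<Rightarrow> nat \<Rightarrow> nat" where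
  "cyc i = case_nat i (skip i)"

lemma sign_compose_permutes:
  "finite S \<Longrightarrow> p permutes S \<Longrightarrow> q permutes S \<Longrightarrow> sign (p \<circ> q) = sign p * sign q"
  by (intro sign_compose) (auto simp: permutation_permutes)

lemma inj_skip: "skip i a = skip i b \<longleftrightarrow> a = b"
  by (auto simp: skip_def split: if_splits)

lemma cyc_permutes_sign:
  assumes "i \<le> k"
  shows "cyc i permutes {..<Suc k} \<and> sign (cyc i) = (-1) ^ i"
  using assms
proof (induction i)
  case 0
  have "cyc 0 = id"
    by (auto simp: cyc_def skip_def fun_eq_iff split: nat.splits)
  then show ?case by (simp only: permutes_id sign_id power_0 simp_thms)
next
  case (Suc i)
  have e: "cyc (Suc i) = Transposition.transpose i (Suc i) \<circ> cyc i"
    by (auto simp: cyc_def skip_def fun_eq_iff Transposition.transpose_def split: nat.splits)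
  have t: "Transposition.transpose i (Suc i) permutes {..<Suc k}"
    using Suc.prems by (intro permutes_swap_id) auto
  have c: "cyc i permutes {..<Suc k}" "sign (cyc i) = (-1) ^ i"
    using Suc by auto
  have "sign (cyc (Suc i)) = sign (Transposition.transpose i (Suc i)) * sign (cyc i)"
    unfolding e by (rule sign_compose_permutes[OF finite_lessThan t c(1)])
  then show ?case
    using permutes_compose[OF c(1) t] c(2) by (simp add: e[symmetric] sign_swap_id)
qed

lemma lift_perm_permutes_sign:
  assumes "\<tau> permutes {..<k}"
  shows "lift_perm \<tau> permutes {..<Suc k} \<and> sign (lift_perm \<tau>) = sign \<tau>"
  using assms finite_lessThan
proof (induction \<tau> rule: permutes_induct)
  case id
  have "lift_perm id = id"
    by (auto simp: lift_perm_def fun_eq_iff split: nat.splits)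
  then show ?case by (simp only: permutes_id sign_id simp_thms)
next
  case (swap a b p)
  have e: "lift_perm (Transposition.transpose a b \<circ> p) = Transposition.transpose (Suc a) (Suc b) \<circ> lift_perm p"
    by (auto simp: lift_perm_def fun_eq_iff Transposition.transpose_def split: nat.splits)
  have t: "Transposition.transpose (Suc a) (Suc b) permutes {..<Suc k}"
    using swap by (intro permutes_swap_id) auto
  have t': "Transposition.transpose a b permutes {..<k}"
    using swap by (intro permutes_swap_id) auto
  have "sign (lift_perm (Transposition.transpose a b \<circ> p)) = sign (Transposition.transpose (Suc a) (Suc b)) * sign (lift_perm p)"
    unfolding e by (rule sign_compose_permutes[OF finite_lessThan t]) (use swap in auto)
  moreover have "sign (Transposition.transpose a b \<circ> p) = sign (Transposition.transpose a b) * sign p"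
    by (rule sign_compose_permutes[OF finite_lessThan t']) (use swap in auto)
  ultimately have "sign (lift_perm (Transposition.transpose a b \<circ> p)) = sign (Transposition.transpose a b \<circ> p)"
    using swap by (simp only: sign_swap_id) simp
  moreover have "lift_perm (Transposition.transpose a b \<circ> p) permutes {..<Suc k}"
    unfolding e using swap t by (blast intro: permutes_compose)
  ultimately show ?case by blast
qed

text \<open>The permutation with value \<open>i\<close> at 0 that follows the pattern \<tau> on the
  remaining positions; it serves the expansion along the first argument.\<close>

definition insert_perm :: "nat \<Rightarrow> (nat \<Rightarrow> nat) \<Rightarrow> nat \<Rightarrow> nat" where
  "insert_perm i \<tau> = cyc i \<circ> lift_perm \<tau>"

lemma insert_perm_simps:
  "insert_perm i \<tau> 0 = i" "insert_perm i \<tau> (Suc j) = skip i (\<tau> j)"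
  by (auto simp: insert_perm_def cyc_def lift_perm_def)

lemma insert_perm_permutes_sign:
  assumes "\<tau> permutes {..<k}" "i \<le> k"
  shows "insert_perm i \<tau> permutes {..<Suc k}" "sign (insert_perm i \<tau>) = (-1) ^ i * sign \<tau>"
proof -
  note c = cyc_permutes_sign[OF assms(2)] and l = lift_perm_permutes_sign[OF assms(1)]
  show "insert_perm i \<tau> permutes {..<Suc k}"
    unfolding insert_perm_def using c l by (blast intro: permutes_compose)
  have "sign (insert_perm i \<tau>) = sign (cyc i) * sign (lift_perm \<tau>)"
    unfolding insert_perm_def
    by (rule sign_compose_permutes[of "{..<Suc k}"]) (use c l in auto)
  then show "sign (insert_perm i \<tau>) = (-1) ^ i * sign \<tau>"
    using c l by simp
qed

lemma bij_insert_perm: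
  "bij_betw (\<lambda>(i, \<tau>). insert_perm i \<tau>) ({..k} \<times> {\<tau>. \<tau> permutes {..<k}}) {\<sigma>. \<sigma> permutes {..<Suc k}}"
proof -
  let ?f = "\<lambda>(i, \<tau>). insert_perm i \<tau>" and ?A = "{..k} \<times> {\<tau>. \<tau> permutes {..<k}}"
  have inj: "inj_on ?f ?A"
  proof (rule inj_onI, clarify)
    fix i \<tau> i' \<tau>' assume "insert_perm i \<tau> = insert_perm i' \<tau>'"
    then have e: "insert_perm i \<tau> j = insert_perm i' \<tau>' j" for j by simp
    from e[of 0] have "i = i'" by (simp add: insert_perm_simps)
    moreover have "\<tau> j = \<tau>' j" for j
      using e[of "Suc j"] \<open>i = i'\<close> by (simp add: insert_perm_simps inj_skip)
    ultimately show "i = i' \<and> \<tau> = \<tau>'" by auto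
  qed
  have "?f ` ?A = {\<sigma>. \<sigma> permutes {..<Suc k}}"
  proof (rule card_subset_eq)
    show "?f ` ?A \<subseteq> {\<sigma>. \<sigma> permutes {..<Suc k}}"
      using insert_perm_permutes_sign by auto
    have c: "card {\<tau>. \<tau> permutes {..<j}} = fact j" for j :: nat
      by (rule card_permutations) auto
    show "card (?f ` ?A) = card {\<sigma>. \<sigma> permutes {..<Suc k}}"
      by (subst card_image[OF inj]) (simp add: card_cartesian_product c)
  qed (simp add: finite_permutations)
  with inj show ?thesis by (simp add: bij_betw_def)
qed

text \<open>Laplace expansion: the permutations are sorted by the vector that they put in first
  position.\<close>

lemma Alt_Suc:
  "Alt (Suc k) F v = (\<Sum>i\<le>k. (-1) ^ i * Alt k (\<lambda>w. F (case_nat (v i) w)) (omit i v))"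
proof -
  have v: "(\<lambda>j. v (insert_perm i \<tau> j)) = case_nat (v i) (\<lambda>j. omit i v (\<tau> j))" for i \<tau>
    by (auto simp: fun_eq_iff insert_perm_simps skip_def omit_def split: nat.splits)
  have "Alt (Suc k) F v = (\<Sum>(i, \<tau>)\<in>{..k} \<times> {\<tau>. \<tau> permutes {..<k}}.
      of_int (sign (insert_perm i \<tau>)) * F (\<lambda>j. v (insert_perm i \<tau> j)))"
    unfolding Alt_def
    by (subst sum.reindex_bij_betw[OF bij_insert_perm, symmetric]) (simp add: case_prod_unfold)
  also have "\<dots> = (\<Sum>(i, \<tau>)\<in>{..k} \<times> {\<tau>. \<tau> permutes {..<k}}.
      (-1) ^ i * (of_int (sign \<tau>) * F (case_nat (v i) (\<lambda>j. omit i v (\<tau> j)))))"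
    by (intro sum.cong refl) (auto simp: insert_perm_permutes_sign v)
  finally show ?thesis
    by (simp add: Alt_def sum_distrib_left sum.cartesian_product)
qed

lemma Alt_0: "Alt 0 F v = F v"
  by (simp add: Alt_def)

lemma Alt_scale: "Alt k (\<lambda>w. c * F w) v = c * Alt k F v"
  by (simp add: Alt_def sum_distrib_left algebra_simps)

lemma Alt_permute:
  assumes "\<tau> permutes {..<k}"
  shows "Alt k F (\<lambda>i. v (\<tau> i)) = of_int (sign \<tau>) * Alt k F v"
proof -
  have s: "sign (\<tau> \<circ> \<sigma>) = sign \<tau> * sign \<sigma>" if "\<sigma> permutes {..<k}" for \<sigma>
    by (rule sign_compose_permutes[OF finite_lessThan assms that])
  have "of_int (sign \<tau>) * Alt k F v
     = of_int (sign \<tau>) * (\<Sum>\<sigma> | \<sigma> permutes {..<k}. of_int (sign (\<tau> \<circ> \<sigma>)) * F (\<lambda>i. v ((\<tau> \<circ> \<sigma>) i)))"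
    unfolding Alt_def by (subst setum_permutations_compose_left[OF assms]) simp
  also have "\<dots> = (\<Sum>\<sigma> | \<sigma> permutes {..<k}. of_int (sign \<sigma>) * F (\<lambda>i. v (\<tau> (\<sigma> i))))"
    unfolding sum_distrib_left
  proof (intro sum.cong refl, clarify)
    fix \<sigma> assume "\<sigma> permutes {..<k}"
    have "of_int (sign \<tau>) * of_int (sign \<tau>) = (1::complex)"
      by (metis of_int_1 of_int_mult sign_idempotent)
    then show "of_int (sign \<tau>) * (of_int (sign (\<tau> \<circ> \<sigma>)) * F (\<lambda>i. v ((\<tau> \<circ> \<sigma>) i)))
       = of_int (sign \<sigma>) * F (\<lambda>i. v (\<tau> (\<sigma> i)))"
      using s[OF \<open>\<sigma> permutes {..<k}\<close>] by (simp add: mult.assoc[symmetric])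
  qed
  finally show ?thesis by (simp add: Alt_def)
qed

lemma Alt_Alt: "Alt k (Alt k F) v = fact k * Alt k F v"
proof -
  have sq: "of_int (sign \<sigma>) * (of_int (sign \<sigma>) * x) = x" for \<sigma> :: "nat \<Rightarrow> nat" and x :: complex
    by (simp add: mult.assoc[symmetric] of_int_mult[symmetric] del: of_int_mult)
  have "Alt k (Alt k F) v = (\<Sum>\<sigma> | \<sigma> permutes {..<k}. Alt k F v)"
    unfolding Alt_def[of k "Alt k F"] by (intro sum.cong refl) (simp add: Alt_permute sq)
  also have "\<dots> = fact k * Alt k F v"
    by (simp add: card_permutations[of "{..<k}" k])
  finally show ?thesis .
qed

text \<open>A permutation of the first \<open>p\<close> positions extends by the identity and is
  absorbed, with its sign, into the outer sum; all p! of them contribute equally. Associativity of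
  the wedge product rests on this.\<close>

lemma Alt_wedge_left:
  "Alt (p + q) (\<lambda>w. Alt p G w * B (\<lambda>i. w (p + i))) v
    = fact p * Alt (p + q) (\<lambda>w. G w * B (\<lambda>i. w (p + i))) v"
proof -
  let ?H = "\<lambda>w. G w * B (\<lambda>i. w (p + i))"
  have sq: "of_int (sign \<sigma>) * (of_int (sign \<sigma>) * x) = x" for \<sigma> :: "nat \<Rightarrow> nat" and x :: complex
    by (simp add: mult.assoc[symmetric] of_int_mult[symmetric] del: of_int_mult)
  have tau: "of_int (sign \<tau>) * Alt (p + q) (\<lambda>w. ?H (\<lambda>i. w (\<tau> i))) v = Alt (p + q) ?H v"
    if "\<tau> permutes {..<p}" for \<tau>
  proof -
    have t: "\<tau> permutes {..<p + q}" using that by (rule permutes_subset) auto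
    have s: "sign (\<sigma> \<circ> \<tau>) = sign \<sigma> * sign \<tau>" if "\<sigma> permutes {..<p + q}" for \<sigma>
      by (rule sign_compose_permutes[OF finite_lessThan that t])
    have "Alt (p + q) ?H v = (\<Sum>\<sigma> | \<sigma> permutes {..<p + q}. of_int (sign (\<sigma> \<circ> \<tau>)) * ?H (\<lambda>i. v ((\<sigma> \<circ> \<tau>) i)))"
      unfolding Alt_def by (subst sum_permutations_compose_right[OF t]) simp
    also have "\<dots> = of_int (sign \<tau>) * Alt (p + q) (\<lambda>w. ?H (\<lambda>i. w (\<tau> i))) v"
      unfolding Alt_def sum_distrib_left
      by (intro sum.cong refl) (simp add: s algebra_simps)
    finally show ?thesis by simp
  qed
  have shift: "\<tau> (p + i) = p + i" if "\<tau> permutes {..<p}" for \<tau> i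
    using that by (rule permutes_not_in) simp
  have "Alt (p + q) (\<lambda>w. Alt p G w * B (\<lambda>i. w (p + i))) v
      = (\<Sum>\<tau> | \<tau> permutes {..<p}. of_int (sign \<tau>) * Alt (p + q) (\<lambda>w. ?H (\<lambda>i. w (\<tau> i))) v)"
    unfolding Alt_def[of "p + q"] Alt_def[of p] sum_distrib_left sum_distrib_right
    by (subst sum.swap) (intro sum.cong refl, auto simp: shift mult_ac)
  also have "\<dots> = (\<Sum>\<tau> | \<tau> permutes {..<p}. Alt (p + q) ?H v)"
    by (intro sum.cong refl) (simp add: tau)
  finally show ?thesis
    by (simp add: card_permutations[of "{..<p}" p])
qed

section \<open>From permutation sums to lists\<close>

lemma wedge_Alt: "wedge p q \<alpha> \<gamma> v = Alt (p + q) (\<lambda>w. \<alpha> w * \<gamma> (\<lambda>i. w (p + i))) v / (fact p * fact q)"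
  by (simp add: wedge_def Alt_def algebra_simps)

lemma Alt_two:
  "Alt (Suc (Suc q)) (\<lambda>w. h (w 0) (w 1) * A (\<lambda>i. w (Suc (Suc i)))) v
    = (\<Sum>i\<le>Suc q. (-1) ^ i * (\<Sum>l\<le>q. (-1) ^ l * h (v i) (omit i v l) * Alt q A (omit l (omit i v))))"
  by (simp add: Alt_Suc Alt_scale mult.assoc del: sum.atMost_Suc)

text \<open>Stated as an eigenvalue equation for \<open>Alt\<close>, the shape in which the
  factorials in \<open>wedge\<close> cancel.\<close>

definition alternating :: "nat \<Rightarrow> ((nat \<Rightarrow> 'a) \<Rightarrow> complex) \<Rightarrow> bool" where
  "alternating k A \<longleftrightarrow> (\<forall>v. Alt k A v = fact k * A v)"

lemma alternating_wedge: "alternating (p + q) (wedge p q \<alpha> \<gamma>)"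
proof -
  have e: "wedge p q \<alpha> \<gamma> = (\<lambda>v. (1 / (fact p * fact q)) * Alt (p + q) (\<lambda>w. \<alpha> w * \<gamma> (\<lambda>i. w (p + i))) v)"
    by (simp add: wedge_Alt fun_eq_iff)
  show ?thesis
    unfolding alternating_def e Alt_scale Alt_Alt by simp
qed

definition cov2 :: "('a \<Rightarrow> 'a \<Rightarrow> complex) \<Rightarrow> (nat \<Rightarrow> 'a) \<Rightarrow> complex" where
  "cov2 h = (\<lambda>v. h (v 0) (v 1))"

lemma wedge_two:
  assumes "alternating q A"
  shows "wedge 2 q (cov2 h) A v
    = (\<Sum>i\<le>Suc q. (-1) ^ i * (\<Sum>l\<le>q. (-1) ^ l * h (v i) (omit i v l) * A (omit l (omit i v)))) / 2"
proof -
  have "wedge 2 q (cov2 h) A v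
     = Alt (Suc (Suc q)) (\<lambda>w. h (w 0) (w 1) * A (\<lambda>i. w (Suc (Suc i)))) v / (2 * fact q)"
    by (simp add: wedge_Alt cov2_def numeral_2_eq_2)
  also have "\<dots> = fact q * (\<Sum>i\<le>Suc q. (-1) ^ i * (\<Sum>l\<le>q. (-1) ^ l * h (v i) (omit i v l) * A (omit l (omit i v)))) / (2 * fact q)"
    unfolding Alt_two using assms unfolding alternating_def
    by (simp add: sum_distrib_left algebra_simps del: sum.atMost_Suc)
  finally show ?thesis by simp
qed

text \<open>The bridge from \<open>wedge\<close> to lists: both sides are half the sum over ordered
  pairs of arguments that are fed to \<open>h\<close>.\<close>

lemma wedge_two_mwedge:
  fixes A :: "(complex ^ 'n) list \<Rightarrow> complex"
  assumes "\<And>u w. h u w = - h w u" "alternating q (\<lambda>v. A (map v [0..<q]))"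
  shows "wedge 2 q (cov2 h) (\<lambda>v. A (map v [0..<q])) v = mwedge h A (map v [0..<2 + q])"
  using mwedge_map_upt[where h=h and A=A and v=v and k="Suc q", OF assms(1)] 
  by (simp add: wedge_two[OF assms(2)] ewedge_map_upt del: upt_Suc sum.atMost_Suc)

text \<open>Antisymmetrising the inner product first only produces a factorial, which its
  normalisation cancels. Both sides are thus one antisymmetrisation of the triple product, divided
  by 2 p! q!.\<close>

lemma wedge_assoc2:
  "wedge (2 + p) q (wedge 2 p (cov2 h) A) B v = wedge 2 (p + q) (cov2 h) (wedge p q A B) v"
proof -
  let ?AB = "\<lambda>w. A w * B (\<lambda>i. w (p + i))"
  have "wedge (2 + p) q (wedge 2 p (cov2 h) A) B v
     = Alt (2 + p + q) (\<lambda>w. (1 / (2 * fact p)) * (Alt (2 + p) (\<lambda>w. h (w 0) (w 1) * A (\<lambda>i. w (2 + i))) w * B (\<lambda>i. w (2 + p + i)))) v / (fact (2 + p) * fact q)"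
    unfolding wedge_Alt[of "2 + p"] by (simp add: wedge_Alt cov2_def)
  also have "\<dots> = Alt (2 + p + q) (\<lambda>w. (h (w 0) (w 1) * A (\<lambda>i. w (2 + i))) * B (\<lambda>i. w (2 + p + i))) v / (2 * fact p * fact q)"
    unfolding Alt_scale Alt_wedge_left by (simp del: fact_Suc add_2_eq_Suc add_2_eq_Suc')
  also have "\<dots> = Alt (Suc (Suc (p + q))) (\<lambda>w. h (w 0) (w 1) * ?AB (\<lambda>i. w (Suc (Suc i)))) v / (2 * fact p * fact q)"
    by (simp add: mult.assoc)
  also have "\<dots> = (\<Sum>i\<le>Suc (p + q). (-1) ^ i * (\<Sum>l\<le>p + q. (-1) ^ l * h (v i) (omit i v l) * wedge p q A B (omit l (omit i v)))) / 2"
    unfolding Alt_two[where A="?AB"] wedge_Alt[of p q A B]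
    by (simp add: sum_divide_distrib sum_distrib_left mult_ac del: sum.atMost_Suc)
  also have "\<dots> = wedge 2 (p + q) (cov2 h) (wedge p q A B) v"
    by (simp add: wedge_two[OF alternating_wedge])
  finally show ?thesis .
qed

lemma alternating_wedge_list: "alternating (2 * length \<alpha>s) (wedge_list \<alpha>s)"
proof (cases \<alpha>s)
  case Nil
  then show ?thesis by (simp add: alternating_def Alt_0)
next
  case (Cons a as)
  then show ?thesis using alternating_wedge[of 2 "2 * length as" a] by simp
qed

lemma wedge_wedge_list:
  "wedge (2 * length hs) (2 * length \<alpha>s) (wedge_list (map cov2 hs)) (wedge_list \<alpha>s) = wedge_list (map cov2 hs @ \<alpha>s)"
proof (induction hs)
  case Nil
  show ?case
    using alternating_wedge_list[of \<alpha>s] by (simp add: wedge_Alt alternating_def fun_eq_iff)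
next
  case (Cons h hs)
  have "wedge (2 * length (h # hs)) (2 * length \<alpha>s) (wedge_list (map cov2 (h # hs))) (wedge_list \<alpha>s)
     = wedge (2 + 2 * length hs) (2 * length \<alpha>s) (wedge 2 (2 * length hs) (cov2 h) (wedge_list (map cov2 hs))) (wedge_list \<alpha>s)"
    by simp
  also have "\<dots> = wedge 2 (2 * length hs + 2 * length \<alpha>s) (cov2 h) (wedge_list (map cov2 hs @ \<alpha>s))"
    by (intro ext) (simp only: wedge_assoc2 Cons)
  finally show ?case by simp
qed

lemma wedge_list_mwedge:
  fixes hs :: "(complex ^ 'n \<Rightarrow> complex ^ 'n \<Rightarrow> complex) list"
  assumes "\<And>h u w. h \<in> set hs \<Longrightarrow> h u w = - h w u"
  shows "wedge_list (map cov2 hs) v = foldr mwedge hs vac (map v [0..<2 * length hs])"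
  using assms
proof (induction hs arbitrary: v)
  case Nil
  then show ?case by (simp add: vac_def)
next
  case (Cons h hs)
  let ?A = "foldr mwedge hs vac"
  have IH: "wedge_list (map cov2 hs) = (\<lambda>v. ?A (map v [0..<2 * length hs]))"
    by (intro ext Cons.IH Cons.prems) simp
  have alt: "alternating (2 * length hs) (\<lambda>v. ?A (map v [0..<2 * length hs]))"
    unfolding IH[symmetric] using alternating_wedge_list[of "map cov2 hs"] by simp
  have "wedge 2 (2 * length hs) (cov2 h) (\<lambda>v. ?A (map v [0..<2 * length hs])) v
      = mwedge h ?A (map v [0..<2 + 2 * length hs])"
    by (rule wedge_two_mwedge[OF _ alt]) (rule Cons.prems, simp)
  then show ?case by (simp add: IH del: upt_Suc)
qed

lemma foldr_mwedge_replicate: "foldr mwedge (replicate k h) A = (mwedge h ^^ k) A"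
  by (induction k) auto

section \<open>Smooth functions and cut-offs\<close>

abbreviation dd :: "'a \<Rightarrow> ('a::real_normed_vector \<Rightarrow> 'b::real_normed_vector) \<Rightarrow> 'a \<Rightarrow> 'b" where
  "dd u f \<equiv> (\<lambda>x. frechet_derivative f (at x) u)"

lemma dd_eqI: "(f has_derivative f') (at x) \<Longrightarrow> dd u f x = f' u"
  by (drule frechet_derivative_at) simp

lemma C_k_SucI:
  assumes "\<And>x. (f has_derivative f' x) (at x)" "\<And>u. C_k k (\<lambda>x. f' x u)"
  shows "C_k (Suc k) f"
proof -
  have "f differentiable (at x)" for x using assms(1) by (auto simp: differentiable_def)
  moreover have "dd u f = (\<lambda>x. f' x u)" for u
    using assms(1) by (auto simp: dd_eqI)
  ultimately show ?thesis using assms(2) by simp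
qed

lemma C_k_Suc_has_derivative:
  "C_k (Suc k) f \<Longrightarrow> (f has_derivative frechet_derivative f (at x)) (at x)"
  by (simp add: frechet_derivative_works[symmetric])

lemma C_k_SucD: "C_k (Suc k) f \<Longrightarrow> C_k k f"
proof (induction k arbitrary: f)
  case 0
  then show ?case
    by (auto simp: continuous_on_eq_continuous_at intro: differentiable_imp_continuous_within)
next
  case (Suc k)
  then show ?case by (metis C_k.simps(2))
qed

lemma C_k_continuous: "C_k k f \<Longrightarrow> continuous_on UNIV f"
  by (induction k) (auto dest: C_k_SucD simp del: C_k.simps(2))

lemma C_k_const: "C_k k (\<lambda>x. c)"
proof (induction k arbitrary: c)
  case (Suc k)
  show ?case by (rule C_k_SucI[where f'="\<lambda>x u. 0"]) (auto intro: Suc)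
qed simp

lemma C_k_bounded_linear: "bounded_linear f \<Longrightarrow> C_k k f"
proof (cases k)
  case (Suc j)
  assume "bounded_linear f"
  then show ?thesis unfolding Suc
    by (intro C_k_SucI[where f'="\<lambda>x. f"]) (auto intro: C_k_const bounded_linear_imp_has_derivative)
qed (simp add: linear_continuous_on)

lemma C_k_add: "C_k k f \<Longrightarrow> C_k k g \<Longrightarrow> C_k k (\<lambda>x. f x + g x)"
proof (induction k arbitrary: f g)
  case (Suc k)
  show ?case
    by (rule C_k_SucI[OF has_derivative_add[OF C_k_Suc_has_derivative[OF Suc.prems(1)] C_k_Suc_has_derivative[OF Suc.prems(2)]]])
      (use Suc in auto)
qed (simp add: continuous_on_add)

lemma C_k_linear_compose: "bounded_linear h \<Longrightarrow> C_k k f \<Longrightarrow> C_k k (\<lambda>x. h (f x))"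
proof (induction k arbitrary: f)
  case 0
  then show ?case by (simp add: bounded_linear.continuous_on)
next
  case (Suc k)
  show ?case
    by (rule C_k_SucI[OF bounded_linear.has_derivative[OF Suc.prems(1) C_k_Suc_has_derivative[OF Suc.prems(2)]]])
      (use Suc in auto)
qed

lemma C_k_bilinear:
  assumes "bounded_bilinear p" "C_k k f" "C_k k g"
  shows "C_k k (\<lambda>x. p (f x) (g x))"
  using assms(2,3)
proof (induction k arbitrary: f g)
  case 0
  then show ?case using assms(1) by (simp add: bounded_bilinear.continuous_on)
next
  case (Suc k)
  show ?case
  proof (rule C_k_SucI[OF bounded_bilinear.FDERIV[OF assms(1) C_k_Suc_has_derivative[OF Suc.prems(1)] C_k_Suc_has_derivative[OF Suc.prems(2)]]])
    show "C_k k (\<lambda>x. p (f x) (dd u g x) + p (dd u f x) (g x))" for u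
      using Suc.prems by (intro C_k_add Suc.IH C_k_SucD[OF Suc.prems(1)] C_k_SucD[OF Suc.prems(2)]) auto
  qed
qed

text \<open>The inner function is real valued, so the chain rule gives a scalar times
  \<open>dd 1 g\<close> composed with \<open>f\<close>, and the induction stays within products and
  compositions.\<close>

lemma C_k_compose:
  fixes g :: "real \<Rightarrow> 'b::real_normed_vector" and f :: "'a::real_normed_vector \<Rightarrow> real"
  shows "C_k k g \<Longrightarrow> C_k k f \<Longrightarrow> C_k k (\<lambda>x. g (f x))"
proof (induction k arbitrary: f g)
  case 0
  then show ?case by (auto intro: continuous_on_compose2)
next
  case (Suc k)
  have d: "((\<lambda>x. g (f x)) has_derivative (\<lambda>u. dd (dd u f x) g (f x))) (at x)" for x
    using has_derivative_compose[OF C_k_Suc_has_derivative[OF Suc.prems(2)] C_k_Suc_has_derivative[OF Suc.prems(1)]] .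
  have e: "dd (dd u f x) g (f x) = dd u f x *\<^sub>R dd 1 g (f x)" for u x
    using linear_scale[OF has_derivative_linear[OF C_k_Suc_has_derivative[OF Suc.prems(1), of "f x"]], of "dd u f x" 1]
    by simp
  show ?case
  proof (rule C_k_SucI[OF d])
    show "C_k k (\<lambda>x. dd (dd u f x) g (f x))" for u
      unfolding e using Suc.prems
      by (intro C_k_bilinear[OF bounded_bilinear_scaleR] Suc.IH C_k_SucD[OF Suc.prems(2)]) auto
  qed
qed

text \<open>The derivative is a product of the derivative of \<open>f\<close> with copies of the
  inverse itself, to which the induction hypothesis applies.\<close>

lemma C_k_inverse:
  fixes f :: "'a::real_normed_vector \<Rightarrow> real"
  assumes "\<And>x. f x \<noteq> 0"
  shows "C_k k f \<Longrightarrow> C_k k (\<lambda>x. inverse (f x))"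
proof (induction k)
  case 0
  then show ?case using assms by (simp add: continuous_on_inverse)
next
  case (Suc k)
  have "((\<lambda>x. inverse (f x)) has_derivative (\<lambda>h. - (inverse (f x) * dd h f x * inverse (f x)))) (at x)" for x
    by (rule Deriv.has_derivative_inverse[OF assms C_k_Suc_has_derivative[OF Suc.prems]])
  then show ?case
  proof (rule C_k_SucI)
    have "C_k k (\<lambda>x. inverse (f x))" by (intro Suc.IH C_k_SucD[OF Suc.prems])
    moreover have "C_k k (dd u f)" for u using Suc.prems by simp
    ultimately show "C_k k (\<lambda>x. - (inverse (f x) * dd u f x * inverse (f x)))" for u
      by (intro C_k_linear_compose[OF bounded_linear_minus[OF bounded_linear_ident]]
          C_k_bilinear[OF bounded_bilinear_mult])
  qed
qed

lemma smooth_const: "smooth (\<lambda>x. c)"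
  by (simp add: smooth_def C_k_const)

lemma smooth_bounded_linear: "bounded_linear f \<Longrightarrow> smooth f"
  by (simp add: smooth_def C_k_bounded_linear)

lemma smooth_add: "smooth f \<Longrightarrow> smooth g \<Longrightarrow> smooth (\<lambda>x. f x + g x)"
  by (simp add: smooth_def C_k_add)

lemma smooth_linear_compose: "bounded_linear h \<Longrightarrow> smooth f \<Longrightarrow> smooth (\<lambda>x. h (f x))"
  by (simp add: smooth_def C_k_linear_compose)

lemma smooth_minus: "smooth f \<Longrightarrow> smooth (\<lambda>x. - f x)"
  using smooth_linear_compose[OF bounded_linear_minus[OF bounded_linear_ident]] by blast

lemma smooth_diff: "smooth f \<Longrightarrow> smooth g \<Longrightarrow> smooth (\<lambda>x. f x - g x)"
  using smooth_add[OF _ smooth_minus, of f g] by simp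

lemma smooth_bilinear:
  "bounded_bilinear p \<Longrightarrow> smooth f \<Longrightarrow> smooth g \<Longrightarrow> smooth (\<lambda>x. p (f x) (g x))"
  by (simp add: smooth_def C_k_bilinear)

lemma smooth_mult:
  fixes f g :: "'a::real_normed_vector \<Rightarrow> 'b::real_normed_algebra"
  shows "smooth f \<Longrightarrow> smooth g \<Longrightarrow> smooth (\<lambda>x. f x * g x)"
  by (rule smooth_bilinear[OF bounded_bilinear_mult])

lemma smooth_inner: "smooth f \<Longrightarrow> smooth g \<Longrightarrow> smooth (\<lambda>x. f x \<bullet> g x)"
  by (rule smooth_bilinear[OF bounded_bilinear_inner])

lemma smooth_compose:
  fixes g :: "real \<Rightarrow> 'b::real_normed_vector" and f :: "'a::real_normed_vector \<Rightarrow> real"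
  shows "smooth g \<Longrightarrow> smooth f \<Longrightarrow> smooth (\<lambda>x. g (f x))"
  by (simp add: smooth_def C_k_compose)

lemma smooth_inverse:
  fixes f :: "'a::real_normed_vector \<Rightarrow> real"
  shows "(\<And>x. f x \<noteq> 0) \<Longrightarrow> smooth f \<Longrightarrow> smooth (\<lambda>x. inverse (f x))"
  by (simp add: smooth_def C_k_inverse)

lemma smooth_ident: "smooth (\<lambda>x. x)"
  by (intro smooth_bounded_linear bounded_linear_ident)

lemma smooth_of_real:
  "smooth f \<Longrightarrow> smooth (\<lambda>x. of_real (f x) :: 'b::real_normed_algebra_1)"
  by (rule smooth_linear_compose[OF bounded_linear_of_real])

lemma smooth_sum: "(\<And>i. i \<in> I \<Longrightarrow> smooth (f i)) \<Longrightarrow> smooth (\<lambda>x. \<Sum>i\<in>I. f i x)"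
  by (induction I rule: infinite_finite_induct) (auto intro: smooth_const smooth_add)

lemma smooth_dd: "smooth f \<Longrightarrow> smooth (dd u f)"
  unfolding smooth_def by (metis C_k.simps(2))

lemma smooth_has_derivative:
  "smooth f \<Longrightarrow> (f has_derivative frechet_derivative f (at x)) (at x)"
  unfolding smooth_def by (blast intro: C_k_Suc_has_derivative)

lemma smooth_continuous: "smooth f \<Longrightarrow> continuous_on UNIV f"
  unfolding smooth_def by (blast intro: C_k_continuous)

lemma dd_add: "smooth f \<Longrightarrow> smooth g \<Longrightarrow> dd u (\<lambda>x. f x + g x) x = dd u f x + dd u g x"
  by (intro dd_eqI has_derivative_add smooth_has_derivative)

lemma dd_diff: "smooth f \<Longrightarrow> smooth g \<Longrightarrow> dd u (\<lambda>x. f x - g x) x = dd u f x - dd u g x"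
  by (intro dd_eqI has_derivative_diff smooth_has_derivative)

lemma dd_linear_compose: "bounded_linear h \<Longrightarrow> smooth f \<Longrightarrow> dd u (\<lambda>x. h (f x)) x = h (dd u f x)"
  by (rule dd_eqI, rule bounded_linear.has_derivative, assumption, rule smooth_has_derivative)

lemma dd_sum:
  "(\<And>i. i \<in> I \<Longrightarrow> smooth (f i)) \<Longrightarrow> dd u (\<lambda>x. \<Sum>i\<in>I. f i x) x = (\<Sum>i\<in>I. dd u (f i) x)"
  by (intro dd_eqI has_derivative_sum smooth_has_derivative)

lemma dd_scale:
  fixes f :: "'a::real_normed_vector \<Rightarrow> 'b::real_normed_algebra"
  shows "smooth f \<Longrightarrow> dd u (\<lambda>x. c * f x) x = c * dd u f x"
  by (rule dd_linear_compose[OF bounded_linear_mult_right])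

lemma dd_linear: "smooth f \<Longrightarrow> linear (\<lambda>u. dd u f x)"
  using has_derivative_linear[OF smooth_has_derivative] by blast

lemma dd_expand:
  fixes f :: "'a::euclidean_space \<Rightarrow> 'b::real_normed_vector"
  assumes "smooth f"
  shows "dd u f x = (\<Sum>e\<in>Basis. (u \<bullet> e) *\<^sub>R dd e f x)"
proof -
  have "dd u f x = dd (\<Sum>e\<in>Basis. (u \<bullet> e) *\<^sub>R e) f x"
    by (simp add: euclidean_representation)
  also have "\<dots> = (\<Sum>e\<in>Basis. (u \<bullet> e) *\<^sub>R dd e f x)"
    using dd_linear[OF assms, of x] by (simp add: linear_sum linear_scale)
  finally show ?thesis .
qed

lemma dd_zero_off:
  assumes "closed K" "\<And>x. x \<notin> K \<Longrightarrow> f x = 0" "x \<notin> K"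
  shows "dd u f x = 0"
proof (rule dd_eqI[where f'="\<lambda>u. 0"])
  show "(f has_derivative (\<lambda>u. 0)) (at x)"
    by (rule has_derivative_transform_within_open[where f="\<lambda>x. 0" and s="- K"])
      (use assms in auto)
qed

text \<open>The family of functions \<open>x\<^sup>-\<^sup>k exp (- 1 / x)\<close> is closed under differentiation up to linear combinations.\<close>

definition flat :: "nat \<Rightarrow> real \<Rightarrow> real" where
  "flat k x = (if x > 0 then inverse x ^ k * exp (- inverse x) else 0)"

lemma flat_nonneg: "0 \<le> flat k x"
  by (simp add: flat_def)

lemma flat_eq_0: "x \<le> 0 \<Longrightarrow> flat k x = 0"
  by (simp add: flat_def)

lemma flat_0_pos: "x > 0 \<Longrightarrow> 0 < flat k x"
  by (simp add: flat_def)

lemma flat_le_fact: "flat k x \<le> fact k"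
proof (cases "x > 0")
  case True
  define y where "y = inverse x"
  have y: "y > 0" using True by (simp add: y_def)
  \<comment> \<open>A single term of the exponential series at y = 1 / x.\<close>
  have "y ^ k / fact k \<le> exp y"
  proof -
    have s: "(\<lambda>n. y ^ n /\<^sub>R fact n) sums exp y" by (rule exp_converges)
    have "(\<Sum>n\<in>{k}. y ^ n /\<^sub>R fact n) \<le> exp y"
      unfolding sums_unique[OF s] using y by (intro sum_le_suminf sums_summable[OF s]) auto
    then show ?thesis by (simp add: field_simps)
  qed
  then have "y ^ k * exp (- y) \<le> fact k"
    by (simp add: exp_minus field_simps)
  then show ?thesis using True by (simp add: flat_def y_def)
qed (simp add: flat_def)

lemma flat_shift: "flat k x = x ^ j * flat (k + j) x"
  by (simp add: flat_def power_add field_simps)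

lemma flat_deriv: "(flat k has_real_derivative (flat (k + 2) x - of_nat k * flat (k + 1) x)) (at x)"
proof -
  consider "x > 0" | "x < 0" | "x = 0" by linarith
  then show ?thesis
  proof cases
    case 1
    have p: "((\<lambda>x. inverse x ^ k) has_real_derivative - (of_nat k * inverse x ^ (k + 1))) (at x)" for k
    proof (induction k)
      case (Suc k)
      have "((\<lambda>x. inverse x * inverse x ^ k) has_real_derivative
          (- (inverse x * inverse x)) * inverse x ^ k + - (of_nat k * inverse x ^ (k + 1)) * inverse x) (at x)"
        using 1 by (intro DERIV_mult Suc) (auto intro!: derivative_eq_intros simp: power2_eq_square)
      then show ?case by (simp add: algebra_simps)
    qed simp
    have e: "((\<lambda>x. exp (- inverse x)) has_real_derivative exp (- inverse x) * inverse x ^ 2) (at x)"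
      using 1 by (auto intro!: derivative_eq_intros simp: power2_eq_square)
    have "((\<lambda>x. inverse x ^ k * exp (- inverse x)) has_real_derivative
        (flat (k + 2) x - of_nat k * flat (k + 1) x)) (at x)"
      using DERIV_mult[OF p[of k] e] 1 by (simp add: flat_def power_add algebra_simps power2_eq_square)
    then show ?thesis
      by (rule has_field_derivative_transform_within_open[where S="{0<..}"])
        (use 1 in \<open>auto simp: flat_def\<close>)
  next
    case 2
    have "((\<lambda>x. 0) has_real_derivative (flat (k + 2) x - of_nat k * flat (k + 1) x)) (at x)"
      using 2 by (simp add: flat_def)
    then show ?thesis
      by (rule has_field_derivative_transform_within_open[where S="{..<0}"])
        (use 2 in \<open>auto simp: flat_def\<close>)
  next
    case 3
    \<comment> \<open>Two powers of h are split off: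
      \<open>flat k h = h\<^sup>2 * flat (k + 2) h\<close> with a bounded second factor, so the
      difference quotient at 0 is O(h).\<close>
    have "((\<lambda>h. (flat k (0 + h) - flat k 0) / h) \<longlongrightarrow> 0) (at 0)"
    proof (rule Lim_null_comparison[where g="\<lambda>h. fact (k + 2) * \<bar>h\<bar>"])
      have "\<bar>flat k h / h\<bar> \<le> fact (k + 2) * \<bar>h\<bar>" if "h \<noteq> 0" for h
      proof -
        have "flat k h / h = h * flat (k + 2) h"
          using flat_shift[of k h 2] that by (simp add: power2_eq_square)
        then have "\<bar>flat k h / h\<bar> = \<bar>h\<bar> * flat (k + 2) h"
          by (simp add: abs_mult flat_nonneg)
        also have "\<dots> \<le> \<bar>h\<bar> * fact (k + 2)"
          by (intro mult_left_mono flat_le_fact) auto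
        finally show ?thesis by (simp add: mult.commute)
      qed
      then show "\<forall>\<^sub>F h in at 0. norm ((flat k (0 + h) - flat k 0) / h) \<le> fact (k + 2) * \<bar>h\<bar>"
        by (auto simp: eventually_at_filter flat_eq_0)
      show "((\<lambda>h. fact (k + 2) * \<bar>h\<bar>) \<longlongrightarrow> (0::real)) (at 0)"
        by (auto intro!: tendsto_eq_intros)
    qed
    then show ?thesis using 3 by (simp add: DERIV_def flat_eq_0)
  qed
qed

lemma C_k_flat: "C_k j (flat k)"
proof (induction j arbitrary: k)
  case 0
  have "isCont (flat k) x" for x using flat_deriv DERIV_isCont by blast
  then show ?case by (simp add: continuous_at_imp_continuous_on)
next
  case (Suc j)
  show ?case
  proof (rule C_k_SucI)
    show "(flat k has_derivative (\<lambda>u. u * (flat (k + 2) x + (- of_nat k) * flat (k + 1) x))) (at x)" for x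
    proof -
      have "(*) (flat (k + 2) x - of_nat k * flat (k + 1) x)
          = (\<lambda>u. u * (flat (k + 2) x + (- of_nat k) * flat (k + 1) x))"
        by (simp add: fun_eq_iff)
      then show ?thesis using flat_deriv[of k x] by (simp only: has_field_derivative_def)
    qed
    show "C_k j (\<lambda>x. u * (flat (k + 2) x + (- of_nat k) * flat (k + 1) x))" for u
      by (intro C_k_bilinear[OF bounded_bilinear_mult] C_k_const C_k_add Suc)
  qed
qed

lemma smooth_flat: "smooth (flat k)"
  by (simp add: smooth_def C_k_flat)

section \<open>Smooth cut-offs\<close>

definition smooth_step :: "real \<Rightarrow> real" where
  "smooth_step x = flat 0 x * inverse (flat 0 x + flat 0 (1 - x))"

lemma flat_sum_pos: "0 < flat 0 x + flat 0 (1 - x)"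
  using flat_nonneg[of 0 x] flat_nonneg[of 0 "1 - x"] flat_0_pos[of x 0] flat_0_pos[of "1 - x" 0]
  by (cases "x > 0") auto

lemma smooth_smooth_step: "smooth smooth_step"
  unfolding smooth_step_def[abs_def] using flat_sum_pos less_imp_neq[OF flat_sum_pos]
  by (intro smooth_mult smooth_inverse smooth_add smooth_flat smooth_compose[OF smooth_flat] smooth_diff
      smooth_const smooth_ident) auto

lemma smooth_step_bounds: "0 \<le> smooth_step x" "smooth_step x \<le> 1"
proof -
  note p = flat_sum_pos[of x] flat_nonneg[of 0 x] flat_nonneg[of 0 "1 - x"]
  show "0 \<le> smooth_step x" using p by (simp add: smooth_step_def)
  show "smooth_step x \<le> 1" using p by (simp add: smooth_step_def divide_inverse[symmetric])
qed

lemma smooth_step_eq_0: "x \<le> 0 \<Longrightarrow> smooth_step x = 0"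
  by (simp add: smooth_step_def flat_eq_0)

lemma smooth_step_eq_1: "1 \<le> x \<Longrightarrow> smooth_step x = 1"
  using flat_0_pos[of x 0] by (simp add: smooth_step_def flat_eq_0)

lemma smooth_bump:
  fixes x :: "'a::euclidean_space"
  assumes "0 < r"
  obtains \<psi> :: "'a \<Rightarrow> real" where "smooth \<psi>" "\<And>y. 0 \<le> \<psi> y" "\<And>y. \<psi> y \<le> 1"
    "\<And>y. y \<in> ball x r \<Longrightarrow> \<psi> y = 1" "\<And>y. y \<notin> cball x (2 * r) \<Longrightarrow> \<psi> y = 0"
proof
  \<comment> \<open>The squared norm is smooth at \<open>x\<close> as well. The argument of the step
    is at least 1 up to distance r and at most 0 from distance 2 r on.\<close>
  let ?\<psi> = "\<lambda>y. smooth_step ((4 * r\<^sup>2 - (y - x) \<bullet> (y - x)) * inverse (3 * r\<^sup>2))"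
  show "smooth ?\<psi>"
    by (intro smooth_compose[OF smooth_smooth_step] smooth_mult smooth_diff smooth_inner smooth_const smooth_ident)
  show "0 \<le> ?\<psi> y" "?\<psi> y \<le> 1" for y by (rule smooth_step_bounds)+
  show "?\<psi> y = 1" if "y \<in> ball x r" for y
  proof (rule smooth_step_eq_1)
    have "norm (y - x) < r" using that by (simp add: dist_norm norm_minus_commute)
    then have "(y - x) \<bullet> (y - x) \<le> r\<^sup>2"
      by (simp add: power2_norm_eq_inner[symmetric] power_mono)
    then show "1 \<le> (4 * r\<^sup>2 - (y - x) \<bullet> (y - x)) * inverse (3 * r\<^sup>2)"
      using assms by (simp add: field_simps)
  qed
  show "?\<psi> y = 0" if "y \<notin> cball x (2 * r)" for y
  proof (rule smooth_step_eq_0)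
    have "2 * r < norm (y - x)" using that by (simp add: dist_norm norm_minus_commute)
    then have "(2 * r)\<^sup>2 \<le> (y - x) \<bullet> (y - x)"
      unfolding power2_norm_eq_inner[symmetric] using assms by (intro power_mono) auto
    then show "(4 * r\<^sup>2 - (y - x) \<bullet> (y - x)) * inverse (3 * r\<^sup>2) \<le> 0"
      using assms by (simp add: power_mult_distrib mult_le_0_iff)
  qed
qed

text \<open>The value 1 is attained on a neighbourhood of \<open>K\<close>, so that 1 - \<psi>
  vanishes near \<open>K\<close>; the splitting of test functions below depends on this.\<close>

lemma smooth_Urysohn:
  fixes K U :: "'a::euclidean_space set"
  assumes "compact K" "open U" "K \<subseteq> U"
  obtains \<psi> :: "'a \<Rightarrow> real" and L W where "smooth \<psi>" "\<And>y. 0 \<le> \<psi> y" "\<And>y. \<psi> y \<le> 1"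
    "compact L" "L \<subseteq> U" "\<And>y. y \<notin> L \<Longrightarrow> \<psi> y = 0" "open W" "K \<subseteq> W" "\<And>y. y \<in> W \<Longrightarrow> \<psi> y = 1"
proof -
  have "\<exists>r>0. cball x (2 * r) \<subseteq> U" if x: "x \<in> K" for x
  proof -
    obtain e where "e > 0" "cball x e \<subseteq> U"
      using assms(2,3) x by (meson open_contains_cball subsetD)
    then show ?thesis by (intro exI[of _ "e / 2"]) auto
  qed
  then obtain r where r: "\<And>x. x \<in> K \<Longrightarrow> r x > 0" "\<And>x. x \<in> K \<Longrightarrow> cball x (2 * r x) \<subseteq> U"
    by metis
  have "K \<subseteq> (\<Union>x\<in>K. ball x (r x))" using r(1) by auto
  then obtain D where D: "D \<subseteq> K" "finite D" "K \<subseteq> (\<Union>x\<in>D. ball x (r x))"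
    using compactE_image[OF assms(1), of K "\<lambda>x. ball x (r x)"] by auto
  define P where "P D \<psi> \<longleftrightarrow> smooth \<psi> \<and> (\<forall>y. 0 \<le> \<psi> y \<and> \<psi> y \<le> 1)
      \<and> (\<forall>y. y \<notin> (\<Union>x\<in>D. cball x (2 * r x)) \<longrightarrow> \<psi> y = 0)
      \<and> (\<forall>y\<in>(\<Union>x\<in>D. ball x (r x)). \<psi> y = 1)" for D and \<psi> :: "'a \<Rightarrow> real"
  have "\<exists>\<psi>. P D \<psi>"
    using D(2,1)
  proof (induction D rule: finite_induct)
    case empty
    show ?case by (intro exI[of _ "\<lambda>x. 0"]) (auto simp: smooth_const P_def)
  next
    case (insert x D)
    then obtain \<psi> where P: "P D \<psi>" by auto
    then have \<psi>: "smooth \<psi>" "\<And>y. 0 \<le> \<psi> y" "\<And>y. \<psi> y \<le> 1"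
      "\<And>y. y \<notin> (\<Union>x\<in>D. cball x (2 * r x)) \<Longrightarrow> \<psi> y = 0" "\<And>y. y \<in> (\<Union>x\<in>D. ball x (r x)) \<Longrightarrow> \<psi> y = 1"
      unfolding P_def by auto
    have "r x > 0" using insert r by auto
    then obtain b :: "'a \<Rightarrow> real" where b: "smooth b" "\<And>y. 0 \<le> b y" "\<And>y. b y \<le> 1"
      "\<And>y. y \<in> ball x (r x) \<Longrightarrow> b y = 1" "\<And>y. y \<notin> cball x (2 * r x) \<Longrightarrow> b y = 0"
      by (rule smooth_bump[of "r x" x]) (rule that)
    \<comment> \<open>A smooth substitute for the maximum: it stays in [0, 1], is 1 where one of the
      two functions is 1, and is 0 where both vanish.\<close>
    let ?f = "\<lambda>y. 1 - (1 - \<psi> y) * (1 - b y)"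
    have "0 \<le> ?f y \<and> ?f y \<le> 1" for y
      using \<psi>(2,3)[of y] b(2,3)[of y] mult_le_one[of "1 - \<psi> y" "1 - b y"] by auto
    moreover have "smooth ?f" using \<psi>(1) b(1) by (intro smooth_diff smooth_mult smooth_const)
    moreover have "?f y = 0" if "y \<notin> (\<Union>x\<in>insert x D. cball x (2 * r x))" for y
      using \<psi>(4)[of y] b(5)[of y] that by auto
    moreover have "?f y = 1" if "y \<in> (\<Union>x\<in>insert x D. ball x (r x))" for y
      using \<psi>(5)[of y] b(4)[of y] that by auto
    ultimately have "P (insert x D) ?f" unfolding P_def by blast
    then show ?case by blast
  qed
  then obtain \<psi> where P: "P D \<psi>" by auto
  then have \<psi>: "smooth \<psi>" "\<And>y. 0 \<le> \<psi> y" "\<And>y. \<psi> y \<le> 1"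
      "\<And>y. y \<notin> (\<Union>x\<in>D. cball x (2 * r x)) \<Longrightarrow> \<psi> y = 0" "\<And>y. y \<in> (\<Union>x\<in>D. ball x (r x)) \<Longrightarrow> \<psi> y = 1"
    unfolding P_def by auto
  show ?thesis
  proof (rule that[of \<psi> "\<Union>x\<in>D. cball x (2 * r x)" "\<Union>x\<in>D. ball x (r x)"])
    show "compact (\<Union>x\<in>D. cball x (2 * r x))" using D(2) by (intro compact_UN) auto
    show "(\<Union>x\<in>D. cball x (2 * r x)) \<subseteq> U" using r(2) D(1) by blast
  qed (use \<psi> D in auto)
qed

section \<open>Riesz representation on test functions\<close>

lemma test_function_supportE:
  assumes "test_function U f"
  obtains K where "smooth f" "compact K" "K \<subseteq> U" "\<And>x. x \<notin> K \<Longrightarrow> f x = 0"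
  using assms unfolding test_function_def by auto

lemma test_functionI:
  "smooth f \<Longrightarrow> compact K \<Longrightarrow> K \<subseteq> U \<Longrightarrow> (\<And>x. x \<notin> K \<Longrightarrow> f x = 0) \<Longrightarrow> test_function U f"
  unfolding test_function_def by auto

lemma test_function_mono: "test_function U f \<Longrightarrow> U \<subseteq> V \<Longrightarrow> test_function V f"
  unfolding test_function_def by blast

lemma test_function_zero: "test_function U (\<lambda>x. 0)"
  by (rule test_functionI[of _ "{}"]) (auto simp: smooth_const)

lemma test_function_add:
  assumes "test_function U f" "test_function U g" shows "test_function U (\<lambda>x. f x + g x)"
proof -
  obtain K where K: "smooth f" "compact K" "K \<subseteq> U" "\<And>x. x \<notin> K \<Longrightarrow> f x = 0"
    using assms(1) by (rule test_function_supportE) (rule that)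
  obtain L where L: "smooth g" "compact L" "L \<subseteq> U" "\<And>x. x \<notin> L \<Longrightarrow> g x = 0"
    using assms(2) by (rule test_function_supportE) (rule that)
  show ?thesis by (rule test_functionI[of _ "K \<union> L"]) (use K L in \<open>auto intro: smooth_add\<close>)
qed

lemma test_function_mult:
  assumes "test_function U f" "smooth g" shows "test_function U (\<lambda>x. g x * f x)"
proof -
  obtain K where K: "smooth f" "compact K" "K \<subseteq> U" "\<And>x. x \<notin> K \<Longrightarrow> f x = 0"
    using assms(1) by (rule test_function_supportE) (rule that)
  show ?thesis by (rule test_functionI[of _ K]) (use K assms(2) in \<open>auto intro: smooth_mult\<close>)
qed

lemma test_function_scale: "test_function U f \<Longrightarrow> test_function U (\<lambda>x. c * f x)"
  by (rule test_function_mult[OF _ smooth_const])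

lemma test_function_Urysohn:
  fixes K U :: "(complex ^ 'n) set"
  assumes "compact K" "open U" "K \<subseteq> U"
  obtains \<psi> W where "test_function U \<psi>" "\<And>y. 0 \<le> \<psi> y" "\<And>y. \<psi> y \<le> 1"
    "open W" "K \<subseteq> W" "\<And>y. y \<in> W \<Longrightarrow> \<psi> y = 1"
proof -
  obtain \<psi> :: "complex ^ 'n \<Rightarrow> real" and L W where \<psi>: "smooth \<psi>" "\<And>y. 0 \<le> \<psi> y" "\<And>y. \<psi> y \<le> 1" "compact L" "L \<subseteq> U"
    "\<And>y. y \<notin> L \<Longrightarrow> \<psi> y = 0" "open W" "K \<subseteq> W" "\<And>y. y \<in> W \<Longrightarrow> \<psi> y = 1"
    by (rule smooth_Urysohn[OF assms]) (rule that)
  show ?thesis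
    by (rule that[OF test_functionI[OF \<psi>(1,4,5)] \<psi>(2,3,7,8)]) (use \<psi>(6,9) in auto)
qed

lemma test_function_bounded:
  assumes "test_function U f"
  obtains M where "M > 0" "\<And>x. \<bar>f x\<bar> \<le> M"
proof -
  obtain K where K: "smooth f" "compact K" "K \<subseteq> U" "\<And>x. x \<notin> K \<Longrightarrow> f x = 0"
    using assms by (rule test_function_supportE) (rule that)
  have "compact (f ` K)"
    by (rule compact_continuous_image[OF continuous_on_subset[OF smooth_continuous[OF K(1)]] K(2)]) auto
  then obtain B where B: "\<And>y. y \<in> f ` K \<Longrightarrow> norm y \<le> B"
    using compact_imp_bounded bounded_iff by metis
  have "\<bar>f x\<bar> \<le> max B 1" for x
    using B[of "f x"] K(4)[of x] by (cases "x \<in> K") auto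
  then show ?thesis using that[of "max B 1"] by auto
qed

lemma integrable_test_function:
  assumes "sets M = sets borel" "test_function U f"
    and "\<And>K. compact K \<Longrightarrow> K \<subseteq> U \<Longrightarrow> emeasure M K < \<infinity>"
  shows "integrable M f"
proof -
  obtain K where K: "smooth f" "compact K" "K \<subseteq> U" "\<And>x. x \<notin> K \<Longrightarrow> f x = 0"
    using assms(2) by (rule test_function_supportE) (rule that)
  obtain B where B: "B > 0" "\<And>x. \<bar>f x\<bar> \<le> B" by (rule test_function_bounded[OF assms(2)]) (rule that)
  have Ks: "K \<in> sets M" using K(2) assms(1) by (simp add: borel_compact)
  have "f \<in> borel_measurable borel"
    by (rule borel_measurable_continuous_onI[OF smooth_continuous[OF K(1)]])
  then have m: "f \<in> borel_measurable M" using assms(1) by (simp cong: measurable_cong_sets)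
  have "integrable M (\<lambda>x. B * indicator K x)"
    using Ks assms(3)[OF K(2,3)] by auto
  then show ?thesis
    by (rule Bochner_Integration.integrable_bound[OF _ m]) (use B K(4) in \<open>auto simp: indicator_def\<close>)
qed

section \<open>From a positive functional to a Borel measure\<close>

locale positive_functional =
  fixes \<Omega> :: "(complex ^ 'n) set" and T :: "(complex ^ 'n \<Rightarrow> real) \<Rightarrow> real"
  assumes open_domain: "open \<Omega>"
    and T_add: "\<And>f g. test_function \<Omega> f \<Longrightarrow> test_function \<Omega> g \<Longrightarrow> T (\<lambda>x. f x + g x) = T f + T g"
    and T_scale: "\<And>c f. test_function \<Omega> f \<Longrightarrow> T (\<lambda>x. c * f x) = c * T f"
    and T_nonneg: "\<And>f. test_function \<Omega> f \<Longrightarrow> (\<And>x. 0 \<le> f x) \<Longrightarrow> 0 \<le> T f"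
begin

lemma T_zero: "T (\<lambda>x. 0) = 0"
  using T_scale[OF test_function_zero, of 0] by simp

lemma T_diff: "test_function \<Omega> f \<Longrightarrow> test_function \<Omega> g \<Longrightarrow> T (\<lambda>x. f x - g x) = T f - T g"
  using T_add[OF _ test_function_scale, of f g "-1"] T_scale[of g "-1"] by simp

lemma test_diff: "test_function \<Omega> f \<Longrightarrow> test_function \<Omega> g \<Longrightarrow> test_function \<Omega> (\<lambda>x. f x - g x)"
  using test_function_add[OF _ test_function_scale, of \<Omega> f g "-1"] by simp

lemma T_mono:
  assumes "test_function \<Omega> f" "test_function \<Omega> g" "\<And>x. f x \<le> g x" shows "T f \<le> T g"
  using T_nonneg[OF test_diff[OF assms(2,1)]] T_diff[OF assms(2,1)] assms(3) by simp

lemma T_sum: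
  assumes "\<And>i. i < (N::nat) \<Longrightarrow> test_function \<Omega> (f i)"
  shows "test_function \<Omega> (\<lambda>x. \<Sum>i<N. f i x) \<and> T (\<lambda>x. \<Sum>i<N. f i x) = (\<Sum>i<N. T (f i))"
  using assms
  by (induction N) (auto simp: T_zero T_add test_function_zero intro: test_function_add)

definition open_mass :: "(complex ^ 'n) set \<Rightarrow> ennreal" where
  "open_mass U = (SUP f\<in>{f. test_function (U \<inter> \<Omega>) f \<and> (\<forall>x. 0 \<le> f x \<and> f x \<le> 1)}. ennreal (T f))"

text \<open>
  Only \<open>A \<inter> \<Omega>\<close> is covered, so that the complement of \<open>\<Omega>\<close>, near which the mass may be
  infinite, gets measure 0.
\<close>

definition outer_mass :: "(complex ^ 'n) set \<Rightarrow> ennreal" where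
  "outer_mass A = (INF U\<in>{U. open U \<and> A \<inter> \<Omega> \<subseteq> U}. open_mass U)"

lemma test_Int: "test_function (U \<inter> \<Omega>) f \<Longrightarrow> test_function \<Omega> f"
  by (erule test_function_mono) auto

lemma open_mass_upper:
  "test_function (U \<inter> \<Omega>) f \<Longrightarrow> (\<And>x. 0 \<le> f x) \<Longrightarrow> (\<And>x. f x \<le> 1) \<Longrightarrow> ennreal (T f) \<le> open_mass U"
  unfolding open_mass_def by (rule SUP_upper) auto

lemma open_mass_least:
  "(\<And>f. test_function (U \<inter> \<Omega>) f \<Longrightarrow> (\<And>x. 0 \<le> f x) \<Longrightarrow> (\<And>x. f x \<le> 1) \<Longrightarrow> ennreal (T f) \<le> c) \<Longrightarrow> open_mass U \<le> c"
  unfolding open_mass_def by (rule SUP_least) auto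

lemma open_mass_mono: "U \<inter> \<Omega> \<subseteq> V \<Longrightarrow> open_mass U \<le> open_mass V"
  by (rule open_mass_least, rule open_mass_upper) (auto elim: test_function_mono)

lemma open_mass_empty: "open_mass {} = 0"
proof -
  have "open_mass {} \<le> 0"
  proof (rule open_mass_least)
    fix f :: "complex ^ 'n \<Rightarrow> real" assume "test_function ({} \<inter> \<Omega>) f"
    then obtain K where "K \<subseteq> {}" "\<And>x. x \<notin> K \<Longrightarrow> f x = 0"
      by (elim test_function_supportE) auto
    then have "f = (\<lambda>x. 0)" by auto
    then show "ennreal (T f) \<le> 0" using T_zero by simp
  qed
  then show ?thesis by simp
qed

lemma open_mass_le_T:
  assumes "test_function \<Omega> g" "\<And>x. 0 \<le> g x" "\<And>x. x \<in> U \<Longrightarrow> 1 \<le> g x"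
  shows "open_mass U \<le> ennreal (T g)"
proof (rule open_mass_least)
  fix f assume f: "test_function (U \<inter> \<Omega>) f" "\<And>x. 0 \<le> f x" "\<And>x. f x \<le> 1"
  obtain K where K: "K \<subseteq> U \<inter> \<Omega>" "\<And>x. x \<notin> K \<Longrightarrow> f x = 0"
    using f(1) by (elim test_function_supportE) auto
  have "f x \<le> g x" for x
    using K f(3)[of x] assms(2,3)[of x] by (cases "x \<in> K") force+
  then show "ennreal (T f) \<le> ennreal (T g)"
    by (intro ennreal_leI T_mono test_Int[OF f(1)] assms(1))
qed

lemma outer_mass_open: "open U \<Longrightarrow> outer_mass U = open_mass U"
  unfolding outer_mass_def
  by (intro antisym INF_lower INF_greatest open_mass_mono) auto

lemma outer_mass_mono: "A \<subseteq> B \<Longrightarrow> outer_mass A \<le> outer_mass B"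
  unfolding outer_mass_def by (intro INF_superset_mono) auto

lemma outer_mass_le: "open U \<Longrightarrow> A \<inter> \<Omega> \<subseteq> U \<Longrightarrow> outer_mass A \<le> open_mass U"
  unfolding outer_mass_def by (rule INF_lower) auto

lemma open_mass_Un:
  assumes "open U" "open V" shows "open_mass (U \<union> V) \<le> open_mass U + open_mass V"
proof (rule open_mass_least)
  fix f assume f: "test_function ((U \<union> V) \<inter> \<Omega>) f" "\<And>x. 0 \<le> f x" "\<And>x. f x \<le> 1"
  obtain K where K: "smooth f" "compact K" "K \<subseteq> (U \<union> V) \<inter> \<Omega>" "\<And>x. x \<notin> K \<Longrightarrow> f x = 0"
    using f(1) by (rule test_function_supportE) (rule that)
  \<comment> \<open>The part of the support that \<open>V\<close> misses is a compact subset of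
    \<open>U\<close>. With \<psi> = 1 near it, f \<psi> is supported in \<open>U\<close> and f (1 -
    \<psi>) in \<open>K - W\<close>, hence in \<open>V\<close>.\<close>
  have "compact (K - V)" "open (U \<inter> \<Omega>)" "K - V \<subseteq> U \<inter> \<Omega>"
    using K assms open_domain by (auto intro: compact_diff)
  then obtain \<psi> W where \<psi>: "test_function (U \<inter> \<Omega>) \<psi>" "\<And>y. 0 \<le> \<psi> y" "\<And>y. \<psi> y \<le> 1"
    "open W" "K - V \<subseteq> W" "\<And>y. y \<in> W \<Longrightarrow> \<psi> y = 1"
    by (rule test_function_Urysohn) (rule that)
  have s\<psi>: "smooth \<psi>" using \<psi>(1) by (simp add: test_function_def)
  have g: "test_function (U \<inter> \<Omega>) (\<lambda>x. f x * \<psi> x)"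
    by (rule test_function_mult[OF \<psi>(1) K(1)])
  have h: "test_function (V \<inter> \<Omega>) (\<lambda>x. f x * (1 - \<psi> x))"
    by (rule test_functionI[of _ "K - W"])
      (use \<psi> s\<psi> K in \<open>auto intro!: smooth_mult smooth_diff smooth_const compact_diff\<close>)
  have "T f = T (\<lambda>x. f x * \<psi> x + f x * (1 - \<psi> x))" by (simp add: algebra_simps)
  also have "\<dots> = T (\<lambda>x. f x * \<psi> x) + T (\<lambda>x. f x * (1 - \<psi> x))"
    by (intro T_add test_Int[OF g] test_Int[OF h])
  finally have "ennreal (T f) = ennreal (T (\<lambda>x. f x * \<psi> x)) + ennreal (T (\<lambda>x. f x * (1 - \<psi> x)))"
    using T_nonneg[OF test_Int[OF g]] T_nonneg[OF test_Int[OF h]] f \<psi> by (simp add: ennreal_plus)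
  also have "\<dots> \<le> open_mass U + open_mass V"
    using f \<psi> by (intro add_mono open_mass_upper g h) (auto intro: mult_le_one)
  finally show "ennreal (T f) \<le> open_mass U + open_mass V" .
qed

lemma open_mass_UN_finite:
  assumes "\<And>i. open (U i)" shows "open_mass (\<Union>i<N. U i) \<le> (\<Sum>i<(N::nat). open_mass (U i))"
proof (induction N)
  case (Suc N)
  have "open_mass (\<Union>i<Suc N. U i) = open_mass ((\<Union>i<N. U i) \<union> U N)"
    by (simp add: lessThan_Suc Un_commute)
  also have "\<dots> \<le> open_mass (\<Union>i<N. U i) + open_mass (U N)"
    using assms by (intro open_mass_Un) auto
  also have "\<dots> \<le> (\<Sum>i<N. open_mass (U i)) + open_mass (U N)"
    using Suc by (rule add_right_mono)
  finally show ?case by simp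
qed (simp add: open_mass_empty)

lemma open_mass_UN:
  fixes U :: "nat \<Rightarrow> (complex ^ 'n) set"
  assumes "\<And>i. open (U i)" shows "open_mass (\<Union>i. U i) \<le> (\<Sum>i. open_mass (U i))"
proof (rule open_mass_least)
  fix f assume f: "test_function ((\<Union>i. U i) \<inter> \<Omega>) f" "\<And>x. 0 \<le> f x" "\<And>x. f x \<le> 1"
  obtain K where K: "smooth f" "compact K" "K \<subseteq> (\<Union>i. U i) \<inter> \<Omega>" "\<And>x. x \<notin> K \<Longrightarrow> f x = 0"
    using f(1) by (rule test_function_supportE) (rule that)
  obtain C where C: "finite C" "K \<subseteq> (\<Union>i\<in>C. U i)"
    using compactE_image[OF K(2), of UNIV U] assms K(3) by auto
  obtain N where N: "C \<subseteq> {..<N}"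
    using C(1) finite_nat_iff_bounded by auto
  have "K \<subseteq> (\<Union>i<N. U i) \<inter> \<Omega>" using K(3) C(2) N by blast
  then have "test_function ((\<Union>i<N. U i) \<inter> \<Omega>) f"
    using K by (intro test_functionI[of _ K]) auto
  then have "ennreal (T f) \<le> open_mass (\<Union>i<N. U i)"
    using f by (intro open_mass_upper)
  also have "\<dots> \<le> (\<Sum>i<N. open_mass (U i))" by (rule open_mass_UN_finite[OF assms])
  also have "\<dots> \<le> (\<Sum>i. open_mass (U i))" by (rule sum_le_suminf) auto
  finally show "ennreal (T f) \<le> (\<Sum>i. open_mass (U i))" .
qed

lemma outer_mass_countably_subadditive: "outer_mass (\<Union>i. A i) \<le> (\<Sum>i. outer_mass (A (i::nat)))"
proof (rule ennreal_le_epsilon)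
  fix e :: real assume "0 < e" and fin: "(\<Sum>i. outer_mass (A i)) < top"
  define d where "d i = e * (1/2) ^ Suc i" for i
  have d: "d i > 0" for i using \<open>0 < e\<close> by (simp add: d_def)
  have "\<exists>U. open U \<and> A i \<inter> \<Omega> \<subseteq> U \<and> open_mass U \<le> outer_mass (A i) + ennreal (d i)" for i
  proof -
    have "outer_mass (A i) \<noteq> top"
      using fin ennreal_suminf_lessD[of "\<lambda>i. outer_mass (A i)" top i] by auto
    then have "outer_mass (A i) < outer_mass (A i) + ennreal (d i)"
      using d[of i] ennreal_add_left_cancel_less[of "outer_mass (A i)" 0 "ennreal (d i)"] by simp
    then show ?thesis unfolding outer_mass_def[of "A i"] INF_less_iff
      by (auto intro: less_imp_le)
  qed
  then obtain U where U: "\<And>i. open (U i)" "\<And>i. A i \<inter> \<Omega> \<subseteq> U i" "\<And>i. open_mass (U i) \<le> outer_mass (A i) + ennreal (d i)"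
    by metis
  have "outer_mass (\<Union>i. A i) \<le> open_mass (\<Union>i. U i)"
    using U(1,2) by (intro outer_mass_le) auto
  also have "\<dots> \<le> (\<Sum>i. open_mass (U i))" by (rule open_mass_UN[OF U(1)])
  also have "\<dots> \<le> (\<Sum>i. outer_mass (A i) + ennreal (d i))"
    by (intro suminf_le U(3)) auto
  also have "\<dots> = (\<Sum>i. outer_mass (A i)) + (\<Sum>i. ennreal (d i))"
    by (rule suminf_add[symmetric]) auto
  also have "(\<Sum>i. ennreal (d i)) = ennreal e"
  proof -
    have "d sums (e * 1)" unfolding d_def by (intro sums_mult power_half_series)
    then show ?thesis using d by (subst suminf_ennreal_eq[of d e]) (auto intro: less_imp_le)
  qed
  finally show "outer_mass (\<Union>i. A i) \<le> (\<Sum>i. outer_mass (A i)) + ennreal e" .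
qed

lemma outer_measure_outer_mass: "outer_measure_space (Pow UNIV) outer_mass"
  unfolding outer_measure_space_def
proof (intro conjI)
  show "positive (Pow UNIV) outer_mass"
    using outer_mass_open[of "{}"] by (simp add: positive_def open_mass_empty)
  show "increasing (Pow UNIV) outer_mass" by (simp add: increasing_def outer_mass_mono)
  show "countably_subadditive (Pow UNIV) outer_mass"
    by (simp add: countably_subadditive_def outer_mass_countably_subadditive)
qed

lemma outer_mass_Un: "outer_mass (A \<union> B) \<le> outer_mass A + outer_mass B"
proof -
  interpret sigma_algebra UNIV "Pow UNIV" by (rule sigma_algebra_Pow)
  have "subadditive (Pow UNIV) outer_mass"
    using outer_measure_outer_mass countably_subadditive_subadditive unfolding outer_measure_space_def by blast
  moreover have "A \<union> B = A \<union> (B - A)" by auto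
  ultimately have "outer_mass (A \<union> B) \<le> outer_mass A + outer_mass (B - A)"
    unfolding subadditive_def by (metis Diff_disjoint Pow_UNIV UNIV_I)
  also have "\<dots> \<le> outer_mass A + outer_mass B" by (intro add_left_mono outer_mass_mono) auto
  finally show ?thesis .
qed

text \<open>If \<open>f\<close> is carried by a compact \<open>K\<close> in
  \<open>U \<inter> G\<close> and \<open>g\<close> is supported in \<open>U - K\<close>, then f + g
  \<le> 1; moreover \<open>U - K\<close> is an open set containing \<open>U - G\<close>. The
  supremum over \<open>g\<close>, then over \<open>f\<close>, gives the nontrivial half of
  Caratheodory's condition.\<close>

lemma open_mass_split:
  assumes "open U" "open G" shows "open_mass (U \<inter> G) + outer_mass (U - G) \<le> open_mass U"
proof -
  have fg: "ennreal (T f) + outer_mass (U - G) \<le> open_mass U"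
    if f: "test_function ((U \<inter> G) \<inter> \<Omega>) f" "\<And>x. 0 \<le> f x" "\<And>x. f x \<le> 1" for f
  proof -
    obtain K where K: "smooth f" "compact K" "K \<subseteq> (U \<inter> G) \<inter> \<Omega>" "\<And>x. x \<notin> K \<Longrightarrow> f x = 0"
      using f(1) by (rule test_function_supportE) (rule that)
    have "outer_mass (U - G) \<le> open_mass (U - K)"
      using K assms by (intro outer_mass_le) (auto intro: compact_imp_closed)
    moreover have "ennreal (T g) + ennreal (T f) \<le> open_mass U" if
      g: "test_function ((U - K) \<inter> \<Omega>) g" "\<And>x. 0 \<le> g x" "\<And>x. g x \<le> 1" for g
    proof -
            obtain L where L: "smooth g" "compact L" "L \<subseteq> (U - K) \<inter> \<Omega>" "\<And>x. x \<notin> L \<Longrightarrow> g x = 0"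
        using g(1) by (rule test_function_supportE) (rule that)
      have fU: "test_function (U \<inter> \<Omega>) f" and gU: "test_function (U \<inter> \<Omega>) g"
        using f(1) g(1) by (auto elim: test_function_mono)
      have "f x + g x \<le> 1" for x
        using f(3)[of x] g(3)[of x] K(4)[of x] L(3) L(4)[of x] by (cases "x \<in> K") force+
      then have "ennreal (T (\<lambda>x. f x + g x)) \<le> open_mass U"
        using f g by (intro open_mass_upper test_function_add fU gU) auto
      then show "ennreal (T g) + ennreal (T f) \<le> open_mass U"
        using T_add[OF test_Int[OF fU] test_Int[OF gU]] T_nonneg[OF test_Int[OF fU] f(2)]
          T_nonneg[OF test_Int[OF gU] g(2)] by (simp add: ennreal_plus[symmetric] add.commute del: ennreal_plus)
    qed
    then have "open_mass (U - K) + ennreal (T f) \<le> open_mass U"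
      unfolding open_mass_def[of "U - K"] using test_function_zero[of "(U - K) \<inter> \<Omega>"]
      by (subst ennreal_SUP_add_left[symmetric]) (auto intro!: SUP_least)
    ultimately show ?thesis
      by (metis add.commute add_left_mono order_trans)
  qed
  have "open_mass (U \<inter> G) + outer_mass (U - G)
      = (SUP f\<in>{f. test_function ((U \<inter> G) \<inter> \<Omega>) f \<and> (\<forall>x. 0 \<le> f x \<and> f x \<le> 1)}. ennreal (T f) + outer_mass (U - G))"
    unfolding open_mass_def[of "U \<inter> G"] using test_function_zero[of "(U \<inter> G) \<inter> \<Omega>"]
    by (subst ennreal_SUP_add_left) auto
  also have "\<dots> \<le> open_mass U" by (intro SUP_least fg) auto
  finally show ?thesis .
qed

lemma open_in_lambda_system: "open G \<Longrightarrow> G \<in> lambda_system UNIV (Pow UNIV) outer_mass"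
proof -
  assume G: "open G"
  interpret sigma_algebra UNIV "Pow UNIV" by (rule sigma_algebra_Pow)
  have "outer_mass (A \<inter> G) + outer_mass (A - G) = outer_mass A" for A
  proof (rule antisym)
    show "outer_mass (A \<inter> G) + outer_mass (A - G) \<le> outer_mass A"
      unfolding outer_mass_def[of A]
    proof (rule INF_greatest, clarify)
      fix U assume U: "open U" "A \<inter> \<Omega> \<subseteq> U"
      have "outer_mass (A \<inter> G) \<le> open_mass (U \<inter> G)" using U G by (intro outer_mass_le) auto
      moreover have "outer_mass (A - G) \<le> outer_mass (U - G)"
        unfolding outer_mass_def using U by (intro INF_superset_mono) auto
      ultimately show "outer_mass (A \<inter> G) + outer_mass (A - G) \<le> open_mass U"
        using open_mass_split[OF U(1) G] add_mono order_trans by blast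
    qed
    show "outer_mass A \<le> outer_mass (A \<inter> G) + outer_mass (A - G)"
      using outer_mass_Un[of "A \<inter> G" "A - G"] by (simp add: Int_Diff_Un)
  qed
  then show ?thesis unfolding lambda_system_eq by simp
qed

definition riesz_measure :: "(complex ^ 'n) measure" where
  "riesz_measure = measure_of UNIV (sets borel) outer_mass"

lemma sets_riesz [simp]: "sets riesz_measure = sets borel"
  unfolding riesz_measure_def by (metis sets.sets_measure_of_eq space_borel)

lemma space_riesz [simp]: "space riesz_measure = UNIV"
  by (metis sets_eq_imp_space_eq sets_riesz space_borel)

lemma emeasure_riesz: "A \<in> sets borel \<Longrightarrow> emeasure riesz_measure A = outer_mass A"
proof -
  assume A: "A \<in> sets borel"
  interpret sigma_algebra UNIV "Pow UNIV" by (rule sigma_algebra_Pow)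
  let ?L = "lambda_system UNIV (Pow UNIV) outer_mass"
  have ms: "measure_space UNIV ?L outer_mass" by (rule caratheodory_lemma[OF outer_measure_outer_mass])
  then have L: "sigma_algebra UNIV ?L" by (simp add: measure_space_def)
  have sub: "sets borel \<subseteq> ?L"
  proof -
    have "sets borel = sigma_sets (UNIV :: (complex ^ 'n) set) {S. open S}"
      by (simp add: borel_def)
    then show ?thesis
      using sigma_algebra.sigma_sets_subset[OF L, of "{S. open S}"] open_in_lambda_system by blast
  qed
  show ?thesis unfolding riesz_measure_def
  proof (rule emeasure_measure_of_sigma[OF _ _ _ A])
    show "sigma_algebra UNIV (sets borel)" by (metis sets.sigma_algebra_axioms space_borel)
    show "positive (sets borel) outer_mass" using ms by (simp add: measure_space_def positive_def)
    show "countably_additive (sets borel) outer_mass"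
      using ms sub unfolding measure_space_def countably_additive_def
      by (metis (no_types, lifting) subset_trans subsetD)
  qed
qed

lemma emeasure_riesz_open: "open U \<Longrightarrow> emeasure riesz_measure U = open_mass U"
  by (simp add: emeasure_riesz outer_mass_open)

lemma emeasure_riesz_compact:
  assumes "compact K" "K \<subseteq> \<Omega>" shows "emeasure riesz_measure K < \<infinity>"
proof -
  obtain \<psi> W where \<psi>: "test_function \<Omega> \<psi>" "\<And>y. 0 \<le> \<psi> y" "\<And>y. \<psi> y \<le> 1"
    "open W" "K \<subseteq> W" "\<And>y. y \<in> W \<Longrightarrow> \<psi> y = 1"
    by (rule test_function_Urysohn[OF assms(1) open_domain assms(2)]) (rule that)
  have "open_mass W \<le> ennreal (T \<psi>)" using \<psi> by (intro open_mass_le_T) auto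
  moreover have "emeasure riesz_measure K \<le> emeasure riesz_measure W"
    using \<psi> by (intro emeasure_mono) auto
  ultimately show ?thesis
    using \<psi>(4) by (simp add: emeasure_riesz_open) (metis ennreal_less_top le_less_trans order_trans)
qed

lemma emeasure_riesz_Compl: "emeasure riesz_measure (- \<Omega>) = 0"
proof -
  have "outer_mass (- \<Omega>) \<le> open_mass {}" by (intro outer_mass_le) auto
  then show ?thesis
    using open_domain by (simp add: emeasure_riesz open_mass_empty)
qed

lemma riesz_integrable: "test_function \<Omega> f \<Longrightarrow> integrable riesz_measure f"
  by (rule integrable_test_function[OF sets_riesz _ emeasure_riesz_compact])

text \<open>The functional and the integral obey the same bounds in terms of masses of open sets, so
  once both are squeezed between the same masses they can be compared.\<close>

lemma riesz_bounds_open: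
  assumes "open U" "emeasure riesz_measure U < \<infinity>"
  shows "test_function (U \<inter> \<Omega>) g \<Longrightarrow> (\<And>x. 0 \<le> g x) \<Longrightarrow> (\<And>x. g x \<le> 1) \<Longrightarrow>
      T g \<le> measure riesz_measure U \<and> (LINT x|riesz_measure. g x) \<le> measure riesz_measure U"
    and "test_function \<Omega> g \<Longrightarrow> (\<And>x. 0 \<le> g x) \<Longrightarrow> (\<And>x. x \<in> U \<Longrightarrow> 1 \<le> g x) \<Longrightarrow>
      measure riesz_measure U \<le> T g \<and> measure riesz_measure U \<le> (LINT x|riesz_measure. g x)"
proof -
  have fin: "ennreal (measure riesz_measure U) = open_mass U"
    using assms by (simp add: emeasure_eq_ennreal_measure[symmetric] emeasure_riesz_open less_top[symmetric])
  have ind: "integrable riesz_measure (indicator U :: _ \<Rightarrow> real)"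
    using assms by auto
  have int: "(LINT x|riesz_measure. indicator U x) = measure riesz_measure U" by simp
  show "T g \<le> measure riesz_measure U \<and> (LINT x|riesz_measure. g x) \<le> measure riesz_measure U"
    if g: "test_function (U \<inter> \<Omega>) g" "\<And>x. 0 \<le> g x" "\<And>x. g x \<le> 1"
  proof
    have "ennreal (T g) \<le> ennreal (measure riesz_measure U)"
      unfolding fin by (rule open_mass_upper[OF g])
    then show "T g \<le> measure riesz_measure U" using measure_nonneg[of riesz_measure U] by (auto simp: ennreal_le_iff2)
    obtain K where "K \<subseteq> U \<inter> \<Omega>" "\<And>x. x \<notin> K \<Longrightarrow> g x = 0"
      using g(1) by (elim test_function_supportE) auto
    then have "g x \<le> indicator U x" for x
      using g(3)[of x] by (cases "x \<in> K") (auto simp: indicator_def)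
    then show "(LINT x|riesz_measure. g x) \<le> measure riesz_measure U"
      unfolding int[symmetric] by (intro integral_mono riesz_integrable test_Int[OF g(1)] ind)
  qed
  show "measure riesz_measure U \<le> T g \<and> measure riesz_measure U \<le> (LINT x|riesz_measure. g x)"
    if g: "test_function \<Omega> g" "\<And>x. 0 \<le> g x" "\<And>x. x \<in> U \<Longrightarrow> 1 \<le> g x"
  proof
    have "ennreal (measure riesz_measure U) \<le> ennreal (T g)"
      unfolding fin by (rule open_mass_le_T[OF g])
    then show "measure riesz_measure U \<le> T g"
      using T_nonneg[OF g(1,2)] by simp
    have "indicator U x \<le> g x" for x
      using g(2,3)[of x] by (auto simp: indicator_def)
    then show "measure riesz_measure U \<le> (LINT x|riesz_measure. g x)"
      unfolding int[symmetric] by (intro integral_mono riesz_integrable g(1) ind)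
  qed
qed

text \<open>
  Layer cake: up to \<open>e\<close>, \<open>f\<close> is the sum of the smoothed indicators \<open>e * smooth_step (f / e - k)\<close> of
  the sets \<open>f > k e\<close>, on which the functional and the integral are compared through the masses of
  neighbouring sets.
\<close>

lemma smooth_step_sum:
  "0 \<le> y \<Longrightarrow> y \<le> real N \<Longrightarrow> \<bar>(\<Sum>k<N. smooth_step (y - real k)) - y\<bar> \<le> 1"
proof (induction N arbitrary: y)
  case (Suc N)
  have e: "(\<Sum>k<Suc N. smooth_step (y - real k)) = smooth_step y + (\<Sum>k<N. smooth_step ((y - 1) - real k))"
    by (subst sum.lessThan_Suc_shift) (simp add: algebra_simps)
  show ?case
  proof (cases "1 \<le> y")
    case True
    then show ?thesis using Suc.IH[of "y - 1"] Suc.prems unfolding e by (simp add: smooth_step_eq_1)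
  next
    case False
    have "(\<Sum>k<N. smooth_step ((y - 1) - real k)) = 0"
      by (rule sum.neutral) (use False in \<open>auto intro!: smooth_step_eq_0\<close>)
    then show ?thesis using False Suc.prems smooth_step_bounds[of y] unfolding e by (simp add: abs_if)
  qed
qed simp

lemma riesz_nonneg:
  assumes f: "test_function \<Omega> f" "\<And>x. 0 \<le> f x"
  shows "(LINT x|riesz_measure. f x) = T f"
proof -
  let ?I = "\<lambda>f. LINT x|riesz_measure. f x"
  obtain K where K: "smooth f" "compact K" "K \<subseteq> \<Omega>" "\<And>x. x \<notin> K \<Longrightarrow> f x = 0"
    using f(1) by (rule test_function_supportE) (rule that)
  obtain M where M: "M > 0" "\<And>x. \<bar>f x\<bar> \<le> M" by (rule test_function_bounded[OF f(1)]) (rule that)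
  obtain \<psi> W where \<psi>: "test_function \<Omega> \<psi>" "\<And>y. 0 \<le> \<psi> y" "\<And>y. \<psi> y \<le> 1"
    "open W" "K \<subseteq> W" "\<And>y. y \<in> W \<Longrightarrow> \<psi> y = 1"
    by (rule test_function_Urysohn[OF K(2) open_domain K(3)]) (rule that)
  let ?D = "T \<psi>"
  have bound: "\<bar>?I f - T f\<bar> \<le> e * (3 * ?D + ?I \<psi>)" if e: "e > 0" for e
  proof -
    obtain N :: nat where N: "M / e \<le> real N" using real_arch_simple by blast
    have f_N: "0 \<le> f x * inverse e" "f x * inverse e \<le> real N" for x
    proof -
      show "0 \<le> f x * inverse e" using f(2)[of x] e by simp
      have "f x * inverse e \<le> M / e"
        using M(2)[of x] e by (simp add: divide_inverse mult_right_mono abs_le_iff)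
      then show "f x * inverse e \<le> real N" using N by simp
    qed
    define s where "s k x = smooth_step (f x * inverse e - real k)" for k x
    have s_smooth: "smooth (s k)" for k
      unfolding s_def by (intro smooth_compose[OF smooth_smooth_step] smooth_diff smooth_mult smooth_const K(1))
    have s01: "0 \<le> s k x" "s k x \<le> 1" for k x
      unfolding s_def by (rule smooth_step_bounds)+
    have s_K: "s k x = 0" if "x \<notin> K" for k x
      unfolding s_def using K(4)[OF that] by (intro smooth_step_eq_0) auto
    have ts: "test_function \<Omega> (s k)" for k
      by (rule test_functionI[OF s_smooth K(2,3) s_K])
    define V where "V k = {x. real k * e < f x}" for k
    \<comment> \<open>\<open>s k\<close> is 1 on \<open>V (k + 1)\<close> and, for k > 0, supported
      in \<open>V (k - 1)\<close>; so its integral and its value under \<open>T\<close> both lie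
      between \<open>l (k + 2)\<close> and \<open>l k\<close>. For k = 0 there is no such set, and
      the mass of the Urysohn function takes its place.\<close>
    define l where "l k = (case k of 0 \<Rightarrow> ?D | Suc j \<Rightarrow> measure riesz_measure (V j))" for k
    have cont: "continuous_on UNIV f" by (rule smooth_continuous[OF K(1)])
    have oV: "open (V k)" for k
      unfolding V_def using cont by (intro open_Collect_less continuous_on_const)
    have V_K: "V k \<subseteq> K" for k
    proof
      fix x assume x: "x \<in> V k"
      have "0 \<le> real k * e" using e by simp
      then show "x \<in> K" using x K(4)[of x] unfolding V_def by force
    qed
    have fV: "emeasure riesz_measure (V k) < \<infinity>" for k
      using emeasure_mono[OF V_K, of riesz_measure k] emeasure_riesz_compact[OF K(2,3)] K(2)
      by (auto simp: borel_compact intro: le_less_trans)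
    have Suc_up: "T (s (Suc k)) \<le> l (Suc k) \<and> ?I (s (Suc k)) \<le> l (Suc k)" for k
    proof -
      have cl: "closed {x. real (Suc k) * e \<le> f x}"
        using cont by (intro closed_Collect_le continuous_on_const)
      have "test_function (V k \<inter> \<Omega>) (s (Suc k))"
      proof (rule test_functionI[OF s_smooth])
        show "compact (K \<inter> {x. real (Suc k) * e \<le> f x})" using K(2) cl by (rule compact_Int_closed)
        show "K \<inter> {x. real (Suc k) * e \<le> f x} \<subseteq> V k \<inter> \<Omega>"
          using K(3) e by (auto simp: V_def algebra_simps)
        show "s (Suc k) x = 0" if "x \<notin> K \<inter> {x. real (Suc k) * e \<le> f x}" for x
        proof (cases "x \<in> K")
          case True
          then have "f x < real (Suc k) * e" using that by auto
          then have "f x * inverse e < real (Suc k)" using e by (simp add: field_simps)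
          then show ?thesis unfolding s_def by (intro smooth_step_eq_0) simp
        qed (rule s_K)
      qed
      then show ?thesis
        using riesz_bounds_open(1)[OF oV fV] s01 by (simp add: l_def)
    qed
    have zero_up: "T (s 0) \<le> l 0 \<and> ?I (s 0) \<le> l 0"
    proof -
      have le: "s 0 x \<le> \<psi> x" for x
        using s01(2)[of 0 x] s_K[of x 0] \<psi>(2)[of x] \<psi>(5,6) by (cases "x \<in> K") auto
      have "T (s 0) \<le> ?D" by (intro T_mono ts \<psi>(1) le)
      moreover have "?I (s 0) \<le> measure riesz_measure (V 0)"
      proof -
        have "s 0 x \<le> indicator (V 0) x" for x
        proof (cases "x \<in> V 0")
          case False
          then show ?thesis using f(2)[of x] by (simp add: V_def s_def smooth_step_eq_0)
        qed (simp add: s01)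
        moreover have "integrable riesz_measure (indicator (V 0) :: _ \<Rightarrow> real)"
          using oV fV by auto
        ultimately have "?I (s 0) \<le> (LINT x|riesz_measure. indicator (V 0) x)"
          by (intro integral_mono riesz_integrable[OF ts])
        then show ?thesis by simp
      qed
      moreover have "measure riesz_measure (V 0) \<le> ?D"
        using riesz_bounds_open(2)[OF oV fV \<psi>(1), of 0] \<psi>(2,5,6) V_K[of 0] by force
      ultimately show ?thesis by (simp add: l_def)
    qed
    have up: "T (s k) \<le> l k" "?I (s k) \<le> l k" for k
      using Suc_up zero_up by (cases k; blast)+
    have low: "l (k + 2) \<le> T (s k)" "l (k + 2) \<le> ?I (s k)" for k
    proof -
      have "1 \<le> s k x" if "x \<in> V (Suc k)" for x
      proof -
        have "real (Suc k) \<le> f x * inverse e" using that e by (simp add: V_def field_simps)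
        then show ?thesis unfolding s_def by (subst smooth_step_eq_1) auto
      qed
      from riesz_bounds_open(2)[OF oV fV ts s01(1) this]
      show "l (k + 2) \<le> T (s k)" "l (k + 2) \<le> ?I (s k)" by (simp_all add: l_def)
    qed
    define Q where "Q x = (\<Sum>k<N. s k x)" for x
    have tQ: "test_function \<Omega> Q" and TQ: "T Q = (\<Sum>k<N. T (s k))"
      using T_sum[of N s] ts unfolding Q_def[abs_def] by auto
    have IQ: "?I Q = (\<Sum>k<N. ?I (s k))"
      unfolding Q_def by (intro Bochner_Integration.integral_sum riesz_integrable ts)
    have "\<bar>?I Q - T Q\<bar> \<le> (\<Sum>k<N. \<bar>?I (s k) - T (s k)\<bar>)"
      unfolding IQ TQ sum_subtractf[symmetric] by (rule sum_abs)
    also have "\<dots> \<le> (\<Sum>k<N. l k - l (k + 2))"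
      by (rule sum_mono) (use up low in \<open>smt (verit)\<close>)
    \<comment> \<open>Telescoping with step 2: the error is bounded independently of the number of
      layers, and multiplying by \<open>e\<close> makes it small.\<close>
    also have "\<dots> = l 0 + l 1 - l N - l (N + 1)"
      by (induction N) auto
    also have "\<dots> \<le> 2 * ?D"
    proof -
      have l1: "l 1 \<le> ?D"
        using riesz_bounds_open(2)[OF oV fV \<psi>(1), of 0] \<psi>(2,5,6) V_K[of 0] by (force simp: l_def)
      have "0 \<le> l k" for k
        using T_nonneg[OF \<psi>(1) \<psi>(2)] by (simp add: l_def split: nat.split)
      from this[of N] this[of "N + 1"] l1 show ?thesis by (simp add: l_def[of 0])
    qed
    finally have QQ: "\<bar>?I Q - T Q\<bar> \<le> 2 * ?D" .
    have Qf: "\<bar>e * Q x - f x\<bar> \<le> e * \<psi> x" for x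
    proof (cases "x \<in> K")
      case True
      have "\<bar>Q x - f x * inverse e\<bar> \<le> 1"
        unfolding Q_def s_def by (rule smooth_step_sum[OF f_N])
      then have "e * \<bar>Q x - f x * inverse e\<bar> \<le> e * 1" using e by (intro mult_left_mono) auto
      moreover have "e * Q x - f x = e * (Q x - f x * inverse e)"
        using e by (simp add: right_diff_distrib)
      then have "\<bar>e * Q x - f x\<bar> = e * \<bar>Q x - f x * inverse e\<bar>"
        using e by (simp only: abs_mult abs_of_pos)
      ultimately show ?thesis using True \<psi>(5,6) by auto
    next
      case False
      then show ?thesis using K(4) s_K e \<psi>(2) by (simp add: Q_def)
    qed
    have T1: "\<bar>e * T Q - T f\<bar> \<le> e * ?D"
    proof -
      have "T (\<lambda>x. e * Q x - f x) \<le> T (\<lambda>x. e * \<psi> x)" "T (\<lambda>x. f x - e * Q x) \<le> T (\<lambda>x. e * \<psi> x)"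
        using Qf by (intro T_mono test_diff test_function_scale tQ \<psi>(1) f(1); smt (verit))+
      then show ?thesis
        using T_diff[OF test_function_scale[OF tQ, of e] f(1)] T_diff[OF f(1) test_function_scale[OF tQ, of e]]
          T_scale[OF tQ, of e] T_scale[OF \<psi>(1), of e] by (simp add: abs_le_iff)
    qed
    have I1: "\<bar>e * ?I Q - ?I f\<bar> \<le> e * ?I \<psi>"
    proof -
      have "\<bar>?I (\<lambda>x. e * Q x - f x)\<bar> \<le> ?I (\<lambda>x. \<bar>e * Q x - f x\<bar>)"
        by (rule integral_abs_bound)
      also have "\<dots> \<le> ?I (\<lambda>x. e * \<psi> x)"
        using Qf by (intro integral_mono integrable_abs Bochner_Integration.integrable_diff integrable_mult_right riesz_integrable tQ f(1) \<psi>(1))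
      finally show ?thesis
        using riesz_integrable[OF tQ] riesz_integrable[OF f(1)] by simp
    qed
    have "\<bar>e * ?I Q - e * T Q\<bar> \<le> e * (2 * ?D)"
      using QQ e mult_left_mono[of "\<bar>?I Q - T Q\<bar>" "2 * ?D" e]
      by (simp add: right_diff_distrib[symmetric] abs_mult)
    then show ?thesis using T1 I1 by (simp add: algebra_simps abs_le_iff)
  qed
  have "\<bar>?I f - T f\<bar> \<le> 0"
  proof (rule field_le_epsilon)
    fix d :: real assume "d > 0"
    define c where "c = 3 * ?D + ?I \<psi>"
    have "c \<ge> 0" unfolding c_def using T_nonneg[OF \<psi>(1) \<psi>(2)] \<psi>(2) by (simp add: integral_nonneg)
    have "\<bar>?I f - T f\<bar> \<le> d / (c + 1) * c"
      using bound[of "d / (c + 1)"] \<open>d > 0\<close> \<open>c \<ge> 0\<close> by (simp add: c_def)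
    also have "\<dots> \<le> d" using \<open>d > 0\<close> \<open>c \<ge> 0\<close> by (simp add: field_simps)
    finally show "\<bar>?I f - T f\<bar> \<le> 0 + d" by simp
  qed
  then show ?thesis by simp
qed

theorem riesz_representation:
  assumes f: "test_function \<Omega> f"
  shows "(LINT x|riesz_measure. f x) = T f"
proof -
  obtain K where K: "smooth f" "compact K" "K \<subseteq> \<Omega>" "\<And>x. x \<notin> K \<Longrightarrow> f x = 0"
    using f by (rule test_function_supportE) (rule that)
  obtain M where M: "M > 0" "\<And>x. \<bar>f x\<bar> \<le> M" by (rule test_function_bounded[OF f]) (rule that)
  obtain \<psi> W where \<psi>: "test_function \<Omega> \<psi>" "\<And>y. 0 \<le> \<psi> y" "\<And>y. \<psi> y \<le> 1"
    "open W" "K \<subseteq> W" "\<And>y. y \<in> W \<Longrightarrow> \<psi> y = 1"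
    by (rule test_function_Urysohn[OF K(2) open_domain K(3)]) (rule that)
  \<comment> \<open>The function is the difference of f + M \<psi> and M \<psi>, which are both
    nonnegative because \<psi> = 1 on the support and M bounds |f|.\<close>
  have t: "test_function \<Omega> (\<lambda>x. M * \<psi> x)" by (rule test_function_scale[OF \<psi>(1)])
  have "0 \<le> f x + M * \<psi> x" for x
  proof (cases "x \<in> K")
    case True
    then show ?thesis using M(2)[of x] \<psi>(5,6) by (auto simp: abs_le_iff)
  qed (use K(4) M(1) \<psi>(2) in simp)
  then have "(LINT x|riesz_measure. f x + M * \<psi> x) = T (\<lambda>x. f x + M * \<psi> x)"
    by (intro riesz_nonneg test_function_add f t)
  moreover have "(LINT x|riesz_measure. M * \<psi> x) = T (\<lambda>x. M * \<psi> x)"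
    using M(1) \<psi>(2) by (intro riesz_nonneg t) auto
  ultimately show ?thesis
    using T_add[OF f t] riesz_integrable[OF f] riesz_integrable[OF t]
    by (simp add: Bochner_Integration.integral_add)
qed

end

text \<open>Integrals of test functions determine the masses of open subsets of \<Omega>. These form
  an intersection-stable generator, and an exhaustion by interiors of compact sets supplies the
  finiteness needed to extend the equality from it.\<close>

lemma representing_measure_unique:
  fixes \<Omega> :: "(complex ^ 'n) set"
  assumes "open \<Omega>"
    and "sets M = sets borel" "sets N = sets borel"
    and "emeasure M (- \<Omega>) = 0" "emeasure N (- \<Omega>) = 0"
    and finM: "\<And>K. compact K \<Longrightarrow> K \<subseteq> \<Omega> \<Longrightarrow> emeasure M K < \<infinity>"
    and finN: "\<And>K. compact K \<Longrightarrow> K \<subseteq> \<Omega> \<Longrightarrow> emeasure N K < \<infinity>"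
    and eq: "\<And>f. test_function \<Omega> f \<Longrightarrow> (LINT x|M. f x) = (LINT x|N. f x)"
  shows "M = N"
proof -
  have le: "emeasure M U \<le> emeasure N U"
    if M: "sets M = sets borel" "\<And>K. compact K \<Longrightarrow> K \<subseteq> \<Omega> \<Longrightarrow> emeasure M K < \<infinity>"
      and N: "sets N = sets borel" "\<And>K. compact K \<Longrightarrow> K \<subseteq> \<Omega> \<Longrightarrow> emeasure N K < \<infinity>"
      and eq: "\<And>f. test_function \<Omega> f \<Longrightarrow> (LINT x|M. f x) = (LINT x|N. f x)"
      and U: "open U" "U \<subseteq> \<Omega>" for M N :: "(complex ^ 'n) measure" and U
  proof -
    obtain C where C: "\<And>k::nat. compact (C k)" "\<And>k. C k \<subseteq> U" "\<And>k. C k \<subseteq> interior (C (Suc k))" "\<Union>(range C) = U"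
      using open_Union_compact_subsets[OF U(1)] by metis
    have inc: "incseq C" using C(3) interior_subset by (intro incseq_SucI) blast
    have Cs: "range C \<subseteq> sets M" using M(1) C(1) by (auto simp: borel_compact)
    have "emeasure M (C k) \<le> emeasure N U" for k
    proof -
      \<comment> \<open>A cut-off between \<open>C k\<close> and a compact \<open>L\<close> inside
        \<open>U\<close> transfers the estimate: M(C k) \<le> \<integral> \<psi> dM = \<integral>
        \<psi> dN \<le> N(L) \<le> N(U).\<close>
      obtain \<psi> W where \<psi>: "test_function U \<psi>" "\<And>y. 0 \<le> \<psi> y" "\<And>y. \<psi> y \<le> 1"
        "open W" "C k \<subseteq> W" "\<And>y. y \<in> W \<Longrightarrow> \<psi> y = 1"
        by (rule test_function_Urysohn[OF C(1) U(1) C(2)]) (rule that)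
      have t: "test_function \<Omega> \<psi>" by (rule test_function_mono[OF \<psi>(1) U(2)])
      obtain L where L: "compact L" "L \<subseteq> U" "\<And>y. y \<notin> L \<Longrightarrow> \<psi> y = 0"
        using \<psi>(1) unfolding test_function_def by auto
      have iM: "integrable M \<psi>" using M t by (intro integrable_test_function[of M \<Omega>])
      have iN: "integrable N \<psi>" using N t by (intro integrable_test_function[of N \<Omega>])
      have CM: "C k \<in> sets M" and UN: "L \<in> sets N"
        using Cs N(1) U(1) L(1) by (auto simp: borel_compact)
      have fC: "emeasure M (C k) < \<infinity>" using M(2) C(1,2) U(2) by blast
      have fL: "emeasure N L < \<infinity>" using N(2) L(1,2) U(2) by blast
      have iC: "integrable M (indicator (C k) :: _ \<Rightarrow> real)" and iL: "integrable N (indicator L :: _ \<Rightarrow> real)"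
        using CM fC UN fL by auto
      have "measure M (C k) = (LINT x|M. indicator (C k) x)" using CM by simp
      also have "\<dots> \<le> (LINT x|M. \<psi> x)"
        using \<psi> by (intro integral_mono iM iC) (auto simp: indicator_def)
      also have "\<dots> = (LINT x|N. \<psi> x)" by (rule eq[OF t])
      also have "\<dots> \<le> (LINT x|N. indicator L x)"
        using \<psi> L by (intro integral_mono iN iL) (auto simp: indicator_def)
      also have "\<dots> = measure N L" using UN by simp
      finally have "emeasure M (C k) \<le> emeasure N L"
        using fC fL by (simp add: emeasure_eq_ennreal_measure less_top[symmetric])
      also have "\<dots> \<le> emeasure N U"
        using L(2) N(1) U(1) by (intro emeasure_mono) auto
      finally show ?thesis .
    qed
    moreover have "(SUP k. emeasure M (C k)) = emeasure M U"
      using SUP_emeasure_incseq[OF Cs inc] C(4) by simp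
    ultimately show ?thesis by (metis SUP_least)
  qed
  let ?E = "{U. open U \<and> U \<subseteq> \<Omega>}"
  have sets: "sets (restrict_space P \<Omega>) = sigma_sets \<Omega> ?E" if "sets P = sets borel" for P :: "(complex ^ 'n) measure"
  proof -
    have "sets (restrict_space P \<Omega>) = (\<inter>) \<Omega> ` sigma_sets UNIV {S. open S}"
      using that by (simp add: sets_restrict_space borel_def)
    also have "\<dots> = sigma_sets \<Omega> ((\<inter>) \<Omega> ` {S. open S})"
      using assms(1) by (intro sigma_sets_Int) auto
    also have "(\<inter>) \<Omega> ` {S. open S} = ?E"
      using assms(1) by (auto simp: image_iff intro!: exI)
    finally show ?thesis .
  qed
  obtain C where C: "\<And>k::nat. compact (C k)" "\<And>k. C k \<subseteq> \<Omega>" "\<And>k. C k \<subseteq> interior (C (Suc k))" "\<Union>(range C) = \<Omega>"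
    using open_Union_compact_subsets[OF assms(1)] by metis
  have AE: "AE x in P. x \<in> \<Omega>" if "sets P = sets borel" "emeasure P (- \<Omega>) = 0" for P :: "(complex ^ 'n) measure"
    using that assms(1) sets_eq_imp_space_eq[OF that(1)]
    by (intro AE_I[of _ _ "- \<Omega>"]) auto
  show ?thesis
  proof (rule measure_eqI_restrict_generator[of ?E \<Omega> M N "range (\<lambda>k. interior (C k))"])
    show "Int_stable ?E" by (auto simp: Int_stable_def)
    show "emeasure M X = emeasure N X" if "X \<in> ?E" for X
      using le[of M N X] le[of N M X] that assms by (intro antisym) auto
    show "\<Union> (range (\<lambda>k. interior (C k))) = \<Omega>"
    proof
      show "\<Union> (range (\<lambda>k. interior (C k))) \<subseteq> \<Omega>"
        by (intro UN_least order_trans[OF interior_subset C(2)])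
      show "\<Omega> \<subseteq> \<Union> (range (\<lambda>k. interior (C k)))"
      proof
        fix x assume "x \<in> \<Omega>"
        then obtain k where "x \<in> C k" unfolding C(4)[symmetric] by auto
        then have "x \<in> interior (C (Suc k))" using C(3) by blast
        then show "x \<in> \<Union> (range (\<lambda>k. interior (C k)))" by blast
      qed
    qed
    show "range (\<lambda>k. interior (C k)) \<subseteq> ?E"
      using order_trans[OF interior_subset C(2)] by auto
    show "emeasure M a \<noteq> \<infinity>" if "a \<in> range (\<lambda>k. interior (C k))" for a
    proof -
      from that obtain k where k: "a = interior (C k)" by auto
      have "emeasure M a \<le> emeasure M (C k)"
        unfolding k using C(1) assms(2) by (intro emeasure_mono interior_subset) (auto simp: borel_compact)
      then show ?thesis using finM[OF C(1,2), of k] by auto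
    qed
  qed (use assms sets AE in auto)
qed

section \<open>Local integrability of subharmonic functions\<close>

lemma usc_open_less:
  fixes \<phi> :: "'a::topological_space \<Rightarrow> ereal"
  assumes "open \<Omega>" "upper_semicontinuous_on \<Omega> \<phi>"
  shows "open {y \<in> \<Omega>. \<phi> y < c}"
proof (subst open_subopen, intro ballI)
  fix x assume "x \<in> {y \<in> \<Omega>. \<phi> y < c}"
  then have x: "x \<in> \<Omega>" "\<phi> x < c" by auto
  then have "\<forall>\<^sub>F y in at x. \<phi> y < c"
    using assms at_within_open[OF x(1) assms(1)] unfolding upper_semicontinuous_on_def by force
  then obtain S where S: "open S" "x \<in> S" "\<forall>y\<in>S. y \<noteq> x \<longrightarrow> \<phi> y < c"
    unfolding eventually_at_topological by blast
  show "\<exists>T. open T \<and> x \<in> T \<and> T \<subseteq> {y \<in> \<Omega>. \<phi> y < c}"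
    by (rule exI[of _ "S \<inter> \<Omega>"]) (use S x assms(1) in auto)
qed

lemma usc_bounded_above:
  fixes \<phi> :: "'a::topological_space \<Rightarrow> ereal"
  assumes "open \<Omega>" "upper_semicontinuous_on \<Omega> \<phi>" "\<And>z. z \<in> \<Omega> \<Longrightarrow> \<phi> z \<noteq> \<infinity>"
    and "compact K" "K \<subseteq> \<Omega>"
  obtains N :: nat where "\<And>z. z \<in> K \<Longrightarrow> \<phi> z \<le> ereal (real N)"
proof -
  have "K \<subseteq> (\<Union>n::nat. {y \<in> \<Omega>. \<phi> y < ereal (real n)})"
  proof
    fix x assume x: "x \<in> K"
    then have "\<phi> x \<noteq> \<infinity>" using assms by auto
    then obtain n :: nat where "\<phi> x < ereal (real n)"
      using less_PInf_Ex_of_nat[of "\<phi> x"] by auto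
    then show "x \<in> (\<Union>n::nat. {y \<in> \<Omega>. \<phi> y < ereal (real n)})"
      using x assms(5) by auto
  qed
  then obtain C where C: "finite C" "K \<subseteq> (\<Union>n\<in>C. {y \<in> \<Omega>. \<phi> y < ereal (real n)})"
    using compactE_image[OF assms(4), of UNIV "\<lambda>n. {y \<in> \<Omega>. \<phi> y < ereal (real n)}"]
      usc_open_less[OF assms(1,2)] by auto
  obtain N where N: "C \<subseteq> {..N}" using C(1) finite_nat_iff_bounded_le by auto
  show ?thesis
  proof (rule that[of N])
    fix z assume "z \<in> K"
    then obtain n where "n \<in> C" "\<phi> z < ereal (real n)" using C(2) by auto
    moreover have "ereal (real n) \<le> ereal (real N)" using N \<open>n \<in> C\<close> by auto
    ultimately show "\<phi> z \<le> ereal (real N)" by (meson less_imp_le order_trans)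
  qed
qed

section \<open>Integrability of the negative part\<close>

context
  fixes \<Omega> :: "'a::euclidean_space set" and \<phi> :: "'a \<Rightarrow> ereal"
  assumes opn: "open \<Omega>" and sh: "subharmonic_on \<Omega> \<phi>"
begin

text \<open>Extension by 0, so that the function is Borel on the whole space and can be integrated
  there.\<close>

private definition g :: "'a \<Rightarrow> ereal" where
  "g y = (if y \<in> \<Omega> then \<phi> y else 0)"

private lemma usc: "upper_semicontinuous_on \<Omega> \<phi>" and fin: "z \<in> \<Omega> \<Longrightarrow> \<phi> z \<noteq> \<infinity>"
  using sh by (auto simp: subharmonic_on_def)

private lemma g_measurable [measurable]: "g \<in> borel_measurable borel"
proof (rule borel_measurableI_less)
  fix c
  have "{x \<in> space borel. g x < c} = {y \<in> \<Omega>. \<phi> y < c} \<union> (if 0 < c then - \<Omega> else {})"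
    by (auto simp: g_def)
  then show "{x \<in> space borel. g x < c} \<in> sets borel"
    using usc_open_less[OF opn usc, of c] opn by auto
qed

private abbreviation neg_int :: "'a set \<Rightarrow> ennreal" where
  "neg_int A \<equiv> (\<integral>\<^sup>+ y. e2ennreal (- g y) * indicator A y \<partial>lborel)"

private lemma nn_uniform:
  assumes "0 < r" "cball z r \<subseteq> \<Omega>"
    and [measurable]: "h \<in> borel_measurable borel"
  shows "(\<integral>\<^sup>+ y. e2ennreal (h (\<phi> y)) \<partial>uniform_measure lborel (cball z r))
    = (\<integral>\<^sup>+ y. e2ennreal (h (g y)) * indicator (cball z r) y \<partial>lborel) / emeasure lborel (cball z r)"
proof -
  have "AE y in uniform_measure lborel (cball z r). e2ennreal (h (\<phi> y)) = e2ennreal (h (g y))"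
    using assms(2) by (intro AE_uniform_measureI AE_I2) (auto simp: g_def)
  then have "(\<integral>\<^sup>+ y. e2ennreal (h (\<phi> y)) \<partial>uniform_measure lborel (cball z r))
     = (\<integral>\<^sup>+ y. e2ennreal (h (g y)) \<partial>uniform_measure lborel (cball z r))"
    by (rule nn_integral_cong_AE)
  also have "\<dots> = (\<integral>\<^sup>+ y. e2ennreal (h (g y)) * indicator (cball z r) y \<partial>lborel) / emeasure lborel (cball z r)"
    by (rule nn_integral_uniform_measure) auto
  finally show ?thesis .
qed

private lemma emeasure_lborel_cball_pos: "0 < s \<Longrightarrow> emeasure lborel (cball z s) \<noteq> 0" for z :: 'a
proof
  assume "0 < s" and "emeasure lborel (cball z s) = 0"
  then have "negligible (cball z s)"
    by (simp add: negligible_iff_null_sets null_sets_def emeasure_completion)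
  then have "negligible (ball z s)" by (rule negligible_subset) auto
  then show False using \<open>0 < s\<close> open_not_negligible[of "ball z s"] by auto
qed

private lemma pos_int_finite:
  assumes "compact K" "K \<subseteq> \<Omega>"
  shows "(\<integral>\<^sup>+ y. e2ennreal (g y) * indicator K y \<partial>lborel) < \<infinity>"
proof -
  obtain N :: nat where N: "\<And>z. z \<in> K \<Longrightarrow> \<phi> z \<le> ereal (real N)"
    by (rule usc_bounded_above[OF opn usc _ assms]) (rule fin, assumption, rule that)
  have "(\<integral>\<^sup>+ y. e2ennreal (g y) * indicator K y \<partial>lborel) \<le> (\<integral>\<^sup>+ y. ennreal (real N) * indicator K y \<partial>lborel)"
  proof (rule nn_integral_mono)
    fix y
    have "e2ennreal (g y) \<le> ennreal (real N)" if "y \<in> K"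
      using N[OF that] assms(2) that e2ennreal_mono[of "\<phi> y" "ereal (real N)"]
      by (auto simp: g_def e2ennreal_ereal)
    then show "e2ennreal (g y) * indicator K y \<le> ennreal (real N) * indicator K y"
      by (auto simp: indicator_def)
  qed
  also have "\<dots> = ennreal (real N) * emeasure lborel K"
    using assms(1) by (intro nn_integral_cmult_indicator) (auto simp: borel_compact)
  also have "\<dots> < \<infinity>"
    using emeasure_compact_finite[OF assms(1)] by (simp add: ennreal_mult_less_top)
  finally show ?thesis .
qed

text \<open>The positive part of the mean is finite, so an infinite negative part would make the
  mean -\<infinity>, against the sub-mean value inequality at \<open>z\<close>.\<close>

private lemma neg_int_cball:
  assumes "0 < r" "cball z r \<subseteq> \<Omega>" "\<phi> z \<noteq> -\<infinity>"
  shows "neg_int (cball z r) < \<infinity>"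
proof (rule ccontr)
  assume "\<not> ?thesis"
  then have top: "neg_int (cball z r) = top" by (simp add: less_top[symmetric])
  have c: "emeasure lborel (cball z r) \<noteq> 0" "emeasure lborel (cball z r) \<noteq> top"
    using emeasure_lborel_cball_pos[OF assms(1)] emeasure_lborel_cball_finite[of z r] by auto
  have P: "(\<integral>\<^sup>+ y. e2ennreal (\<phi> y) \<partial>uniform_measure lborel (cball z r)) < top"
    using nn_uniform[OF assms(1,2), of "\<lambda>x. x"] pos_int_finite[OF compact_cball assms(2)] c
    by (simp add: ennreal_divide_eq_top_iff less_top[symmetric])
  have N: "(\<integral>\<^sup>+ y. e2ennreal (- \<phi> y) \<partial>uniform_measure lborel (cball z r)) = top"
    using nn_uniform[OF assms(1,2), of "\<lambda>x. - x"] top c by (simp add: ennreal_top_divide)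
  have "\<phi> z \<le> ball_mean \<phi> z r"
    using sh assms(1,2) unfolding subharmonic_on_def by blast
  also have "\<dots> = -\<infinity>"
    unfolding ball_mean_def N using P
    by (cases "\<integral>\<^sup>+ y. e2ennreal (\<phi> y) \<partial>uniform_measure lborel (cball z r)") auto
  finally show False using assms(3) by simp
qed

text \<open>It turns out to be open and closed in \<Omega> and to contain, in every component, a
  point where \<phi> is not -\<infinity>.\<close>

private definition A :: "'a set" where
  "A = {z \<in> \<Omega>. \<exists>r>0. neg_int (cball z r) < \<infinity>}"

private lemma neg_int_mono: "S \<subseteq> S' \<Longrightarrow> neg_int S' < \<infinity> \<Longrightarrow> neg_int S < \<infinity>"
  by (erule le_less_trans[rotated], rule nn_integral_mono) (auto simp: indicator_def)

private lemma open_A: "open A"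
  unfolding open_contains_ball
proof
  fix z assume "z \<in> A"
  then obtain r where r: "z \<in> \<Omega>" "r > 0" "neg_int (cball z r) < \<infinity>" by (auto simp: A_def)
  obtain d where d: "d > 0" "ball z d \<subseteq> \<Omega>" using opn r(1) open_contains_ball by blast
  have "ball z (min d (r / 2)) \<subseteq> A"
  proof
    fix w assume w: "w \<in> ball z (min d (r / 2))"
    have "cball w (r / 2) \<subseteq> cball z r"
    proof
      fix y assume "y \<in> cball w (r / 2)"
      then show "y \<in> cball z r" using w dist_triangle[of z y w] by auto
    qed
    then have "neg_int (cball w (r / 2)) < \<infinity>" using r(3) neg_int_mono by blast
    then show "w \<in> A" using d w r(2) unfolding A_def by (auto intro!: exI[of _ "r / 2"])
  qed
  then show "\<exists>e>0. ball z e \<subseteq> A" using d r by (intro exI[of _ "min d (r / 2)"]) auto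
qed

text \<open>A point of \<open>A\<close> near \<open>z\<close> yields a point \<open>w\<close> near
  \<open>z\<close> with \<phi> w \<noteq> -\<infinity>. By \<open>neg_int_cball\<close> a ball about
  \<open>w\<close> that contains a neighbourhood of \<open>z\<close> has finite integral, and
  \<open>z\<close> would lie in \<open>A\<close>.\<close>

private lemma open_diff_A: "open (\<Omega> - A)"
  unfolding open_contains_ball
proof
  fix z assume z: "z \<in> \<Omega> - A"
  obtain d where d: "d > 0" "cball z d \<subseteq> \<Omega>" using opn z open_contains_cball by blast
  \<comment> \<open>The point \<open>w\<close> found below lies within 2 r of \<open>z\<close>, so
    its ball of radius 2 r reaches no further than 4 r = d.\<close>
  define r where "r = d / 4"
  have r: "r > 0" using d by (simp add: r_def)
  have "ball z r \<subseteq> \<Omega> - A"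
  proof
    fix z' assume z': "z' \<in> ball z r"
    have "z' \<in> \<Omega>" using z' d by (auto simp: r_def)
    moreover have "z' \<notin> A"
    proof
      assume "z' \<in> A"
      then obtain r' where r': "r' > 0" "neg_int (cball z' r') < \<infinity>" by (auto simp: A_def)
      define s where "s = min r r'"
      have s: "s > 0" "s \<le> r" "s \<le> r'" using r r' by (auto simp: s_def)
      have sub: "cball z' s \<subseteq> \<Omega>"
      proof
        fix y assume "y \<in> cball z' s"
        then have "dist z y \<le> d" using z' s(2) r dist_triangle[of z y z'] by (auto simp: r_def)
        then show "y \<in> \<Omega>" using d by auto
      qed
      \<comment> \<open>Otherwise \<phi> would be -\<infinity> on a ball of positive measure,
        although its negative part is integrable there.\<close>
      have "\<exists>w\<in>cball z' s. \<phi> w \<noteq> -\<infinity>"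
      proof (rule ccontr)
        assume "\<not> ?thesis"
        then have "neg_int (cball z' s) = (\<integral>\<^sup>+ y. top * indicator (cball z' s) y \<partial>lborel)"
          using sub by (intro nn_integral_cong) (auto simp: g_def indicator_def)
        also have "\<dots> = top * emeasure lborel (cball z' s)"
          by (rule nn_integral_cmult_indicator) auto
        also have "\<dots> = top"
          using s(1) using emeasure_lborel_cball_pos[OF s(1)] by (simp add: ennreal_top_mult)
        finally have "neg_int (cball z' s) = top" .
        moreover have "neg_int (cball z' s) < \<infinity>"
          using r'(2) by (rule neg_int_mono[rotated]) (use s in auto)
        ultimately show False by simp
      qed
      then obtain w where w: "w \<in> cball z' s" "\<phi> w \<noteq> -\<infinity>" by blast
      have dw: "dist z w < 2 * r" using w(1) z' s(2) dist_triangle[of z w z'] by auto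
      have "cball w (2 * r) \<subseteq> \<Omega>"
      proof
        fix y assume "y \<in> cball w (2 * r)"
        then have "dist z y \<le> d" using dw dist_triangle[of z y w] by (auto simp: r_def)
        then show "y \<in> \<Omega>" using d by auto
      qed
      then have "neg_int (cball w (2 * r)) < \<infinity>" using w(2) r by (intro neg_int_cball) auto
      moreover have "cball z (2 * r - dist z w) \<subseteq> cball w (2 * r)"
      proof
        fix y assume "y \<in> cball z (2 * r - dist z w)"
        then show "y \<in> cball w (2 * r)" using dist_triangle[of w y z] by (auto simp: dist_commute)
      qed
      ultimately have "neg_int (cball z (2 * r - dist z w)) < \<infinity>" by (rule neg_int_mono[rotated])
      then have "z \<in> A" using z dw unfolding A_def by (auto intro!: exI[of _ "2 * r - dist z w"])
      then show False using z by simp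
    qed
    ultimately show "z' \<in> \<Omega> - A" by simp
  qed
  then show "\<exists>e>0. ball z e \<subseteq> \<Omega> - A" using r by blast
qed

private lemma A_eq: "A = \<Omega>"
proof
  show "A \<subseteq> \<Omega>" by (auto simp: A_def)
  show "\<Omega> \<subseteq> A"
  proof
    fix x assume "x \<in> \<Omega>"
    then obtain C where C: "C \<in> components \<Omega>" "x \<in> C"
      by (metis Union_components UnionE)
    obtain z where z: "z \<in> C" "\<phi> z \<noteq> -\<infinity>"
      using sh C(1) unfolding subharmonic_on_def by blast
    have CO: "C \<subseteq> \<Omega>" using C(1) in_components_subset by blast
    obtain r where r: "r > 0" "cball z r \<subseteq> \<Omega>"
      using opn CO z(1) open_contains_cball by blast
    have "z \<in> A" using neg_int_cball[OF r z(2)] r(1) CO z(1) by (auto simp: A_def)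
    moreover have "connected C" using C(1) in_components_connected by blast
    ultimately show "x \<in> A"
      using open_A open_diff_A C(2) z(1) CO unfolding connected_def by blast
  qed
qed

lemma subharmonic_locally_integrable:
  assumes K: "compact K" "K \<subseteq> \<Omega>"
  shows "set_integrable lborel K (\<lambda>z. real_of_ereal (\<phi> z))"
proof -
  have "\<exists>r>0. neg_int (cball x r) < \<infinity>" if "x \<in> K" for x
    using A_eq K(2) that by (auto simp: A_def)
  then obtain r where r: "\<And>x. x \<in> K \<Longrightarrow> r x > 0" "\<And>x. x \<in> K \<Longrightarrow> neg_int (cball x (r x)) < \<infinity>"
    by metis
  have "K \<subseteq> (\<Union>x\<in>K. ball x (r x))" using r(1) by auto
  then obtain D where D: "D \<subseteq> K" "finite D" "K \<subseteq> (\<Union>x\<in>D. ball x (r x))"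
    using compactE_image[OF K(1), of K "\<lambda>x. ball x (r x)"] by auto
  have "neg_int K \<le> (\<integral>\<^sup>+ y. (\<Sum>x\<in>D. e2ennreal (- g y) * indicator (cball x (r x)) y) \<partial>lborel)"
  proof (rule nn_integral_mono)
    fix y
    show "e2ennreal (- g y) * indicator K y \<le> (\<Sum>x\<in>D. e2ennreal (- g y) * indicator (cball x (r x)) y)"
    proof (cases "y \<in> K")
      case True
      then obtain x where x: "x \<in> D" "y \<in> ball x (r x)" using D(3) by auto
      have "e2ennreal (- g y) * indicator (cball x (r x)) y \<le> (\<Sum>x\<in>D. e2ennreal (- g y) * indicator (cball x (r x)) y)"
        using x(1) D(2) by (intro member_le_sum) auto
      then show ?thesis using x True by (auto simp: indicator_def)
    qed auto
  qed
  also have "\<dots> = (\<Sum>x\<in>D. neg_int (cball x (r x)))"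
    by (rule nn_integral_sum) (auto intro!: borel_measurable_times_ennreal borel_measurable_indicator borel_closed)
  also have "\<dots> < \<infinity>" using r(2) D(1,2) by (auto simp: ennreal_sum_less_top)
  finally have neg: "neg_int K < \<infinity>" .
  have Ks [measurable]: "K \<in> sets borel" using K(1) by (rule borel_compact)
  have "integrable lborel (\<lambda>y. indicator K y *\<^sub>R real_of_ereal (g y))"
  proof (rule integrableI_bounded)
    show "(\<lambda>y. indicator K y *\<^sub>R real_of_ereal (g y)) \<in> borel_measurable lborel"
      by measurable
    have "(\<integral>\<^sup>+ y. ennreal (norm (indicator K y *\<^sub>R real_of_ereal (g y))) \<partial>lborel)
       \<le> (\<integral>\<^sup>+ y. e2ennreal (g y) * indicator K y + e2ennreal (- g y) * indicator K y \<partial>lborel)"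
    proof (rule nn_integral_mono)
      fix y
      have "ennreal \<bar>real_of_ereal (g y)\<bar> \<le> e2ennreal (g y) + e2ennreal (- g y)"
        by (cases "g y") (auto simp: e2ennreal_ereal abs_if ennreal_neg)
      then show "ennreal (norm (indicator K y *\<^sub>R real_of_ereal (g y)))
         \<le> e2ennreal (g y) * indicator K y + e2ennreal (- g y) * indicator K y"
        by (auto simp: indicator_def)
    qed
    also have "\<dots> = (\<integral>\<^sup>+ y. e2ennreal (g y) * indicator K y \<partial>lborel) + neg_int K"
      by (rule nn_integral_add) auto
    also have "\<dots> < \<infinity>" using neg pos_int_finite[OF K] by (simp add: less_top[symmetric])
    finally show "(\<integral>\<^sup>+ y. ennreal (norm (indicator K y *\<^sub>R real_of_ereal (g y))) \<partial>lborel) < \<infinity>" .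
  qed
  moreover have "(\<lambda>y. indicator K y *\<^sub>R real_of_ereal (g y)) = (\<lambda>y. indicator K y *\<^sub>R real_of_ereal (\<phi> y))"
    using K(2) by (auto simp: g_def indicator_def fun_eq_iff)
  ultimately show ?thesis unfolding set_integrable_def by simp
qed

end

section \<open>The form beta and the operator ddc\<close>

abbreviation J :: "complex ^ 'n \<Rightarrow> complex ^ 'n" where
  "J u \<equiv> \<i> *s u"

lemma inner_J: "J u \<bullet> w = - (u \<bullet> J w)"
  by (simp add: inner_vec_def inner_complex_def sum_negf[symmetric] algebra_simps)

lemma J_J: "J (J u) = - u"
  by (simp add: vec_eq_iff vector_scalar_mult_def)

lemma inner_J_J: "J u \<bullet> J w = u \<bullet> w"
  by (simp add: inner_J J_J)

lemma inner_J_self: "J u \<bullet> u = 0"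
  using inner_J[of u u] by (simp add: inner_commute)

lemma bounded_linear_J: "bounded_linear (J :: complex ^ 'n \<Rightarrow> complex ^ 'n)"
proof -
  have "linear (J :: complex ^ 'n \<Rightarrow> complex ^ 'n)"
    by (rule linearI) (simp_all add: vec_eq_iff vector_scalar_mult_def algebra_simps)
  then show ?thesis by (rule linear_conv_bounded_linear[THEN iffD1])
qed

text \<open>At a point z, \<open>hinner z\<close> is half of d|z|^2, and the covector
  \<open>hbeta z\<close> below is twice d^c|z|^2; their wedge product is therefore d|z|^2 \<and>
  d^c|z|^2. As a function of two vectors, \<open>hbeta\<close> is \<beta> itself.\<close>

definition hinner :: "complex ^ 'n \<Rightarrow> complex ^ 'n \<Rightarrow> complex" where
  "hinner u w = of_real (u \<bullet> w)"

definition hbeta :: "complex ^ 'n \<Rightarrow> complex ^ 'n \<Rightarrow> complex" where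
  "hbeta u w = of_real ((J u \<bullet> w) / pi)"

lemma hbeta_antisym: "hbeta u w = - hbeta w u"
  using inner_J[of u w] by (simp add: hbeta_def inner_commute)

lemma linear_hbeta1: "linear (\<lambda>u. hbeta u w)"
  unfolding hbeta_def
  by (rule linearI)
    (simp_all add: linear_add[OF bounded_linear.linear[OF bounded_linear_J]]
      linear_scale[OF bounded_linear.linear[OF bounded_linear_J]] inner_left_distrib add_divide_distrib scaleR_conv_of_real[where 'a=complex])

lemma linear_hinner: "linear (hinner u)"
  unfolding hinner_def by (rule linearI) (simp_all add: inner_right_distrib scaleR_conv_of_real[where 'a=complex])

lemma linear_hbeta: "linear (hbeta u)"
  unfolding hbeta_def by (rule linearI) (simp_all add: inner_right_distrib add_divide_distrib scaleR_conv_of_real[where 'a=complex])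

lemma ext_d_eq: "ext_d k \<omega> z v = (\<Sum>i\<le>k. (-1) ^ i * dd (v i) (\<lambda>w. \<omega> w (omit i v)) z)"
  unfolding ext_d_def del_def delbar_def sum.distrib[symmetric]
  by (intro sum.cong refl) (simp add: deriv_10_def deriv_01_def field_simps)

text \<open>For a differential D, the antilinear part minus the linear part is u \<mapsto> \<i> D(J
  u), which makes d^c a real operator.\<close>

lemma ext_dc_eq:
  "ext_dc k \<omega> z v = (\<Sum>l\<le>k. - (1 / (4 * of_real pi)) * ((-1) ^ l * dd (J (v l)) (\<lambda>w. \<omega> w (omit l v)) z))"
  unfolding ext_dc_def del_def delbar_def sum_subtractf[symmetric] sum_distrib_left
  by (intro sum.cong refl) (simp add: deriv_10_def deriv_01_def field_simps)

text \<open>In coordinates d is the sum of \<open>hinner a\<close> \<and> \<partial>_a, and d^c is a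
  quarter of the sum of \<open>hbeta e\<close> \<and> \<partial>_e, because J u \<bullet> e = -
  \<pi> \<open>hbeta e u\<close>. The exterior factors are constant and can be moved inside the
  derivatives.\<close>

lemma ddc_expand:
  fixes \<omega> :: "'n::finite dform" and L :: "complex ^ 'n \<Rightarrow> (complex ^ 'n) list \<Rightarrow> complex"
  assumes sm: "\<And>v. smooth (\<lambda>z. \<omega> z v)" and L: "\<And>z v. \<omega> z v = L z (map v [0..<k])"
  shows "ddc k \<omega> z v = (1/4) * (\<Sum>a\<in>Basis. \<Sum>e\<in>Basis.
    dd a (dd e (\<lambda>w. ewedge (hinner a) (ewedge (hbeta e) (L w)) (map v [0..<Suc (Suc k)]))) z)"
proof -
  let ?f = "\<lambda>i l w. \<omega> w (omit l (omit i v))"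
  define C0 where "C0 = - (1 / (4 * complex_of_real pi))"
  have c: "C0 * complex_of_real ((J u \<bullet> e) * (v' \<bullet> a)) = (1/4) * (hinner a v' * hbeta e u)"
    for u v' e a :: "complex ^ 'n"
    using inner_J[of u e] by (simp add: C0_def hinner_def hbeta_def inner_commute field_simps)
  have dd2: "dd v' (dd (J u) g) z = (\<Sum>a\<in>Basis. \<Sum>e\<in>Basis. of_real ((J u \<bullet> e) * (v' \<bullet> a)) * dd a (dd e g) z)"
    if g: "smooth g" for g :: "complex ^ 'n \<Rightarrow> complex" and u v'
  proof -
    have e: "dd (J u) g = (\<lambda>w. \<Sum>e\<in>Basis. of_real (J u \<bullet> e) * dd e g w)"
      using dd_expand[OF g, where u="J u"] by (simp add: scaleR_conv_of_real[where 'a=complex] fun_eq_iff)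
    have "dd v' (dd (J u) g) z = (\<Sum>e\<in>Basis. of_real (J u \<bullet> e) * dd v' (dd e g) z)"
      unfolding e by (simp add: dd_sum dd_scale smooth_mult smooth_const smooth_dd g)
    also have "\<dots> = (\<Sum>e\<in>Basis. of_real (J u \<bullet> e) * (\<Sum>a\<in>Basis. of_real (v' \<bullet> a) * dd a (dd e g) z))"
      using dd_expand[OF smooth_dd[OF g], where u=v'] by (simp add: scaleR_conv_of_real[where 'a=complex])
    also have "\<dots> = (\<Sum>a\<in>Basis. \<Sum>e\<in>Basis. of_real ((J u \<bullet> e) * (v' \<bullet> a)) * dd a (dd e g) z)"
      by (simp add: sum_distrib_left mult.assoc) (rule sum.swap)
    finally show ?thesis .
  qed
  have "ddc k \<omega> z v = (\<Sum>i\<le>Suc k. (-1) ^ i * dd (v i) (\<lambda>w. ext_dc k \<omega> w (omit i v)) z)"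
    unfolding ddc_def ext_d_eq ..
  also have "\<dots> = (\<Sum>i\<le>Suc k. (-1) ^ i * (\<Sum>l\<le>k. C0 * ((-1) ^ l *
      dd (v i) (dd (J (omit i v l)) (?f i l)) z)))"
    unfolding ext_dc_eq C0_def[symmetric] by (simp add: dd_sum dd_scale smooth_mult smooth_const smooth_dd sm del: sum.atMost_Suc)
  also have "\<dots> = (\<Sum>i\<le>Suc k. \<Sum>l\<le>k. \<Sum>a\<in>Basis. \<Sum>e\<in>Basis. (-1) ^ i * ((-1) ^ l *
      ((1/4) * (hinner a (v i) * hbeta e (omit i v l)) * dd a (dd e (?f i l)) z)))"
    unfolding dd2[OF sm] c[symmetric] sum_distrib_left
    by (intro sum.cong refl) (simp add: mult_ac)
  also have "\<dots> = (\<Sum>i\<le>Suc k. \<Sum>a\<in>Basis. \<Sum>e\<in>Basis. \<Sum>l\<le>k. (-1) ^ i * ((-1) ^ l *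
      ((1/4) * (hinner a (v i) * hbeta e (omit i v l)) * dd a (dd e (?f i l)) z)))"
    by (rule sum.cong[OF refl], subst sum.swap, rule sum.cong[OF refl], rule sum.swap)
  also have "\<dots> = (\<Sum>a\<in>Basis. \<Sum>e\<in>Basis. \<Sum>i\<le>Suc k. \<Sum>l\<le>k. (-1) ^ i * ((-1) ^ l *
      ((1/4) * (hinner a (v i) * hbeta e (omit i v l)) * dd a (dd e (?f i l)) z)))"
    by (subst sum.swap, rule sum.cong[OF refl], rule sum.swap)
  also have "\<dots> = (1/4) * (\<Sum>a\<in>Basis. \<Sum>e\<in>Basis.
    dd a (dd e (\<lambda>w. ewedge (hinner a) (ewedge (hbeta e) (L w)) (map v [0..<Suc (Suc k)]))) z)"
    unfolding ewedge_map_upt L[symmetric] sum_distrib_left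
    by (intro sum.cong refl)
      (simp add: dd_sum dd_scale smooth_mult smooth_const smooth_dd smooth_sum sm sum_distrib_left mult_ac del: sum.atMost_Suc)
  finally show ?thesis .
qed

lemma has_derivative_norm2: "((\<lambda>w. (norm (w - x)) ^ 2) has_derivative (\<lambda>u. 2 * ((z - x) \<bullet> u))) (at z)"
  for x z :: "'a::real_inner"
  unfolding power2_norm_eq_inner
  by (rule has_derivative_eq_rhs, (rule derivative_intros)+) (auto simp: inner_commute)

lemma smooth_norm2: "smooth (\<lambda>w. (norm (w - x))\<^sup>2)" for x :: "'a::real_inner"
  unfolding power2_norm_eq_inner by (intro smooth_inner smooth_diff smooth_ident smooth_const)

lemma sum_Basis_hinner:
  "linear h \<Longrightarrow> (\<Sum>a\<in>Basis. hinner a u * h a) = h u" for h :: "complex ^ 'n \<Rightarrow> complex"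
proof -
  assume h: "linear h"
  have "h u = h (\<Sum>a\<in>Basis. (u \<bullet> a) *\<^sub>R a)" by (simp add: euclidean_representation)
  also have "\<dots> = (\<Sum>a\<in>Basis. hinner a u * h a)"
    by (simp add: linear_sum[OF h] linear_scale[OF h] hinner_def scaleR_conv_of_real[where 'a=complex] inner_commute)
  finally show ?thesis by simp
qed

lemma beta_eq:
  fixes z :: "complex ^ 'n::finite"
  shows "beta z = cov2 hbeta"
proof
  fix v :: "nat \<Rightarrow> complex ^ 'n"
  let ?X = "\<lambda>a e. hinner a (v 0) * hbeta e (v 1) - hinner a (v 1) * hbeta e (v 0)"
  let ?g = "\<lambda>w::complex ^ 'n. complex_of_real ((norm w)\<^sup>2)"
  have sg: "smooth ?g" using smooth_of_real[OF smooth_norm2[of 0]] by simp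
  have d1: "dd e ?g = (\<lambda>w. of_real (2 * (w \<bullet> e)))" for e
  proof (rule ext, rule dd_eqI)
    fix z :: "complex ^ 'n"
    show "(?g has_derivative (\<lambda>u. of_real (2 * (z \<bullet> u)))) (at z)"
      using bounded_linear.has_derivative[OF bounded_linear_of_real has_derivative_norm2[of 0 z]] by simp
  qed
  have d2: "dd a (dd e ?g) z = of_real (2 * (a \<bullet> e))" for a e
    unfolding d1 by (rule dd_eqI) (auto intro!: derivative_eq_intros)
  have "beta z v = (1/4) * (\<Sum>a\<in>Basis. \<Sum>e\<in>Basis.
    dd a (dd e (\<lambda>w. ewedge (hinner a) (ewedge (hbeta e) (\<lambda>vs. ?g w)) (map v [0..<Suc (Suc 0)]))) z)"
    unfolding beta_def by (rule ddc_expand) (auto intro: sg[simplified])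
  also have "\<dots> = (1/4) * (\<Sum>a\<in>Basis. \<Sum>e\<in>Basis. dd a (dd e (\<lambda>w. ?X a e * ?g w)) z)"
    by (simp add: algebra_simps)
  also have "\<dots> = (1/4) * (\<Sum>a\<in>Basis. \<Sum>e\<in>Basis. ?X a e * of_real (2 * (a \<bullet> e)))"
    by (simp only: dd_scale sg smooth_dd d2)
  also have "\<dots> = (1/4) * (\<Sum>a\<in>Basis. ?X a a * 2)"
    by (intro arg_cong[where f="(*) (1/4)"] sum.cong refl)
       (simp add: inner_Basis if_distrib[of of_real] if_distrib[of "(*) _"] sum.delta' cong: if_cong)
  also have "\<dots> = (1/2) * ((\<Sum>a\<in>Basis. hinner a (v 0) * hbeta a (v 1)) - (\<Sum>a\<in>Basis. hinner a (v 1) * hbeta a (v 0)))"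
    by (simp add: sum_distrib_right[symmetric] sum_subtractf)
  also have "\<dots> = cov2 hbeta v"
    using hbeta_antisym[of "v 1" "v 0"]
    by (simp add: sum_Basis_hinner[OF linear_hbeta1] cov2_def)
  finally show "beta z v = cov2 hbeta v" .
qed

section \<open>The real frame and the volume of the powers of \<beta>\<close>

definition vframe :: "nat \<Rightarrow> complex ^ 'n::finite" where
  "vframe k = axis (from_nat_into UNIV (k div 2)) (if even k then 1 else \<i>)"

definition vlist :: "(complex ^ 'n::finite) list" where
  "vlist = map vframe [0..<2 * CARD('n)]"

lemma vol_coeff_list: "(\<And>v. \<tau> v = A (map v [0..<2 * CARD('n)])) \<Longrightarrow> vol_coeff \<tau> = A vlist"
  for \<tau> :: "'n::finite covector"
  by (simp add: vol_coeff_def vlist_def vframe_def[abs_def])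

lemma span_vlist: "span (set (vlist :: (complex ^ 'n::finite) list)) = UNIV"
proof -
  have "Basis \<subseteq> set (vlist :: (complex ^ 'n) list)"
  proof
    fix b :: "complex ^ 'n" assume "b \<in> Basis"
    then obtain i c where b: "b = axis i c" "c = 1 \<or> c = \<i>"
      by (auto simp: Basis_vec_def Basis_complex_def)
    have "i \<in> from_nat_into (UNIV :: 'n set) ` {..<CARD('n)}"
      using bij_betw_from_nat_into_finite[of "UNIV :: 'n set"] by (simp add: bij_betw_def)
    then obtain j where j: "j < CARD('n)" "i = from_nat_into UNIV j" by auto
    have "b = vframe (if c = 1 then 2 * j else Suc (2 * j))"
      using b j by (auto simp: vframe_def)
    moreover have "(if c = 1 then 2 * j else Suc (2 * j)) < 2 * CARD('n)"
      using j by auto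
    ultimately show "b \<in> set vlist" unfolding vlist_def by auto
  qed
  then show ?thesis using span_mono span_Basis by blast
qed

interpretation frame: volume_frame hbeta "vlist :: (complex ^ 'n::finite) list"
  by (rule volume_frame.intro[OF hbeta_antisym linear_hbeta1 span_vlist])

lemma map_upt_pairs: "map f [0..<2 * k] = concat (map (\<lambda>j. [f (2 * j), f (Suc (2 * j))]) [0..<k])"
  by (induction k) auto

text \<open>Contraction with the first vector e_j leaves the covector \<open>hbeta e_j\<close>,
  which is 1 / \<pi> on \<i> e_j and vanishes on all other pairs; the Leibniz factors multiply up to
  the factorial.\<close>

lemma mpow_hbeta_pairs:
  fixes js :: "'n::finite list"
  assumes "distinct js"
  shows "mpow hbeta (length js) (concat (map (\<lambda>j. [axis j 1, axis j \<i>]) js))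
    = of_real (fact (length js) / pi ^ length js)"
  using assms
proof (induction js)
  case Nil
  then show ?case by (simp add: mpow_def vac_def)
next
  case (Cons j js)
  let ?e = "axis j 1 :: complex ^ 'n" and ?e' = "axis j \<i> :: complex ^ 'n"
  let ?rest = "concat (map (\<lambda>j. [axis j 1, axis j \<i> :: complex ^ 'n]) js)"
  have Je: "J ?e = ?e'"
    by (simp add: vec_eq_iff axis_def)
  have hee: "hbeta ?e ?e' = of_real (1 / pi)"
    unfolding hbeta_def Je by (simp add: inner_axis_axis inner_complex_def)
  have "hbeta ?e v = 0" if "v \<in> set ?rest" for v
    using that Cons.prems by (auto simp: hbeta_def Je inner_axis_axis)
  then have z: "ewedge (hbeta ?e) A ?rest = 0" for A by (rule ewedge_vanish)
  have "mpow hbeta (length (j # js)) (concat (map (\<lambda>j. [axis j 1, axis j \<i>]) (j # js)))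
     = of_nat (Suc (length js)) * (hbeta ?e ?e' * mpow hbeta (length js) ?rest)"
    using z by (simp add: mpow_Cons del: of_nat_Suc)
  also have "\<dots> = of_real (fact (length (j # js)) / pi ^ length (j # js))"
    using Cons by (simp add: hee field_simps)
  finally show ?case .
qed

lemma mpow_vlist: "mpow hbeta CARD('n) (vlist :: (complex ^ 'n::finite) list) = of_real (fact CARD('n) / pi ^ CARD('n))"
proof -
  let ?js = "map (from_nat_into (UNIV :: 'n set)) [0..<CARD('n)]"
  have "distinct ?js"
    using bij_betw_from_nat_into_finite[of "UNIV :: 'n set"]
    by (auto simp: distinct_map bij_betw_def atLeast0LessThan)
  moreover have "vlist = concat (map (\<lambda>j. [axis j 1, axis j \<i>]) ?js)"
    unfolding vlist_def map_upt_pairs by (simp add: vframe_def o_def)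
  ultimately show ?thesis using mpow_hbeta_pairs[of ?js] by simp
qed

section \<open>A family of m-positive forms\<close>

text \<open>
  With respect to \<open>\<beta>\<close>, this Hermitian form has the eigenvalue \<open>1 - c |y|\<^sup>2\<close> in the complex direction
  of \<open>y\<close> and 1 in the orthogonal ones; its \<open>m\<close>-positivity amounts to \<open>c |y|\<^sup>2 \<le> n / m\<close>.
\<close>

definition hgam :: "real \<Rightarrow> complex ^ 'n \<Rightarrow> complex ^ 'n \<Rightarrow> complex ^ 'n \<Rightarrow> complex" where
  "hgam c y u w = hbeta u w - of_real c * (hinner y u * hbeta y w - hbeta y u * hinner y w)"

lemma hgam_antisym: "hgam c y u w = - hgam c y w u"
  using hbeta_antisym[of u w] by (simp add: hgam_def algebra_simps)

lemma wedge_dz_dzbar: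
  "wedge 1 1 (dz j) (dzbar k) v = v 0 $ j * cnj (v 1 $ k) - v 1 $ j * cnj (v 0 $ k)"
  by (simp add: wedge_Alt Alt_Suc Alt_0 dz_def dzbar_def omit_def)

lemma hbeta_hermitian:
  fixes u w :: "complex ^ 'n::finite"
  shows "hbeta u w = (\<i> / (2 * of_real pi)) * (\<Sum>j\<in>UNIV. u $ j * cnj (w $ j) - w $ j * cnj (u $ j))"
proof -
  have e: "complex_of_real ((\<i> * a) \<bullet> b) = (\<i> / 2) * (a * cnj b - b * cnj a)" for a b
    by (simp add: complex_eq_iff inner_complex_def field_simps)
  have "hbeta u w = (\<Sum>j\<in>UNIV. complex_of_real ((\<i> * u $ j) \<bullet> (w $ j))) / of_real pi"
    by (simp add: hbeta_def inner_vec_def)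
  then show ?thesis unfolding e sum_distrib_left[symmetric] by simp
qed

text \<open>The rank one part is \<i> / (2 \<pi>) times p \<and> cnj p for a complex linear form p,
  hence of type (1,1), and its coefficient matrix can be read off.\<close>

lemma hinner_hbeta_hermitian:
  fixes y u w :: "complex ^ 'n::finite"
  defines "p \<equiv> \<lambda>u. \<Sum>j\<in>UNIV. cnj (y $ j) * u $ j"
  shows "hinner y u * hbeta y w - hbeta y u * hinner y w
    = (\<i> / (2 * of_real pi)) * (p u * cnj (p w) - p w * cnj (p u))"
proof -
  have 1: "hinner y u = (p u + cnj (p u)) / 2" for u
  proof -
    have e: "complex_of_real (a \<bullet> b) = (cnj a * b + cnj (cnj a * b)) / 2" for a b
      by (simp add: complex_eq_iff inner_complex_def algebra_simps)
    show ?thesis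
      by (simp add: hinner_def inner_vec_def p_def e sum.distrib sum_divide_distrib add_divide_distrib)
  qed
  have 2: "hbeta y u = - (\<i> / (2 * of_real pi)) * (p u - cnj (p u))" for u
    by (simp add: hbeta_hermitian p_def sum_subtractf algebra_simps)
  show ?thesis unfolding 1 2 by (simp add: field_simps)
qed

lemma real_11_hgam: "real_11_covector (cov2 (hgam c (y :: complex ^ 'n::finite)))"
proof -
  define K where "K = \<i> / (2 * complex_of_real pi)"
  define a :: "complex ^ 'n ^ 'n" where
    "a = (\<chi> j k. K * ((if j = k then 1 else 0) - of_real c * cnj (y $ j) * y $ k))"
  have "cov2 (hgam c y) v = (\<Sum>j\<in>UNIV. \<Sum>k\<in>UNIV. a $ j $ k * wedge 1 1 (dz j) (dzbar k) v)" for v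
  proof -
    let ?u = "v 0" and ?w = "v 1"
    let ?D = "\<lambda>j k. ?u $ j * cnj (?w $ k) - ?w $ j * cnj (?u $ k)"
    define p where "p u = (\<Sum>j\<in>UNIV. cnj (y $ j) * u $ j)" for u :: "complex ^ 'n"
    have P: "p u * cnj (p w) = (\<Sum>j\<in>UNIV. \<Sum>k\<in>UNIV. cnj (y $ j) * y $ k * (u $ j * cnj (w $ k)))" for u w
      by (simp add: p_def sum_product mult_ac)
    have "(\<Sum>j\<in>UNIV. \<Sum>k\<in>UNIV. a $ j $ k * wedge 1 1 (dz j) (dzbar k) v)
       = (\<Sum>j\<in>UNIV. \<Sum>k\<in>UNIV. K * ((if j = k then ?D j k else 0) - of_real c * (cnj (y $ j) * y $ k * ?D j k)))"
      unfolding wedge_dz_dzbar by (intro sum.cong refl) (simp add: a_def algebra_simps)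
    also have "\<dots> = K * ((\<Sum>j\<in>UNIV. ?D j j) - of_real c * (\<Sum>j\<in>UNIV. \<Sum>k\<in>UNIV. cnj (y $ j) * y $ k * ?D j k))"
      by (simp only: sum_distrib_left[symmetric] sum_subtractf) (simp add: sum_subtractf)
    also have "(\<Sum>j\<in>UNIV. \<Sum>k\<in>UNIV. cnj (y $ j) * y $ k * ?D j k) = p ?u * cnj (p ?w) - p ?w * cnj (p ?u)"
      unfolding P by (simp only: right_diff_distrib sum_subtractf)
    also have "K * ((\<Sum>j\<in>UNIV. ?D j j) - of_real c * (p ?u * cnj (p ?w) - p ?w * cnj (p ?u)))
       = cov2 (hgam c y) v"
      unfolding cov2_def hgam_def hinner_hbeta_hermitian p_def hbeta_hermitian[of ?u] K_def[symmetric]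
      by (simp only: right_diff_distrib mult_ac sum_subtractf)
    finally show ?thesis by simp
  qed
  moreover have "cov2 (hgam c y) v \<in> \<real>" for v
    by (simp add: cov2_def hgam_def hinner_def hbeta_def)
  ultimately show ?thesis unfolding real_11_covector_def by blast
qed

lemma mwedge_hgam:
  "mwedge (hgam c y) A vs = mwedge hbeta A vs - of_real c * ewedge (hinner y) (ewedge (hbeta y) A) vs"
  unfolding hgam_def[abs_def] by (rule mwedge_form_diff_scale)

lemma funpow_mwedge_commute:
  "(mwedge g ^^ p) ((mwedge h ^^ q) A) = (mwedge h ^^ q) ((mwedge g ^^ p) A)"
proof -
  have 1: "mwedge g (mwedge h B) = mwedge h (mwedge g B)" for B
    by (intro ext mwedge_commute)
  have 2: "mwedge g ((mwedge h ^^ q) B) = (mwedge h ^^ q) (mwedge g B)" for B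
    by (induction q arbitrary: B) (auto simp: 1)
  show ?thesis by (induction p) (auto simp: 2)
qed

text \<open>The rank one part has square zero, so the binomial expansion stops after the linear
  term.\<close>

lemma hgam_pow:
  fixes y :: "complex ^ 'n"
  shows "(mwedge (hgam c y) ^^ q) (mpow hbeta p) vs = mpow hbeta (p + q) vs
    - of_nat q * of_real c * ewedge (hinner y) (ewedge (hbeta y) (mpow hbeta (p + q - 1))) vs"
proof (induction q arbitrary: vs)
  case (Suc q)
  let ?R = "\<lambda>A. ewedge (hinner y) (ewedge (hbeta y) A)"
  let ?K = "of_nat q * complex_of_real c"
  define P :: "(complex ^ 'n) list \<Rightarrow> complex" where "P = mpow hbeta (p + q - 1)"
  have IH: "(mwedge (hgam c y) ^^ q) (mpow hbeta p) = (\<lambda>vs. mpow hbeta (p + q) vs - ?K * ?R P vs)"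
    by (intro ext) (simp only: Suc P_def)
  have RR: "?R (?R A) vs = 0" for A vs
  proof -
    have "ewedge (hbeta y) (ewedge (hinner y) B) = (\<lambda>vs. - ewedge (hinner y) (ewedge (hbeta y) B) vs)" for B
      by (intro ext ewedge_anticommute)
    then have "?R (?R A) vs = - ewedge (hinner y) (ewedge (hinner y) (ewedge (hbeta y) (ewedge (hbeta y) A))) vs"
      by (simp add: ewedge_minus)
    then show ?thesis by (simp add: ewedge_ewedge_self)
  qed
  have MR: "mwedge hbeta (?R A) vs = ?R (mwedge hbeta A) vs" for A vs
  proof -
    have "mwedge hbeta (ewedge (hbeta y) A) = ewedge (hbeta y) (mwedge hbeta A)"
      by (intro ext mwedge_ewedge)
    then show ?thesis by (simp add: mwedge_ewedge)
  qed
  \<comment> \<open>For q = 0 the factor \<open>?K\<close> is 0, so the truncated exponent p + q - 1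
    does no harm.\<close>
  have M: "?K * mwedge hbeta (?R P) vs = ?K * ?R (mpow hbeta (p + q)) vs"
  proof (cases q)
    case (Suc q')
    have "mwedge hbeta P = (mpow hbeta (p + q) :: (complex ^ 'n) list \<Rightarrow> complex)"
      by (simp add: mpow_Suc[symmetric] Suc P_def)
    then show ?thesis by (simp only: MR)
  qed simp
  have "(mwedge (hgam c y) ^^ Suc q) (mpow hbeta p) vs
     = mpow hbeta (Suc (p + q)) vs - ?K * ?R (mpow hbeta (p + q)) vs - of_real c * ?R (mpow hbeta (p + q)) vs"
    by (simp add: IH mwedge_hgam mwedge_diff mwedge_scale M ewedge_diff ewedge_scale RR mpow_Suc)
  then show ?case by (simp add: algebra_simps)
qed simp

lemma wedge_power_cov2: "wedge_power (cov2 h) j = wedge_list (map cov2 (replicate j h))"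
  by (simp add: wedge_power_def)

lemma wedge_powers:
  fixes g h :: "complex ^ 'n \<Rightarrow> complex ^ 'n \<Rightarrow> complex"
  assumes "\<And>u w. g u w = - g w u" "\<And>u w. h u w = - h w u"
  shows "wedge (2 * p) (2 * q) (wedge_power (cov2 g) p) (wedge_power (cov2 h) q) v
    = (mwedge g ^^ p) ((mwedge h ^^ q) vac) (map v [0..<2 * (p + q)])"
proof -
  have "wedge (2 * p) (2 * q) (wedge_power (cov2 g) p) (wedge_power (cov2 h) q)
     = wedge_list (map cov2 (replicate p g @ replicate q h))"
    using wedge_wedge_list[of "replicate p g" "map cov2 (replicate q h)"]
    by (simp add: wedge_power_cov2)
  then show ?thesis
    using wedge_list_mwedge[of "replicate p g @ replicate q h" v] assms
    by (auto simp: foldr_mwedge_replicate)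
qed

lemma mpow_hbeta_volume:
  fixes u :: "complex ^ 'n::finite"
  assumes "CARD('n) = Suc k"
  shows "linear \<xi> \<Longrightarrow> ewedge \<xi> (ewedge (hbeta u) (mpow hbeta k)) vlist
    = \<xi> u * mpow hbeta CARD('n) (vlist :: (complex ^ 'n) list) / of_nat CARD('n)"
  using frame.vol2[of \<xi> k u] unfolding assms[symmetric]
  by (simp add: field_simps)

text \<open>By \<open>hgam_pow\<close> and \<open>vol2\<close>, \<gamma>^j \<and> \<beta>^(n-j) is
  (1 - j \<kappa> |y|^2 / n) \<beta>^n. Among j = 1, ..., m the binding condition for positive
  \<kappa> is the one with j = m, and this is the hypothesis.\<close>

lemma m_positive_hgam:
  fixes y :: "complex ^ 'n::finite \<Rightarrow> complex ^ 'n"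
  assumes "m \<le> CARD('n)" and \<kappa>: "\<And>z. z \<in> S \<Longrightarrow> real m * (\<kappa> z * (norm (y z))\<^sup>2) \<le> real CARD('n)"
  shows "m_positive_on S m (\<lambda>z. cov2 (hgam (\<kappa> z) (y z)))"
  unfolding m_positive_on_def
proof (intro ballI conjI real_11_hgam)
  fix z j assume z: "z \<in> S" and j: "j \<in> {1..m}"
  let ?n = "CARD('n)"
  obtain k where k: "?n = Suc k" by (metis zero_less_card_finite gr0_implies_Suc)
  let ?h = "hgam (\<kappa> z) (y z)"
  let ?t = "\<kappa> z * (norm (y z))\<^sup>2"
  have jn: "j \<le> ?n" using j assms(1) by auto
  have "vol_coeff (wedge (2 * j) (2 * (?n - j)) (wedge_power (cov2 ?h) j) (wedge_power (beta z) (?n - j)))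
      = (mwedge ?h ^^ j) ((mwedge hbeta ^^ (?n - j)) vac) vlist"
    unfolding beta_eq
    using wedge_powers[of ?h hbeta j "?n - j", OF hgam_antisym hbeta_antisym] jn
    by (intro vol_coeff_list) simp
  also have "\<dots> = mpow hbeta ?n (vlist :: (complex ^ 'n) list) - of_nat j * of_real (\<kappa> z) * ewedge (hinner (y z)) (ewedge (hbeta (y z)) (mpow hbeta k)) vlist"
    using hgam_pow[where q=j and p="?n - j" and c="\<kappa> z" and y="y z" and vs=vlist] jn unfolding mpow_def[symmetric] by (simp add: k)
  also have "\<dots> = of_real (fact ?n / pi ^ ?n * (1 - real j * ?t / real ?n))"
    unfolding mpow_hbeta_volume[OF k linear_hinner] mpow_vlist
    by (simp add: hinner_def power2_norm_eq_inner right_diff_distrib)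
  also have "\<dots> \<in> \<real>\<^sub>\<ge>\<^sub>0"
  proof -
    have "real j * ?t \<le> real ?n"
    proof (cases "0 \<le> ?t")
      case True
      then have "real j * ?t \<le> real m * ?t" using j by (intro mult_right_mono) auto
      then show ?thesis using \<kappa>[OF z] by linarith
    next
      case False
      then have "?t \<le> 0" by linarith
      then have "real j * ?t \<le> 0" by (rule mult_nonneg_nonpos[rotated]) simp
      then show ?thesis by (meson of_nat_0_le_iff order_trans)
    qed
    then have "real j * ?t / real ?n \<le> 1" by (simp add: divide_le_eq)
    then show ?thesis by (subst nonneg_Reals_of_real_iff) (intro mult_nonneg_nonneg, auto)
  qed
  finally show "vol_coeff (wedge (2 * j) (2 * (?n - j)) (wedge_power (cov2 ?h) j) (wedge_power (beta z) (?n - j))) \<in> \<real>\<^sub>\<ge>\<^sub>0" .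
qed

section \<open>Test forms built from this family\<close>

definition gam_form :: "nat \<Rightarrow> (complex ^ 'n \<Rightarrow> real) \<Rightarrow> (complex ^ 'n \<Rightarrow> real) \<Rightarrow> complex ^ 'n \<Rightarrow> 'n dform" where
  "gam_form q f \<kappa> x = (\<lambda>z v. of_real (f z) * wedge_list (replicate q (cov2 (hgam (\<kappa> z) (z - x)))) v)"

lemma strongly_m_positive_gam_form:
  fixes x :: "complex ^ 'n::finite"
  assumes "m \<le> CARD('n)" "q \<le> CARD('n)" "\<And>z. z \<in> S \<Longrightarrow> 0 \<le> f z"
    and \<kappa>: "\<And>z. z \<in> S \<Longrightarrow> real m * (\<kappa> z * (norm (z - x))\<^sup>2) \<le> real CARD('n)"
  shows "strongly_m_positive_on S m q (gam_form q f \<kappa> x)"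
  unfolding strongly_m_positive_on_def
\<comment> \<open>A single product suffices: the term k = 0 carries the weight \<open>f\<close>, all
  others have weight 0. The binomial coefficient is positive since q \<le> n, so this index
  exists.\<close>
proof (intro exI[of _ "\<lambda>k z. if k = 0 then f z else 0"] exI[of _ "\<lambda>j k z. cov2 (hgam (\<kappa> z) (z - x))"] conjI allI impI ballI)
  fix z assume "z \<in> S"
  let ?N = "CARD('n) choose q"
  have N: "0 < ?N" using assms(2) by (simp add: zero_less_binomial)
  show "gam_form q f \<kappa> x z = (\<lambda>v. \<Sum>k < ?N. of_real (if k = 0 then f z else 0)
      * wedge_list (map (\<lambda>j. cov2 (hgam (\<kappa> z) (z - x))) [0..<q]) v)"
  proof
    fix v
    have "(\<Sum>k < ?N. of_real (if k = 0 then f z else 0) * wedge_list (map (\<lambda>j. cov2 (hgam (\<kappa> z) (z - x))) [0..<q]) v)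
       = (\<Sum>k \<in> {0::nat}. of_real (if k = 0 then f z else 0) * wedge_list (map (\<lambda>j. cov2 (hgam (\<kappa> z) (z - x))) [0..<q]) v)"
      by (rule sum.mono_neutral_right) (use N in auto)
    then show "gam_form q f \<kappa> x z v = (\<Sum>k < ?N. of_real (if k = 0 then f z else 0)
      * wedge_list (map (\<lambda>j. cov2 (hgam (\<kappa> z) (z - x))) [0..<q]) v)"
      by (simp add: gam_form_def map_replicate_const)
  qed
qed (use assms in \<open>auto intro: m_positive_hgam\<close>)

lemma wedge_scale_right: "wedge p q \<alpha> (\<lambda>v. c * \<gamma> v) v = c * wedge p q \<alpha> \<gamma> v"
  by (simp add: wedge_def sum_distrib_left mult_ac)

text \<open>
  The function \<open>k\<close> replaces \<open>f \<kappa>\<close>, which need not be smooth at \<open>x\<close>.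
\<close>

definition gam_list :: "nat \<Rightarrow> nat \<Rightarrow> (complex ^ 'n \<Rightarrow> real) \<Rightarrow> (complex ^ 'n \<Rightarrow> real) \<Rightarrow> complex ^ 'n
    \<Rightarrow> complex ^ 'n \<Rightarrow> (complex ^ 'n) list \<Rightarrow> complex" where
  "gam_list r q f k x z vs = of_real (f z) * mpow hbeta r vs
    - of_nat q * of_real (k z) * ewedge (hinner (z - x)) (ewedge (hbeta (z - x)) (mpow hbeta (r - 1))) vs"

lemma smooth_ewedge:
  assumes "\<And>v. smooth (\<lambda>z. \<xi> z v)" "\<And>vs. smooth (\<lambda>z. A z vs)"
  shows "smooth (\<lambda>z. ewedge (\<xi> z) (A z) vs :: complex)"
  using assms(2)
proof (induction vs arbitrary: A)
  case (Cons v vs)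
  have "smooth (\<lambda>z. ewedge (\<xi> z) (\<lambda>ws. A z (v # ws)) vs)"
    using Cons.prems by (intro Cons.IH)
  then show ?case using assms(1) Cons.prems by (auto intro!: smooth_diff smooth_mult)
qed (simp add: smooth_const)

lemma smooth_hinner: "smooth (\<lambda>z. hinner (z - x) v)"
  unfolding hinner_def by (intro smooth_of_real smooth_inner smooth_diff smooth_ident smooth_const)

lemma smooth_J: "smooth (\<lambda>z. J (z - x) :: complex ^ 'n::finite)"
  by (rule smooth_linear_compose[OF bounded_linear_J]) (intro smooth_diff smooth_ident smooth_const)

lemma smooth_hbeta: "smooth (\<lambda>z. hbeta (z - x) v)"
  unfolding hbeta_def divide_inverse
  by (intro smooth_of_real smooth_mult smooth_inner smooth_J smooth_const)

lemma smooth_gam_list: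
  assumes "smooth f" "smooth k" shows "smooth (\<lambda>z. gam_list r q f k x z vs)"
  unfolding gam_list_def
  by (intro smooth_diff smooth_mult smooth_of_real smooth_const assms smooth_ewedge smooth_hinner smooth_hbeta)

lemma gam_form_list:
  fixes x :: "complex ^ 'n::finite"
  assumes "\<And>z. z \<noteq> x \<Longrightarrow> f z * \<kappa> z = k z"
  shows "wedge (2 * p) (2 * q) (wedge_power (beta z) p) (gam_form q f \<kappa> x z) v
    = gam_list (p + q) q f k x z (map v [0..<2 * (p + q)])"
proof -
  let ?h = "hgam (\<kappa> z) (z - x)"
  have "wedge (2 * p) (2 * q) (wedge_power (beta z) p) (gam_form q f \<kappa> x z) v
     = of_real (f z) * wedge (2 * p) (2 * q) (wedge_power (cov2 hbeta) p) (wedge_power (cov2 ?h) q) v"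
    unfolding gam_form_def wedge_scale_right beta_eq by (simp add: wedge_power_def)
  also have "\<dots> = of_real (f z) * (mwedge ?h ^^ q) (mpow hbeta p) (map v [0..<2 * (p + q)])"
    by (simp add: wedge_powers[OF hbeta_antisym hgam_antisym] funpow_mwedge_commute[where g=hbeta] mpow_def)
  also have "\<dots> = gam_list (p + q) q f k x z (map v [0..<2 * (p + q)])"
  \<comment> \<open>At \<open>x\<close> the vector z - x is 0 and kills the rank one part, whatever
    values \<kappa> and \<open>k\<close> take there.\<close>
  proof (cases "z = x")
    case True
    have "hinner (0::complex ^ 'n) = (\<lambda>v. 0)" by (simp add: hinner_def fun_eq_iff)
    then have "ewedge (hinner (z - x)) B vs = 0" for B vs
      using ewedge_vanish[of vs "hinner (z - x)"] True by simp
    then show ?thesis by (simp add: hgam_pow gam_list_def)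
  next
    case False
    show ?thesis unfolding hgam_pow gam_list_def assms[OF False, symmetric]
      by (simp add: algebra_simps)
  qed
  finally show ?thesis .
qed

lemma gam_form_list0:
  fixes x :: "complex ^ 'n::finite"
  assumes "\<And>z. z \<noteq> x \<Longrightarrow> f z * \<kappa> z = k z"
  shows "gam_form q f \<kappa> x z v = gam_list q q f k x z (map v [0..<2 * q])"
proof -
  have "gam_form q f \<kappa> x z v = wedge (2 * 0) (2 * q) (wedge_power (beta z) 0) (gam_form q f \<kappa> x z) v"
    using alternating_wedge_list[of "replicate q (cov2 (hgam (\<kappa> z) (z - x)))"]
    by (simp add: wedge_Alt wedge_power_def gam_form_def Alt_scale alternating_def)
  then show ?thesis using gam_form_list[OF assms, where p=0 and q=q and z=z and v=v] by simp
qed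

text \<open>With y = w - x: |y|^2 times the inner product of the components of \<open>a\<close> and
  \<open>e\<close> orthogonal to the complex line of y.\<close>

abbreviation radial_defect :: "complex ^ 'n \<Rightarrow> complex ^ 'n \<Rightarrow> complex ^ 'n \<Rightarrow> complex ^ 'n \<Rightarrow> real" where
  "radial_defect x a e w \<equiv>
    (norm (w - x))\<^sup>2 * (a \<bullet> e) - (w - x) \<bullet> a * ((w - x) \<bullet> e) - J (w - x) \<bullet> a * (J (w - x) \<bullet> e)"

abbreviation gam_wedge :: "nat \<Rightarrow> nat \<Rightarrow> (complex ^ 'n::finite \<Rightarrow> real) \<Rightarrow> (complex ^ 'n \<Rightarrow> real) \<Rightarrow> complex ^ 'n \<Rightarrow> 'n dform" where
  "gam_wedge p q f \<kappa> x \<equiv>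
    \<lambda>z. wedge (2 * p) (2 * (CARD('n) - 1 - p)) (wedge_power (beta z) p) (gam_form q f \<kappa> x z)"

text \<open>The smooth part is evaluated by \<open>vol2\<close>. For the rank one part,
  \<open>vol4\<close> contracts with y = w - x, and its three terms are the three terms of
  \<open>radial_defect\<close>.\<close>

lemma vol_gam_list:
  fixes x :: "complex ^ 'n::finite"
  assumes n: "CARD('n) = Suc (Suc r)"
  shows "ewedge (hinner a) (ewedge (hbeta e) (gam_list (Suc r) q f k x w)) vlist
    = of_real (fact CARD('n) / pi ^ CARD('n) / real CARD('n) * (f w * (a \<bullet> e) - real q / real (Suc r) * k w * radial_defect x a e w))"
proof -
  define y where "y = w - x"
  define C where "C = fact CARD('n) / pi ^ CARD('n) / real CARD('n)"
  let ?M = "mpow hbeta (Suc r) :: (complex ^ 'n) list \<Rightarrow> complex"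
  have V2: "linear \<xi> \<Longrightarrow> ewedge \<xi> (ewedge (hbeta u) ?M) vlist = \<xi> u * of_real C" for \<xi> u
    using mpow_hbeta_volume[OF n, of \<xi> u] by (simp add: mpow_vlist C_def)
  \<comment> \<open>Written as \<open>hbeta\<close> of a vector, the covector becomes accessible to
    \<open>V2\<close>.\<close>
  have hy: "hinner y = hbeta (- pi *\<^sub>R J y)"
  proof
    fix v
    have Jm: "J (- pi *\<^sub>R J u) = pi *\<^sub>R u" for u :: "complex ^ 'n"
      by (simp add: linear_scale[OF bounded_linear.linear[OF bounded_linear_J]] J_J
          linear_neg[OF bounded_linear.linear[OF bounded_linear_J]])
    show "hinner y v = hbeta (- pi *\<^sub>R J y) v" unfolding hinner_def hbeta_def Jm by simp
  qed
  have v1: "ewedge (hbeta e) (ewedge (hinner y) ?M) vlist = - hinner y e * of_real C"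
    by (subst ewedge_anticommute) (simp add: V2 linear_hinner)
  have v2: "ewedge (hinner a) (ewedge (hinner y) ?M) vlist = of_real (- pi * (a \<bullet> J y)) * of_real C"
    by (subst hy) (simp add: V2 linear_hinner hinner_def)
  have v3: "ewedge (hinner a) (ewedge (hbeta e) ?M) vlist = of_real (a \<bullet> e) * of_real C"
    using V2[OF linear_hinner, of a e] by (simp only: hinner_def[of a e])
  have v4: "of_nat (Suc r) * ewedge (hinner a) (ewedge (hbeta e) (ewedge (hinner y) (ewedge (hbeta y) (mpow hbeta r)))) vlist
     = of_real (C * ((norm y)\<^sup>2 * (a \<bullet> e) - y \<bullet> a * (y \<bullet> e) - J y \<bullet> a * (J y \<bullet> e)))"
  proof -
    have "hbeta e y = - of_real (J y \<bullet> e / pi)"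
      using hbeta_antisym[of e y] by (simp add: hbeta_def)
    then show ?thesis
      unfolding frame.vol4[OF linear_hinner linear_hbeta linear_hinner] v1 v2 v3
      by (simp add: hinner_def power2_norm_eq_inner inner_commute algebra_simps)
  qed
  have "ewedge (hinner a) (ewedge (hbeta e) (gam_list (Suc r) q f k x w)) vlist
    = of_real (f w) * ewedge (hinner a) (ewedge (hbeta e) ?M) vlist - of_nat q * of_real (k w) *
      ewedge (hinner a) (ewedge (hbeta e) (ewedge (hinner y) (ewedge (hbeta y) (mpow hbeta r)))) vlist"
  proof -
    have "ewedge (hbeta e) (gam_list (Suc r) q f k x w) = (\<lambda>vs. of_real (f w) * ewedge (hbeta e) ?M vs - of_nat q * of_real (k w) *
        ewedge (hbeta e) (ewedge (hinner y) (ewedge (hbeta y) (mpow hbeta r))) vs)"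
      unfolding gam_list_def[abs_def] y_def by (intro ext) (simp add: ewedge_diff ewedge_scale)
    then show ?thesis by (simp add: ewedge_diff ewedge_scale)
  qed
  also have "ewedge (hinner a) (ewedge (hbeta e) (ewedge (hinner y) (ewedge (hbeta y) (mpow hbeta r)))) vlist
    = of_real (C * ((norm y)\<^sup>2 * (a \<bullet> e) - y \<bullet> a * (y \<bullet> e) - J y \<bullet> a * (J y \<bullet> e)) / real (Suc r))"
    unfolding of_real_divide v4[symmetric] by (simp del: of_nat_Suc)
  finally show ?thesis unfolding y_def[symmetric] C_def[symmetric] v3 by (simp add: algebra_simps add_divide_distrib diff_divide_distrib del: of_nat_Suc)
qed

lemma vol_ddc_gam_form:
  fixes x :: "complex ^ 'n::finite"
  assumes n: "CARD('n) = Suc (Suc r)" and pq: "p + q = Suc r"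
    and fk: "smooth f" "smooth k" and \<kappa>: "\<And>z. z \<noteq> x \<Longrightarrow> f z * \<kappa> z = k z"
  shows "vol_coeff (ddc (2 * CARD('n) - 2) (gam_wedge p q f \<kappa> x) z)
    = of_real (fact CARD('n) / pi ^ CARD('n) / (4 * real CARD('n)) * (\<Sum>a\<in>Basis. \<Sum>e\<in>Basis.
       dd a (dd e (\<lambda>w. f w * (a \<bullet> e) - real q / real (Suc r) * (k w * radial_defect x a e w))) z))"
proof -
  let ?C = "fact CARD('n) / pi ^ CARD('n) / real CARD('n)"
  let ?G = "\<lambda>a e w. f w * (a \<bullet> e) - real q / real (Suc r) * (k w * radial_defect x a e w)"
  let ?\<omega> = "gam_wedge p q f \<kappa> x"
  have q: "CARD('n) - 1 - p = q" using n pq by simp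
  have k2: "2 * CARD('n) - 2 = 2 * (p + q)" "Suc (Suc (2 * (p + q))) = 2 * CARD('n)" using n pq by auto
  have \<omega>: "?\<omega> z v = gam_list (Suc r) q f k x z (map v [0..<2 * (p + q)])" for z v
    unfolding q pq[symmetric] by (rule gam_form_list[OF \<kappa>])
  have sG: "smooth (?G a e)" for a e
    by (intro smooth_diff smooth_mult smooth_const fk smooth_norm2 smooth_inner smooth_J smooth_ident)
  have "ddc (2 * CARD('n) - 2) ?\<omega> z v = (1/4) * (\<Sum>a\<in>Basis. \<Sum>e\<in>Basis.
    dd a (dd e (\<lambda>w. ewedge (hinner a) (ewedge (hbeta e) (gam_list (Suc r) q f k x w)) (map v [0..<2 * CARD('n)]))) z)" for v
    unfolding k2(1)
    by (subst k2(2)[symmetric], rule ddc_expand) (simp_all only: \<omega> smooth_gam_list[OF fk])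
  then have "vol_coeff (ddc (2 * CARD('n) - 2) ?\<omega> z) = (1/4) * (\<Sum>a\<in>Basis. \<Sum>e\<in>Basis.
    dd a (dd e (\<lambda>w. ewedge (hinner a) (ewedge (hbeta e) (gam_list (Suc r) q f k x w)) vlist)) z)"
    by (rule vol_coeff_list)
  also have "\<dots> = (1/4) * (\<Sum>a\<in>Basis. \<Sum>e\<in>Basis. dd a (dd e (\<lambda>w. of_real (?C * ?G a e w))) z)"
    unfolding vol_gam_list[OF n] by (simp only: mult.assoc)
  also have "\<dots> = (1/4) * (\<Sum>a\<in>Basis. \<Sum>e\<in>Basis. of_real (?C * dd a (dd e (?G a e)) z))"
  proof -
    have "dd a (dd e (\<lambda>w. complex_of_real (?C * ?G a e w))) z = of_real (?C * dd a (dd e (?G a e)) z)" for a e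
    proof -
      have s1: "smooth (\<lambda>w. ?C * ?G a e w)" by (intro smooth_mult smooth_const sG)
      have "dd e (\<lambda>w. complex_of_real (?C * ?G a e w)) = (\<lambda>w. of_real (?C * dd e (?G a e) w))"
        by (rule ext) (simp only: dd_linear_compose[OF bounded_linear_of_real s1] dd_scale[OF sG])
      moreover have "dd a (\<lambda>w. complex_of_real (?C * dd e (?G a e) w)) z = of_real (?C * dd a (dd e (?G a e)) z)"
        by (simp only: dd_linear_compose[OF bounded_linear_of_real smooth_mult[OF smooth_const smooth_dd[OF sG]]]
            dd_scale[OF smooth_dd[OF sG]])
      ultimately show ?thesis by simp
    qed
    then show ?thesis by simp
  qed
  also have "\<dots> = of_real ((1/4) * (?C * (\<Sum>a\<in>Basis. \<Sum>e\<in>Basis. dd a (dd e (?G a e)) z)))"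
    by (simp only: of_real_mult of_real_sum of_real_divide of_real_1 of_real_numeral sum_distrib_left[symmetric])
  finally show ?thesis by simp
qed

section \<open>Radial computations\<close>

definition lapl :: "('a::euclidean_space \<Rightarrow> real) \<Rightarrow> 'a \<Rightarrow> real" where
  "lapl f z = (\<Sum>a\<in>Basis. dd a (dd a f) z)"

lemma lapl_add: "smooth f \<Longrightarrow> smooth g \<Longrightarrow> lapl (\<lambda>x. f x + g x) z = lapl f z + lapl g z"
  by (simp add: lapl_def dd_add smooth_dd sum.distrib)

lemma lapl_scale: "smooth f \<Longrightarrow> lapl (\<lambda>x. c * f x) z = c * lapl f z"
  by (simp add: lapl_def dd_scale smooth_dd sum_distrib_left)

lemma smooth_lapl: "smooth f \<Longrightarrow> smooth (lapl f)"
  unfolding lapl_def[abs_def] by (intro smooth_sum smooth_dd)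

lemma test_function_lapl: "test_function U f \<Longrightarrow> test_function U (lapl f)"
proof -
  assume "test_function U f"
  then obtain K where K: "smooth f" "compact K" "K \<subseteq> U" "\<And>x. x \<notin> K \<Longrightarrow> f x = 0"
    by (rule test_function_supportE) (rule that)
  note c = compact_imp_closed[OF K(2)]
  have "lapl f x = 0" if "x \<notin> K" for x
    unfolding lapl_def by (intro sum.neutral ballI dd_zero_off[OF c dd_zero_off[OF c K(4)] that])
  then show ?thesis by (rule test_functionI[OF smooth_lapl[OF K(1)] K(2,3)])
qed

lemma sum_dd_inner:
  fixes f :: "'a::euclidean_space \<Rightarrow> real"
  shows "smooth f \<Longrightarrow> (\<Sum>e\<in>Basis. dd e f w * (a \<bullet> e)) = dd a f w"
  using dd_expand[where f=f and u=a and x=w] by (simp add: mult.commute)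

lemma smooth_real_derivative:
  fixes g :: "real \<Rightarrow> real"
  assumes "smooth g" shows "(g has_real_derivative dd 1 g t) (at t)"
proof -
  have "frechet_derivative g (at t) = (*) (dd 1 g t)"
  proof
    fix u
    show "frechet_derivative g (at t) u = dd 1 g t * u"
      using linear_scale[OF dd_linear[OF assms, of t], of u 1] by (simp add: mult.commute)
  qed
  then show ?thesis
    using smooth_has_derivative[OF assms, of t] by (simp only: has_field_derivative_def)
qed

lemma has_derivative_radial:
  fixes x :: "'a::real_inner" and g :: "real \<Rightarrow> real"
  assumes "(g has_real_derivative d) (at ((norm (w - x))\<^sup>2))"
  shows "((\<lambda>w. g ((norm (w - x))\<^sup>2)) has_derivative (\<lambda>u. d * (2 * ((w - x) \<bullet> u)))) (at w)"
  using has_derivative_compose[OF has_derivative_norm2 assms[unfolded has_field_derivative_def]] by simp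

text \<open>As a form in \<open>e\<close>, \<open>radial_defect\<close> annihilates w - x, so the
  derivative of \<open>b\<close> drops out; the divergence of the quadratic expression is - 2 (n -
  1) (w - x) \<bullet> a. For b = - h' the result is n - 1 times the derivative of h(|w - x|^2) in
  direction \<open>a\<close>.\<close>

lemma sum_dd_radial:
  fixes x w a :: "complex ^ 'n::finite"
  assumes n: "CARD('n) = Suc (Suc r)" and b: "smooth b"
  shows "(\<Sum>e\<in>Basis. dd e (\<lambda>w. b ((norm (w - x))\<^sup>2) * radial_defect x a e w) w)
    = - 2 * real (Suc r) * (b ((norm (w - x))\<^sup>2) * ((w - x) \<bullet> a))"
proof -
  define y where "y = w - x"
  define t where "t = (norm y)\<^sup>2"
  define d where "d = dd 1 b t"
  have db: "((\<lambda>w. b ((norm (w - x))\<^sup>2)) has_derivative (\<lambda>u. d * (2 * (y \<bullet> u)))) (at w)"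
    using has_derivative_radial[OF smooth_real_derivative[OF b], where w=w and x=x] by (simp add: y_def t_def d_def)
  have dJ: "((\<lambda>w. J (w - x)) has_derivative J) (at w)"
  proof -
    have "((\<lambda>w. w - x) has_derivative (\<lambda>u. u)) (at w)" by (auto intro!: derivative_eq_intros)
    then show ?thesis by (rule bounded_linear.has_derivative[OF bounded_linear_J])
  qed
  have dd: "dd e (\<lambda>w. b ((norm (w - x))\<^sup>2) * radial_defect x a e w) w
    = b t * (2 * (y \<bullet> e) * (a \<bullet> e) - ((e \<bullet> a) * (y \<bullet> e) + (y \<bullet> a) * (e \<bullet> e)) - ((J e \<bullet> a) * (J y \<bullet> e) + (J y \<bullet> a) * (J e \<bullet> e)))
     + (d * (2 * (y \<bullet> e))) * (t * (a \<bullet> e) - (y \<bullet> a) * (y \<bullet> e) - (J y \<bullet> a) * (J y \<bullet> e))" for e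
  proof -
    have 1: "((\<lambda>w. (w - x) \<bullet> c) has_derivative (\<lambda>u. u \<bullet> c)) (at w)" for c
      by (auto intro!: derivative_eq_intros)
    have 2: "((\<lambda>w. J (w - x) \<bullet> c) has_derivative (\<lambda>u. J u \<bullet> c)) (at w)" for c
      using bounded_linear.has_derivative[OF bounded_linear_inner_left dJ, of c] .
    have D: "((\<lambda>w. b ((norm (w - x))\<^sup>2) * radial_defect x a e w)
      has_derivative (\<lambda>u. b t * (2 * (y \<bullet> u) * (a \<bullet> e) - ((u \<bullet> a) * (y \<bullet> e) + (y \<bullet> a) * (u \<bullet> e)) - ((J u \<bullet> a) * (J y \<bullet> e) + (J y \<bullet> a) * (J u \<bullet> e)))
     + (d * (2 * (y \<bullet> u))) * (t * (a \<bullet> e) - (y \<bullet> a) * (y \<bullet> e) - (J y \<bullet> a) * (J y \<bullet> e)))) (at w)"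
      by (rule has_derivative_eq_rhs, rule has_derivative_mult[OF db])
        (rule has_derivative_diff has_derivative_mult has_derivative_norm2 1 2 has_derivative_const |
          simp add: y_def[symmetric] t_def[symmetric] fun_eq_iff)+
    from dd_eqI[OF D, of e] show ?thesis .
  qed
  have N: "(\<Sum>e\<in>(Basis :: (complex ^ 'n) set). e \<bullet> e) = 2 * real (Suc (Suc r))"
    using n by (simp add: inner_Basis)
  have s1: "(\<Sum>e\<in>Basis. (u \<bullet> e) * (v \<bullet> e)) = u \<bullet> v" for u v :: "complex ^ 'n"
    using euclidean_inner[of u v] by simp
  have s2: "(\<Sum>e\<in>Basis. (J e \<bullet> a) * (J y \<bullet> e)) = - (y \<bullet> a)"
  proof -
    have "(\<Sum>e\<in>Basis. (J e \<bullet> a) * (J y \<bullet> e)) = - (\<Sum>e\<in>Basis. (J a \<bullet> e) * (J y \<bullet> e))"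
      by (simp add: inner_J[of _ a] inner_commute[of _ "J a"] sum_negf)
    then show ?thesis by (simp only: s1 inner_J_J) (simp add: inner_commute)
  qed
  have "(\<Sum>e\<in>Basis. b t * (2 * (y \<bullet> e) * (a \<bullet> e) - ((e \<bullet> a) * (y \<bullet> e) + (y \<bullet> a) * (e \<bullet> e)) - ((J e \<bullet> a) * (J y \<bullet> e) + (J y \<bullet> a) * (J e \<bullet> e)))
     + (d * (2 * (y \<bullet> e))) * (t * (a \<bullet> e) - (y \<bullet> a) * (y \<bullet> e) - (J y \<bullet> a) * (J y \<bullet> e)))
    = (\<Sum>e\<in>Basis. b t * (2 * ((y \<bullet> e) * (a \<bullet> e)) - ((a \<bullet> e) * (y \<bullet> e) + (y \<bullet> a) * (e \<bullet> e)) - (J e \<bullet> a) * (J y \<bullet> e))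
     + 2 * d * (t * ((y \<bullet> e) * (a \<bullet> e)) - (y \<bullet> a) * ((y \<bullet> e) * (y \<bullet> e)) - (J y \<bullet> a) * ((y \<bullet> e) * (J y \<bullet> e))))"
    by (intro sum.cong refl) (simp add: inner_J_self inner_J_self[unfolded inner_commute[of "J _"]] inner_commute algebra_simps)
  also have "\<dots> = b t * (2 * (y \<bullet> a) - (a \<bullet> y + (y \<bullet> a) * (2 * real (Suc (Suc r)))) - (- (y \<bullet> a)))
     + 2 * d * (t * (y \<bullet> a) - (y \<bullet> a) * (y \<bullet> y) - (J y \<bullet> a) * (y \<bullet> J y))"
    by (simp only: sum.distrib sum_subtractf sum_distrib_left[symmetric] s1 s2 N)
  also have "\<dots> = - 2 * real (Suc r) * (b t * (y \<bullet> a))"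
    using inner_J_self[of y] by (simp add: t_def power2_norm_eq_inner inner_commute algebra_simps)
  finally show ?thesis unfolding dd unfolding y_def t_def .
qed

lemma dd_radial:
  fixes x w a :: "'a::real_inner" and g :: "real \<Rightarrow> real"
  assumes "\<And>t. (g has_real_derivative d t) (at t)"
  shows "dd a (\<lambda>w. g ((norm (w - x))\<^sup>2)) w = d ((norm (w - x))\<^sup>2) * (2 * ((w - x) \<bullet> a))"
  by (rule dd_eqI has_derivative_radial assms)+

lemma smooth_radial:
  fixes x :: "'a::real_inner" and g :: "real \<Rightarrow> real"
  shows "smooth g \<Longrightarrow> smooth (\<lambda>w. g ((norm (w - x))\<^sup>2))"
  by (rule smooth_compose[OF _ smooth_norm2])

text \<open>The coordinate version of dd^c(b dt \<and> d^c t) = dd^c h \<and> \<beta>, b = - h'. The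
  inner sum is a gradient by \<open>sum_dd_radial\<close>, so the outer one is a Laplacian, and n -
  1 cancels the denominator \<open>Suc r\<close>.\<close>

lemma sum_dd_gam:
  fixes x z :: "complex ^ 'n::finite"
  assumes n: "CARD('n) = Suc (Suc r)" and b: "smooth b" and c: "smooth h"
    and h: "\<And>t. (h has_real_derivative - b t) (at t)" and F: "smooth F"
  shows "(\<Sum>a\<in>Basis. \<Sum>e\<in>Basis. dd a (dd e (\<lambda>w. F w * (a \<bullet> e) - real q / real (Suc r) * (s * b ((norm (w - x))\<^sup>2) * radial_defect x a e w))) z)
    = lapl F z - real q * s * lapl (\<lambda>w. h ((norm (w - x))\<^sup>2)) z"
proof -
  define K where "K = real q / real (Suc r) * s"
  let ?H = "\<lambda>a e w. b ((norm (w - x))\<^sup>2) * radial_defect x a e w"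
  let ?X = "\<lambda>w. h ((norm (w - x))\<^sup>2)"
  have sH: "smooth (?H a e)" for a e
    by (intro smooth_diff smooth_mult smooth_const smooth_radial b smooth_norm2 smooth_inner smooth_J smooth_ident)
  have sX: "smooth ?X" by (rule smooth_radial[OF c])
  have e: "F w * (a \<bullet> e) - real q / real (Suc r) * (s * b ((norm (w - x))\<^sup>2) * radial_defect x a e w)
       = (a \<bullet> e) * F w - K * ?H a e w" for a e w
    by (simp add: K_def mult_ac)
  have sG: "smooth (\<lambda>w. (a \<bullet> e) * F w - K * ?H a e w)" for a e
    by (intro smooth_diff smooth_mult[OF smooth_const] F sH)
  have D: "(\<Sum>e\<in>Basis. dd e (\<lambda>w. (a \<bullet> e) * F w - K * ?H a e w) w) = dd a F w - real q * s * dd a ?X w" for a w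
  proof -
    have "(\<Sum>e\<in>Basis. dd e (\<lambda>w. (a \<bullet> e) * F w - K * ?H a e w) w)
       = (\<Sum>e\<in>Basis. dd e F w * (a \<bullet> e)) - K * (\<Sum>e\<in>Basis. dd e (?H a e) w)"
      unfolding dd_diff[OF smooth_mult[OF smooth_const F] smooth_mult[OF smooth_const sH]] dd_scale[OF F] dd_scale[OF sH]
      by (simp add: sum_subtractf sum_distrib_left mult.commute)
    also have "K * (\<Sum>e\<in>Basis. dd e (?H a e) w) = real q * s * dd a ?X w"
      unfolding sum_dd_radial[OF n b] dd_radial[OF h] by (simp add: K_def del: of_nat_Suc)
    finally show ?thesis by (simp add: sum_dd_inner[OF F])
  qed
  have "(\<Sum>e\<in>Basis. dd a (dd e (\<lambda>w. (a \<bullet> e) * F w - K * ?H a e w)) z)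
      = dd a (dd a F) z - real q * s * dd a (dd a ?X) z" for a
  proof -
    have "(\<Sum>e\<in>Basis. dd a (dd e (\<lambda>w. (a \<bullet> e) * F w - K * ?H a e w)) z)
       = dd a (\<lambda>w. \<Sum>e\<in>Basis. dd e (\<lambda>w. (a \<bullet> e) * F w - K * ?H a e w) w) z"
      by (rule dd_sum[symmetric]) (rule smooth_dd[OF sG])
    also have "\<dots> = dd a (\<lambda>w. dd a F w - real q * s * dd a ?X w) z" unfolding D ..
    also have "\<dots> = dd a (dd a F) z - real q * s * dd a (dd a ?X) z"
      by (simp only: dd_diff[OF smooth_dd[OF F] smooth_mult[OF smooth_const smooth_dd[OF sX]]] dd_scale[OF smooth_dd[OF sX]])
    finally show ?thesis .
  qed
  then show ?thesis unfolding e lapl_def by (simp add: sum_subtractf sum_distrib_left)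
qed

text \<open>The density of dd^c f \<and> \<beta>^(n-1) is this constant times the Laplacian of f: n!
  / \<pi>^n comes from \<beta>^n, 1 / n from \<open>vol2\<close> and 1 / 4 from
  \<open>ddc_expand\<close>.\<close>

definition trace_const :: "'n itself \<Rightarrow> real" where
  "trace_const _ = fact CARD('n) / pi ^ CARD('n) / (4 * real CARD('n))"

lemma vol_ddc_radial:
  fixes x :: "complex ^ 'n::finite"
  assumes n: "CARD('n) = Suc (Suc r)" and pq: "p + q = Suc r"
    and b: "smooth b" and c: "smooth h"
    and h: "\<And>t. (h has_real_derivative - b t) (at t)" and F: "smooth F"
    and \<kappa>: "\<And>z. z \<noteq> x \<Longrightarrow> F z * \<kappa> z = s * b ((norm (z - x))\<^sup>2)"
  shows "vol_coeff (ddc (2 * CARD('n) - 2) (gam_wedge p q F \<kappa> x) z)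
    = of_real (trace_const TYPE('n) * (lapl F z - real q * s * lapl (\<lambda>w. h ((norm (w - x))\<^sup>2)) z))"
proof -
  have k: "smooth (\<lambda>w. s * b ((norm (w - x))\<^sup>2))" by (intro smooth_mult smooth_const smooth_radial b)
  have "vol_coeff (ddc (2 * CARD('n) - 2) (gam_wedge p q F \<kappa> x) z)
    = of_real (fact CARD('n) / pi ^ CARD('n) / (4 * real CARD('n)) * (\<Sum>a\<in>Basis. \<Sum>e\<in>Basis.
       dd a (dd e (\<lambda>w. F w * (a \<bullet> e) - real q / real (Suc r) * (s * b ((norm (w - x))\<^sup>2) * radial_defect x a e w))) z))"
    by (rule vol_ddc_gam_form[OF n pq F k \<kappa>])
  then show ?thesis
    unfolding sum_dd_gam[OF n b c h F] trace_const_def .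
qed

lemma vol_ddc_beta:
  fixes x :: "complex ^ 'n::finite"
  assumes n: "CARD('n) = Suc (Suc r)" and pq: "p + q = Suc r" and F: "smooth F"
  shows "vol_coeff (ddc (2 * CARD('n) - 2) (gam_wedge p q F (\<lambda>_. 0) x) z)
    = of_real (trace_const TYPE('n) * lapl F z)"
  using vol_ddc_radial[OF n pq smooth_const smooth_const _ F, of 0 0 x "\<lambda>_. 0" 0 z] by simp

section \<open>The trace measure\<close>

text \<open>The real counterpart of the trace pairing, with the Laplacian for dd^c;
  \<open>ddc_beta_pairing_test\<close> identifies the two.\<close>

definition pair_T :: "(complex ^ 'n::finite) set \<Rightarrow> (complex ^ 'n \<Rightarrow> ereal) \<Rightarrow> (complex ^ 'n \<Rightarrow> real) \<Rightarrow> real" where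
  "pair_T \<Omega> \<phi> f = (LINT z:\<Omega>|lborel. real_of_ereal (\<phi> z) * (trace_const TYPE('n) * lapl f z))"

lemma ddc_pairing_real:
  fixes \<Omega> :: "(complex ^ 'n::finite) set"
  assumes "\<And>z. vol_coeff (ddc (2 * CARD('n) - 2) \<gamma> z) = of_real (g z)"
  shows "ddc_pairing \<Omega> \<phi> \<gamma> = of_real (LINT z:\<Omega>|lborel. real_of_ereal (\<phi> z) * g z)"
proof -
  have "ddc_pairing \<Omega> \<phi> \<gamma> = (LINT z|lborel. complex_of_real (indicator \<Omega> z *\<^sub>R (real_of_ereal (\<phi> z) * g z)))"
    unfolding ddc_pairing_def set_lebesgue_integral_def assms
    by (intro Bochner_Integration.integral_cong refl) (auto simp: indicator_def)
  then show ?thesis unfolding set_lebesgue_integral_def by (simp only: integral_complex_of_real)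
qed

lemma subharmonic_times_test_integrable:
  fixes \<Omega> :: "(complex ^ 'n::finite) set"
  assumes "open \<Omega>" "subharmonic_on \<Omega> \<phi>" "test_function \<Omega> g"
  shows "set_integrable lborel \<Omega> (\<lambda>z. real_of_ereal (\<phi> z) * g z)"
proof -
  obtain K where K: "smooth g" "compact K" "K \<subseteq> \<Omega>" "\<And>x. x \<notin> K \<Longrightarrow> g x = 0"
    using assms(3) by (rule test_function_supportE) (rule that)
  obtain B where B: "B > 0" "\<And>x. \<bar>g x\<bar> \<le> B" by (rule test_function_bounded[OF assms(3)]) (rule that)
  let ?u = "\<lambda>z. indicator K z *\<^sub>R real_of_ereal (\<phi> z)"
  have i: "integrable lborel ?u"
    using subharmonic_locally_integrable[OF assms(1,2) K(2,3)] unfolding set_integrable_def .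
  have g: "g \<in> borel_measurable lborel"
    using borel_measurable_continuous_onI[OF smooth_continuous[OF K(1)]] by simp
  have "integrable lborel (\<lambda>z. ?u z * g z)"
  proof (rule Bochner_Integration.integrable_bound)
    show "integrable lborel (\<lambda>z. B * ?u z)" using i by (rule integrable_mult_right)
    show "(\<lambda>z. ?u z * g z) \<in> borel_measurable lborel"
      using borel_measurable_integrable[OF i] g by (rule borel_measurable_times)
    show "AE z in lborel. norm (?u z * g z) \<le> norm (B * ?u z)"
    proof (rule AE_I2)
      fix z
      have "norm (?u z * g z) = norm (?u z) * \<bar>g z\<bar>" by (simp only: real_norm_def abs_mult)
      also have "\<dots> \<le> norm (?u z) * B" by (rule mult_left_mono[OF B(2)]) simp
      also have "\<dots> = norm (B * ?u z)" using B(1) by (simp only: real_norm_def abs_mult abs_of_pos mult.commute)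
      finally show "norm (?u z * g z) \<le> norm (B * ?u z)" .
    qed
  qed
  moreover have "(\<lambda>z. ?u z * g z) = (\<lambda>z. indicator \<Omega> z *\<^sub>R (real_of_ereal (\<phi> z) * g z))"
    using K(3,4) by (auto simp: indicator_def fun_eq_iff)
  ultimately show ?thesis unfolding set_integrable_def by simp
qed

lemma nonneg_Reals_of_realD: "complex_of_real x \<in> \<real>\<^sub>\<ge>\<^sub>0 \<Longrightarrow> 0 \<le> x"
  by simp

section \<open>Consequences of m-subharmonicity for the trace measure\<close>

context
  fixes \<Omega> :: "(complex ^ 'n::finite) set" and \<phi> :: "complex ^ 'n \<Rightarrow> ereal" and m r :: nat
  assumes m1: "1 \<le> m" and mn: "m < CARD('n)" and opn: "open \<Omega>" and msh: "m_subharmonic_on \<Omega> m \<phi>"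
    and n: "CARD('n) = Suc (Suc r)"
begin

private lemma sh: "subharmonic_on \<Omega> \<phi>"
  using msh by (simp add: m_subharmonic_on_def)

private lemma int_lapl: "test_function \<Omega> f \<Longrightarrow>
    set_integrable lborel \<Omega> (\<lambda>z. real_of_ereal (\<phi> z) * (trace_const TYPE('n) * lapl f z))"
  by (intro subharmonic_times_test_integrable[OF opn sh] test_function_scale test_function_lapl)

lemma test_form_gam:
  assumes F: "test_function \<Omega> F" and k: "smooth k" and \<kappa>: "\<And>z. z \<noteq> x \<Longrightarrow> F z * \<kappa> z = k z"
  shows "test_form \<Omega> (gam_form q F \<kappa> x)"
proof -
  obtain K where K: "smooth F" "compact K" "K \<subseteq> \<Omega>" "\<And>x. x \<notin> K \<Longrightarrow> F x = 0"
    using F by (rule test_function_supportE) (rule that)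
  have "gam_form q F \<kappa> x z v = gam_list q q F k x z (map v [0..<2 * q])" for z v
    by (rule gam_form_list0[OF \<kappa>])
  then have "smooth (\<lambda>z. gam_form q F \<kappa> x z v)" for v
    by (simp only: smooth_gam_list[OF K(1) k])
  moreover have "gam_form q F \<kappa> x z = (\<lambda>v. 0)" if "z \<notin> K" for z
    using K(4)[OF that] by (simp add: gam_form_def)
  ultimately show ?thesis unfolding test_form_def using K by blast
qed

private lemma pairing_nonneg:
  assumes F: "test_function \<Omega> F" "\<And>z. 0 \<le> F z" and k: "smooth k" and \<kappa>: "\<And>z. z \<noteq> x \<Longrightarrow> F z * \<kappa> z = k z"
    and \<kappa>m: "\<And>z. real m * (\<kappa> z * (norm (z - x))\<^sup>2) \<le> real CARD('n)"
  shows "ddc_pairing \<Omega> \<phi> (gam_wedge (CARD('n) - m) (m - 1) F \<kappa> x) \<in> \<real>\<^sub>\<ge>\<^sub>0"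
proof -
  have "strongly_m_positive_on \<Omega> m (m - 1) (gam_form (m - 1) F \<kappa> x)"
    using mn F(2) \<kappa>m by (intro strongly_m_positive_gam_form) auto
  then show ?thesis
    using msh test_form_gam[OF F(1) k \<kappa>] unfolding m_subharmonic_on_def ddc_beta_pairing_def by blast
qed

lemma pair_T_functional: "positive_functional \<Omega> (pair_T \<Omega> \<phi>)"
proof
  show "open \<Omega>" by (rule opn)
  fix f assume f: "test_function \<Omega> f"
  then have sf: "smooth f" by (auto simp: test_function_def)
  show "pair_T \<Omega> \<phi> (\<lambda>x. f x + g x) = pair_T \<Omega> \<phi> f + pair_T \<Omega> \<phi> g" if g: "test_function \<Omega> g" for g
  proof -
    have sg: "smooth g" using g by (auto simp: test_function_def)
    show ?thesis
      unfolding pair_T_def lapl_add[OF sf sg] distrib_left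
      by (rule set_integral_add(2)[OF int_lapl[OF f] int_lapl[OF g]])
  qed
  show "pair_T \<Omega> \<phi> (\<lambda>x. c * f x) = c * pair_T \<Omega> \<phi> f" for c
    unfolding pair_T_def lapl_scale[OF sf]
    by (subst set_integral_mult_right[symmetric]) (simp add: mult_ac)
  show "0 \<le> pair_T \<Omega> \<phi> f" if "\<And>x. 0 \<le> f x"
  proof -
    \<comment> \<open>For \<kappa> = 0 the test form is f \<beta>^(m-1), and its product with
      \<beta>^(n-m) is f \<beta>^(n-1), the form that defines the trace.\<close>
    have "complex_of_real (pair_T \<Omega> \<phi> f) = ddc_pairing \<Omega> \<phi> (gam_wedge (CARD('n) - m) (m - 1) f (\<lambda>_. 0) 0)"
      unfolding pair_T_def
      by (rule ddc_pairing_real[symmetric], rule vol_ddc_beta[OF n _ sf]) (use m1 mn n in auto)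
    also have "\<dots> \<in> \<real>\<^sub>\<ge>\<^sub>0"
      by (rule pairing_nonneg[OF f that smooth_const[of 0]]) auto
    finally show ?thesis by (rule nonneg_Reals_of_realD)
  qed
qed

lemma ddc_beta_pairing_test:
  assumes "smooth f"
  shows "ddc_beta_pairing \<Omega> \<phi> (CARD('n) - 1) (\<lambda>z v. of_real (f z)) = of_real (pair_T \<Omega> \<phi> f)"
proof -
  have e: "(\<lambda>z v. complex_of_real (f z)) = gam_form 0 f (\<lambda>_. 0) 0"
    by (simp add: gam_form_def)
  show ?thesis unfolding ddc_beta_pairing_def pair_T_def e
    by (rule ddc_pairing_real, rule vol_ddc_beta[OF n _ assms]) (simp add: n)
qed

text \<open>The definite description is resolved by existence, from
  \<open>riesz_representation\<close>, and uniqueness, from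
  \<open>representing_measure_unique\<close>.\<close>

lemma trace_measure:
  shows "sets (trace_measure \<Omega> \<phi>) = sets borel"
    and "compact K \<Longrightarrow> K \<subseteq> \<Omega> \<Longrightarrow> emeasure (trace_measure \<Omega> \<phi>) K < \<infinity>"
    and "test_function \<Omega> f \<Longrightarrow> (LINT z|trace_measure \<Omega> \<phi>. f z) = pair_T \<Omega> \<phi> f"
proof -
  interpret positive_functional \<Omega> "pair_T \<Omega> \<phi>" by (rule pair_T_functional)
  let ?P = "\<lambda>\<mu>. sets \<mu> = sets borel \<and> emeasure \<mu> (- \<Omega>) = 0 \<and>
     (\<forall>K. compact K \<and> K \<subseteq> \<Omega> \<longrightarrow> emeasure \<mu> K < \<infinity>) \<and>
     (\<forall>f. test_function \<Omega> f \<longrightarrow>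
        of_real (LINT z|\<mu>. f z) = ddc_beta_pairing \<Omega> \<phi> (CARD('n) - 1) (\<lambda>z v. of_real (f z)))"
  have eq: "(of_real (LINT z|\<mu>. f z) = ddc_beta_pairing \<Omega> \<phi> (CARD('n) - 1) (\<lambda>z v. of_real (f z)))
      \<longleftrightarrow> (LINT z|\<mu>. f z) = pair_T \<Omega> \<phi> f" if "test_function \<Omega> f" for f \<mu>
  proof -
    have "smooth f" using that by (auto simp: test_function_def)
    then show ?thesis by (simp only: ddc_beta_pairing_test of_real_eq_iff)
  qed
  have P: "?P riesz_measure"
  proof (intro conjI allI impI sets_riesz emeasure_riesz_Compl)
    show "emeasure riesz_measure K < \<infinity>" if "compact K \<and> K \<subseteq> \<Omega>" for K
      using that emeasure_riesz_compact by blast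
    show "of_real (LINT z|riesz_measure. f z) = ddc_beta_pairing \<Omega> \<phi> (CARD('n) - 1) (\<lambda>z v. of_real (f z))"
      if "test_function \<Omega> f" for f
      unfolding eq[OF that] by (rule riesz_representation[OF that])
  qed
  have u: "\<mu> = riesz_measure" if \<mu>: "?P \<mu>" for \<mu>
  proof (rule representing_measure_unique[OF opn])
    show "(LINT x|\<mu>. f x) = (LINT x|riesz_measure. f x)" if f: "test_function \<Omega> f" for f
      using \<mu> f eq[OF f] riesz_representation[OF f] by metis
  qed (use \<mu> emeasure_riesz_Compl emeasure_riesz_compact in auto)
  have "trace_measure \<Omega> \<phi> = riesz_measure"
    unfolding trace_measure_def by (rule the_equality[of ?P, OF P u])
  with P show "sets (trace_measure \<Omega> \<phi>) = sets borel"
    and "compact K \<Longrightarrow> K \<subseteq> \<Omega> \<Longrightarrow> emeasure (trace_measure \<Omega> \<phi>) K < \<infinity>"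
    and "test_function \<Omega> f \<Longrightarrow> (LINT z|trace_measure \<Omega> \<phi>. f z) = pair_T \<Omega> \<phi> f"
    using riesz_representation by auto
qed

lemma test_function_radial:
  assumes "cball x \<rho> \<subseteq> \<Omega>" "smooth g" "0 \<le> \<rho>" "\<And>t. \<rho>\<^sup>2 < t \<Longrightarrow> g t = 0"
  shows "test_function \<Omega> (\<lambda>w. g ((norm (w - x))\<^sup>2))"
proof (rule test_functionI[OF smooth_radial[OF assms(2)] compact_cball assms(1)])
  fix w assume "w \<notin> cball x \<rho>"
  then have "\<rho> < norm (w - x)" by (simp add: dist_norm norm_minus_commute)
  then have "\<rho>\<^sup>2 < (norm (w - x))\<^sup>2" using assms(3) by (intro power_strict_mono) auto
  then show "g ((norm (w - x))\<^sup>2) = 0" by (rule assms(4))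
qed

text \<open>The form tested is F \<gamma>^(m-1) with F = t b(t). By \<open>vol_ddc_radial\<close>
  the pairing is the trace pairing of F - ((m - 1) n / m) h, and the trace measure turns its
  nonnegativity into an inequality of integrals.\<close>

lemma trace_radial_inequality:
  assumes "cball x \<rho> \<subseteq> \<Omega>" "0 \<le> \<rho>" and b: "smooth b" and h: "smooth h"
    and hb: "\<And>t. (h has_real_derivative - b t) (at t)" and b0: "\<And>t. 0 \<le> b t"
    and supp: "\<And>t. \<rho>\<^sup>2 < t \<Longrightarrow> b t = 0" "\<And>t. \<rho>\<^sup>2 < t \<Longrightarrow> h t = 0"
  shows "real (m - 1) * real CARD('n) / real m * (LINT w|trace_measure \<Omega> \<phi>. h ((norm (w - x))\<^sup>2))
    \<le> (LINT w|trace_measure \<Omega> \<phi>. (norm (w - x))\<^sup>2 * b ((norm (w - x))\<^sup>2))"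
proof -
  interpret positive_functional \<Omega> "pair_T \<Omega> \<phi>" by (rule pair_T_functional)
  define s where "s = real CARD('n) / real m"
  define F where "F w = (norm (w - x))\<^sup>2 * b ((norm (w - x))\<^sup>2)" for w
  define X where "X w = h ((norm (w - x))\<^sup>2)" for w
  \<comment> \<open>the extreme admissible radial form; division by 0 gives \<open>\<kappa> x = 0\<close>\<close>
  define \<kappa> where "\<kappa> w = s / (norm (w - x))\<^sup>2" for w
  have tF: "test_function \<Omega> F" unfolding F_def
    by (rule test_function_radial[OF assms(1) smooth_mult[OF smooth_ident b] assms(2)]) (simp add: supp)
  have tX: "test_function \<Omega> X" unfolding X_def
    by (rule test_function_radial[OF assms(1) h assms(2)]) (simp add: supp)
  have sF: "smooth F" and sX: "smooth X" using tF tX by (auto simp: test_function_def)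
  have \<kappa>: "F w * \<kappa> w = s * b ((norm (w - x))\<^sup>2)" if "w \<noteq> x" for w
    using that by (simp add: F_def \<kappa>_def)
  have \<kappa>m: "real m * (\<kappa> w * (norm (w - x))\<^sup>2) \<le> real CARD('n)" for w
    using m1 by (simp add: \<kappa>_def s_def)
  have sk: "smooth (\<lambda>w. s * b ((norm (w - x))\<^sup>2))" by (intro smooth_mult smooth_const smooth_radial b)
  let ?c = "real (m - 1) * s"
  have "ddc_pairing \<Omega> \<phi> (gam_wedge (CARD('n) - m) (m - 1) F \<kappa> x)
    = of_real (LINT z:\<Omega>|lborel. real_of_ereal (\<phi> z) * (trace_const TYPE('n) * (lapl F z - ?c * lapl X z)))"
    unfolding X_def
    by (rule ddc_pairing_real, rule vol_ddc_radial[OF n _ b h hb sF \<kappa>]) (use m1 mn n in auto)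
  also have "(LINT z:\<Omega>|lborel. real_of_ereal (\<phi> z) * (trace_const TYPE('n) * (lapl F z - ?c * lapl X z)))
     = pair_T \<Omega> \<phi> (\<lambda>w. F w + (- ?c) * X w)"
    unfolding pair_T_def lapl_add[OF sF smooth_mult[OF smooth_const sX]] lapl_scale[OF sX] by simp
  also have "\<dots> = pair_T \<Omega> \<phi> F + (- ?c) * pair_T \<Omega> \<phi> X"
    by (simp only: T_add[OF tF test_function_scale[OF tX]] T_scale[OF tX])
  finally have "complex_of_real (pair_T \<Omega> \<phi> F + (- ?c) * pair_T \<Omega> \<phi> X) \<in> \<real>\<^sub>\<ge>\<^sub>0"
    using pairing_nonneg[OF tF _ sk \<kappa> \<kappa>m] b0 by (simp add: F_def)
  then have "0 \<le> pair_T \<Omega> \<phi> F + (- ?c) * pair_T \<Omega> \<phi> X" by (rule nonneg_Reals_of_realD)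
  then show ?thesis
    unfolding F_def[symmetric] X_def[symmetric] trace_measure(3)[OF tF] trace_measure(3)[OF tX]
    by (simp add: s_def)
qed

end

section \<open>Monotonicity of the mass ratio\<close>

lemma flat_scaled_deriv:
  "\<rho> \<noteq> 0 \<Longrightarrow> ((\<lambda>t. flat 0 (c * (1 - t / \<rho>))) has_real_derivative - (c / \<rho> * flat 2 (c * (1 - t / \<rho>)))) (at t)"
  by (rule DERIV_cong, rule DERIV_chain2[OF flat_deriv], (rule derivative_intros | simp)+)
    (simp add: numeral_2_eq_2)

lemma flat_scale_deriv:
  assumes "\<rho> \<noteq> 0"
  shows "((\<lambda>\<rho>. flat 0 (c * (1 - t / \<rho>))) has_real_derivative c * t / \<rho>\<^sup>2 * flat 2 (c * (1 - t / \<rho>))) (at \<rho>)"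
proof -
  have "((\<lambda>\<rho>. c * (1 - t / \<rho>)) has_real_derivative c * (t / \<rho>\<^sup>2)) (at \<rho>)"
    using assms by (auto intro!: derivative_eq_intros simp: power2_eq_square)
  from DERIV_chain2[OF flat_deriv[of 0] this] show ?thesis
    by (simp add: numeral_2_eq_2 mult_ac)
qed

text \<open>For t < 1 the argument grows to infinity, where \<open>flat 0\<close> tends to 1; for t
  \<ge> 1 it is never positive. The limit is the indicator that belongs to open balls.\<close>

lemma flat_scaled_tendsto:
  "(\<lambda>k. flat 0 (real k * (1 - t))) \<longlonglongrightarrow> (if t < 1 then 1 else 0)"
proof (cases "t < 1")
  case True
  have "filterlim (\<lambda>k. real k * (1 - t)) at_top sequentially"
    using True by (intro filterlim_at_top_mult_tendsto_pos[OF tendsto_const] filterlim_real_sequentially) auto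
  then have "((\<lambda>k. inverse (real k * (1 - t))) \<longlongrightarrow> 0) sequentially"
    by (rule tendsto_inverse_0_at_top)
  then have "(\<lambda>k. exp (- inverse (real k * (1 - t)))) \<longlonglongrightarrow> exp (- 0)"
    by (intro tendsto_intros)
  moreover have "\<forall>\<^sub>F k in sequentially. exp (- inverse (real k * (1 - t))) = flat 0 (real k * (1 - t))"
    using eventually_gt_at_top[of 0] by eventually_elim (use True in \<open>simp add: flat_def\<close>)
  ultimately show ?thesis using True by (simp add: tendsto_cong)
next
  case False
  then have "flat 0 (real k * (1 - t)) = 0" for k
    by (intro flat_eq_0 mult_nonneg_nonpos) auto
  then show ?thesis using False by simp
qed

context
  fixes \<Omega> :: "(complex ^ 'n::finite) set" and \<phi> :: "complex ^ 'n \<Rightarrow> ereal" and m r :: nat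
  assumes m1: "1 \<le> m" and mn: "m < CARD('n)" and opn: "open \<Omega>" and msh: "m_subharmonic_on \<Omega> m \<phi>"
    and n: "CARD('n) = Suc (Suc r)"
begin

private abbreviation \<sigma> where "\<sigma> \<equiv> trace_measure \<Omega> \<phi>"

private lemmas tm = trace_measure[OF m1 mn opn msh n]

text \<open>Half of the exponent in the Lelong number, because the parameter \<rho> below is a
  squared radius.\<close>

private definition q :: real where "q = real (m - 1) * real CARD('n) / real m"

private lemma sets_\<sigma> [measurable_cong]: "sets \<sigma> = sets borel" by (rule tm(1))

private lemma space_\<sigma>: "space \<sigma> = UNIV"
  using sets_eq_imp_space_eq[OF sets_\<sigma>] by simp

private lemma continuous_measurable: "continuous_on UNIV f \<Longrightarrow> f \<in> borel_measurable \<sigma>"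
  for f :: "complex ^ 'n \<Rightarrow> real"
  using borel_measurable_continuous_onI[of f] by (simp cong: measurable_cong_sets)

private lemma integrable_cball: "cball x R \<subseteq> \<Omega> \<Longrightarrow> integrable \<sigma> (\<lambda>w. C * indicator (cball x R) w :: real)"
  using tm(2)[OF compact_cball, of x R] by (intro integrable_mult_right) (auto simp: sets_\<sigma>)

text \<open>A smooth approximation of the indicator of the ball of squared radius \<rho>; the
  parameter \<open>c\<close> controls its sharpness.\<close>

private definition u :: "complex ^ 'n \<Rightarrow> real \<Rightarrow> real \<Rightarrow> complex ^ 'n \<Rightarrow> real" where
  "u x c \<rho> w = flat 0 (c * (1 - (norm (w - x))\<^sup>2 / \<rho>))"

private definition u' :: "complex ^ 'n \<Rightarrow> real \<Rightarrow> real \<Rightarrow> complex ^ 'n \<Rightarrow> real" where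
  "u' x c \<rho> w = c * (norm (w - x))\<^sup>2 / \<rho>\<^sup>2 * flat 2 (c * (1 - (norm (w - x))\<^sup>2 / \<rho>))"

private lemma continuous_flat: "continuous_on S (\<lambda>w. flat k (f w))" if "continuous_on S f"
  for f :: "complex ^ 'n \<Rightarrow> real"
  using continuous_on_compose2[OF smooth_continuous[OF smooth_flat] that] by auto

private lemma u_measurable: "u x c \<rho> \<in> borel_measurable \<sigma>"
  unfolding u_def[abs_def] divide_inverse
  by (intro continuous_measurable continuous_flat continuous_intros)

private lemma u'_measurable: "u' x c \<rho> \<in> borel_measurable \<sigma>"
  unfolding u'_def[abs_def] divide_inverse
  by (intro continuous_measurable continuous_on_mult continuous_flat continuous_intros)

private lemma u_deriv: "\<rho> > 0 \<Longrightarrow> ((\<lambda>\<rho>. u x c \<rho> w) has_real_derivative u' x c \<rho> w) (at \<rho>)"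
  unfolding u_def u'_def by (rule flat_scale_deriv) simp

private lemma flat_outside: "0 < c \<Longrightarrow> 0 < \<rho> \<Longrightarrow> \<rho> \<le> t \<Longrightarrow> flat k (c * (1 - t / \<rho>)) = 0"
  by (intro flat_eq_0 mult_nonneg_nonpos) auto

private lemma u'_bound:
  assumes "0 < c" "0 < \<rho>" shows "\<bar>u' x c \<rho> w\<bar> \<le> 2 * c / \<rho>"
proof (cases "(norm (w - x))\<^sup>2 < \<rho>")
  case True
  have "flat 2 (c * (1 - (norm (w - x))\<^sup>2 / \<rho>)) \<le> 2"
    using flat_le_fact[of 2] by simp
  moreover have "c * (norm (w - x))\<^sup>2 / \<rho>\<^sup>2 \<le> c / \<rho>"
    using True assms by (simp add: power2_eq_square divide_le_eq field_simps)
  ultimately have "u' x c \<rho> w \<le> c / \<rho> * 2"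
    unfolding u'_def using assms by (intro mult_mono flat_nonneg) auto
  moreover have "0 \<le> u' x c \<rho> w" unfolding u'_def using assms by (intro mult_nonneg_nonneg flat_nonneg) auto
  ultimately show ?thesis by (simp add: mult.commute)
next
  case False
  then show ?thesis using flat_outside[of c \<rho>] assms by (simp add: u'_def)
qed

private lemma u_outside: "0 < c \<Longrightarrow> 0 < \<rho> \<Longrightarrow> \<rho> \<le> R\<^sup>2 \<Longrightarrow> 0 < R \<Longrightarrow> w \<notin> cball x R \<Longrightarrow> u x c \<rho> w = 0"
proof -
  assume a: "0 < c" "0 < \<rho>" "\<rho> \<le> R\<^sup>2" "0 < R" "w \<notin> cball x R"
  then have "R < norm (w - x)" by (simp add: dist_norm norm_minus_commute)
  then have "R\<^sup>2 < (norm (w - x))\<^sup>2" using a(4) by (intro power_strict_mono) auto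
  then show ?thesis unfolding u_def using a by (intro flat_outside) auto
qed

private lemma u_bounds: "0 \<le> u x c \<rho> w" "u x c \<rho> w \<le> 1"
  unfolding u_def using flat_nonneg flat_le_fact[of 0] by auto

private lemma u_integrable:
  assumes "0 < c" "0 < \<rho>" "\<rho> \<le> R\<^sup>2" "0 < R" "cball x R \<subseteq> \<Omega>"
  shows "integrable \<sigma> (u x c \<rho>)"
proof (rule Bochner_Integration.integrable_bound[OF integrable_cball[OF assms(5), of 1] u_measurable])
  show "AE w in \<sigma>. norm (u x c \<rho> w) \<le> norm (1 * indicator (cball x R) w :: real)"
    using u_outside[OF assms(1-4)] u_bounds by (intro AE_I2) (auto simp: indicator_def)
qed

private definition G :: "complex ^ 'n \<Rightarrow> real \<Rightarrow> real \<Rightarrow> real" where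
  "G x c \<rho> = (LINT w|\<sigma>. u x c \<rho> w)"

private lemma G_deriv:
  assumes c: "0 < c" and \<rho>: "0 < \<rho>" "\<rho> < R\<^sup>2" and R: "0 < R" "cball x R \<subseteq> \<Omega>"
  shows "((\<lambda>\<rho>. G x c \<rho>) has_real_derivative (LINT w|\<sigma>. u' x c \<rho> w)) (at \<rho>)"
proof -
  \<comment> \<open>It keeps \<rho> + e above \<rho> / 2, where the derivative is at most 4 c /
    \<rho>, and below R^2, where the cut-off is carried by \<open>cball x R\<close>. Together they
    give the dominating function for differentiation under the integral.\<close>
  define d where "d = min (\<rho> / 2) (R\<^sup>2 - \<rho>)"
  have d: "d > 0" using \<rho> by (simp add: d_def)
  have inside: "\<rho> / 2 \<le> \<rho> + e" "\<rho> + e \<le> R\<^sup>2" "0 < \<rho> + e" if "\<bar>e\<bar> < d" for e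
    using that \<rho> by (auto simp: d_def abs_less_iff)
  let ?K = "4 * c / \<rho>"
  have lip: "\<bar>(u x c (\<rho> + e) w - u x c \<rho> w) / e\<bar> \<le> ?K * indicator (cball x R) w" if e: "\<bar>e\<bar> < d" "e \<noteq> 0" for e w
  proof (cases "w \<in> cball x R")
    case False
    then show ?thesis
      using u_outside[OF c inside(3,2)[OF e(1)] R(1) False] u_outside[OF c \<rho>(1) less_imp_le[OF \<rho>(2)] R(1) False] by simp
  next
    case True
    have "norm (u x c (\<rho> + e) w - u x c \<rho> w) \<le> ?K * norm ((\<rho> + e) - \<rho>)"
    proof (rule field_differentiable_bound[of "{\<rho>/2..}" "\<lambda>\<rho>. u x c \<rho> w" "\<lambda>\<rho>. u' x c \<rho> w"])
      show "((\<lambda>\<rho>. u x c \<rho> w) has_field_derivative u' x c z w) (at z within {\<rho>/2..})" if "z \<in> {\<rho>/2..}" for z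
        using that \<rho>(1) by (intro DERIV_subset[OF u_deriv]) auto
      show "norm (u' x c z w) \<le> ?K" if "z \<in> {\<rho>/2..}" for z
      proof -
        have z: "0 < z" "\<rho> / 2 \<le> z" using that \<rho>(1) by auto
        have "norm (u' x c z w) \<le> 2 * c / z" using u'_bound[OF c z(1)] by simp
        also have "\<dots> \<le> 2 * c / (\<rho> / 2)" using z \<rho>(1) c by (intro divide_left_mono) auto
        finally show ?thesis by simp
      qed
    qed (use inside[OF e(1)] \<rho>(1) in auto)
    then show ?thesis using True e(2) by (simp add: divide_le_eq)
  qed
  have "((\<lambda>e. (G x c (\<rho> + e) - G x c \<rho>) / e) \<longlongrightarrow> (LINT w|\<sigma>. u' x c \<rho> w)) (at 0 within {-d<..<d})"
    unfolding tendsto_at_iff_sequentially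
  proof (intro allI impI)
    fix X :: "nat \<Rightarrow> real" assume X: "\<forall>i. X i \<in> {-d<..<d} - {0}" "X \<longlonglongrightarrow> 0"
    have Xd: "\<bar>X i\<bar> < d" "X i \<noteq> 0" for i using X(1)[rule_format, of i] by (auto simp: abs_less_iff)
    have "(\<lambda>i. LINT w|\<sigma>. (u x c (\<rho> + X i) w - u x c \<rho> w) / X i) \<longlonglongrightarrow> (LINT w|\<sigma>. u' x c \<rho> w)"
    proof (rule integral_dominated_convergence[where w="\<lambda>w. ?K * indicator (cball x R) w"])
      show "integrable \<sigma> (\<lambda>w. ?K * indicator (cball x R) w)" by (rule integrable_cball[OF R(2)])
      show "AE w in \<sigma>. norm ((u x c (\<rho> + X i) w - u x c \<rho> w) / X i) \<le> ?K * indicator (cball x R) w" for i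
        using lip[OF Xd] by (intro AE_I2) simp
      show "AE w in \<sigma>. (\<lambda>i. (u x c (\<rho> + X i) w - u x c \<rho> w) / X i) \<longlonglongrightarrow> u' x c \<rho> w"
      proof (rule AE_I2)
        fix w
        have "((\<lambda>e. (u x c (\<rho> + e) w - u x c \<rho> w) / e) \<longlongrightarrow> u' x c \<rho> w) (at 0)"
          using u_deriv[OF \<rho>(1)] by (simp add: DERIV_def)
        then show "(\<lambda>i. (u x c (\<rho> + X i) w - u x c \<rho> w) / X i) \<longlonglongrightarrow> u' x c \<rho> w"
          using X Xd(2) unfolding tendsto_at_iff_sequentially by (auto simp: o_def)
      qed
    qed (use u_measurable u'_measurable in \<open>auto intro!: borel_measurable_divide borel_measurable_diff\<close>)
    moreover have "(LINT w|\<sigma>. (u x c (\<rho> + X i) w - u x c \<rho> w) / X i) = (G x c (\<rho> + X i) - G x c \<rho>) / X i" for i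
      unfolding G_def
      using u_integrable[OF c inside(3,2)[OF Xd(1)] R] u_integrable[OF c \<rho>(1) less_imp_le[OF \<rho>(2)] R] by simp
    ultimately show "((\<lambda>e. (G x c (\<rho> + e) - G x c \<rho>) / e) \<circ> X) \<longlonglongrightarrow> (LINT w|\<sigma>. u' x c \<rho> w)"
      by (simp only: o_def)
  qed
  then have "((\<lambda>e. (G x c (\<rho> + e) - G x c \<rho>) / e) \<longlongrightarrow> (LINT w|\<sigma>. u' x c \<rho> w)) (at 0)"
    using d at_within_open[of 0 "{-d<..<d}"] by simp
  then show ?thesis by (simp add: DERIV_def)
qed

text \<open>The cut-off depends on t / \<rho> only, so \<rho> times its derivative in \<rho> is - t
  times its derivative in t. The right-hand side of \<open>trace_radial_inequality\<close> is
  therefore \<rho> G'(\<rho>).\<close>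

private lemma G_inequality:
  assumes c: "0 < c" and \<rho>: "0 < \<rho>" "\<rho> \<le> R\<^sup>2" and R: "0 < R" "cball x R \<subseteq> \<Omega>"
  shows "q * G x c \<rho> \<le> \<rho> * (LINT w|\<sigma>. u' x c \<rho> w)"
proof -
  let ?b = "\<lambda>t. c / \<rho> * flat 2 (c * (1 - t / \<rho>))" and ?h = "\<lambda>t. flat 0 (c * (1 - t / \<rho>))"
  have sa: "smooth (\<lambda>t. c * (1 - t / \<rho>))"
    unfolding divide_inverse by (intro smooth_mult smooth_diff smooth_const smooth_ident)
  have "real (m - 1) * real CARD('n) / real m * (LINT w|\<sigma>. ?h ((norm (w - x))\<^sup>2))
    \<le> (LINT w|\<sigma>. (norm (w - x))\<^sup>2 * ?b ((norm (w - x))\<^sup>2))"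
  proof (rule trace_radial_inequality[OF m1 mn opn msh n R(2)])
    show "smooth ?b" by (intro smooth_mult smooth_const smooth_compose[OF smooth_flat] sa)
    show "smooth ?h" by (intro smooth_compose[OF smooth_flat] sa)
    show "(?h has_real_derivative - ?b t) (at t)" for t using \<rho>(1) by (intro flat_scaled_deriv) simp
    show "0 \<le> ?b t" for t using c \<rho>(1) by (intro mult_nonneg_nonneg flat_nonneg) auto
    show "?b t = 0" "?h t = 0" if "R\<^sup>2 < t" for t
      using flat_outside[OF c \<rho>(1), of t] that \<rho>(2) by auto
  qed (use R in auto)
  also have "(\<lambda>w. (norm (w - x))\<^sup>2 * ?b ((norm (w - x))\<^sup>2)) = (\<lambda>w. \<rho> * u' x c \<rho> w)"
    using \<rho>(1) by (auto simp: u'_def fun_eq_iff power2_eq_square)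
  finally show ?thesis by (simp add: q_def G_def u_def)
qed

text \<open>The derivative of G(\<rho>) \<rho>^(-q) is \<rho>^(-q-1) (\<rho> G' - q G), which is
  nonnegative by \<open>G_inequality\<close>.\<close>

private lemma G_mono:
  assumes c: "0 < c" and \<rho>: "0 < \<rho>1" "\<rho>1 \<le> \<rho>2" "\<rho>2 < R\<^sup>2" and R: "0 < R" "cball x R \<subseteq> \<Omega>"
  shows "G x c \<rho>1 * \<rho>1 powr (- q) \<le> G x c \<rho>2 * \<rho>2 powr (- q)"
proof (rule DERIV_nonneg_imp_nondecreasing[OF \<rho>(2)])
  fix \<rho> assume "\<rho>1 \<le> \<rho>" "\<rho> \<le> \<rho>2"
  then have r: "0 < \<rho>" "\<rho> < R\<^sup>2" using \<rho> by auto
  let ?D = "LINT w|\<sigma>. u' x c \<rho> w"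
  have "((\<lambda>\<rho>. \<rho> powr (- q)) has_real_derivative - q * \<rho> powr (- q - 1)) (at \<rho>)"
    using r(1) by (rule has_real_derivative_powr)
  then have "((\<lambda>\<rho>. G x c \<rho> * \<rho> powr (- q)) has_real_derivative
      ?D * \<rho> powr (- q) + (- q * \<rho> powr (- q - 1)) * G x c \<rho>) (at \<rho>)"
    by (rule DERIV_mult[OF G_deriv[OF c r R]])
  moreover have "?D * \<rho> powr (- q) + (- q * \<rho> powr (- q - 1)) * G x c \<rho> = \<rho> powr (- q - 1) * (\<rho> * ?D - q * G x c \<rho>)"
    using r(1) by (simp add: powr_diff field_simps)
  ultimately have "((\<lambda>\<rho>. G x c \<rho> * \<rho> powr (- q)) has_real_derivative \<rho> powr (- q - 1) * (\<rho> * ?D - q * G x c \<rho>)) (at \<rho>)"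
    by (simp only:)
  moreover have "0 \<le> \<rho> powr (- q - 1) * (\<rho> * ?D - q * G x c \<rho>)"
    using G_inequality[OF c r(1) less_imp_le[OF r(2)] R] by (intro mult_nonneg_nonneg) auto
  ultimately show "\<exists>y. ((\<lambda>\<rho>. G x c \<rho> * \<rho> powr (- q)) has_real_derivative y) (at \<rho>) \<and> 0 \<le> y"
    by blast
qed

text \<open>Dominated convergence as the cut-offs sharpen; \<open>Suc k\<close> keeps the sharpness
  positive from the start.\<close>

private lemma G_tendsto:
  assumes \<rho>: "0 < \<rho>" "\<rho> < R\<^sup>2" and R: "0 < R" "cball x R \<subseteq> \<Omega>"
  shows "(\<lambda>k. G x (real (Suc k)) \<rho>) \<longlonglongrightarrow> measure \<sigma> (ball x (sqrt \<rho>))"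
proof -
  have "(\<lambda>k. LINT w|\<sigma>. u x (real (Suc k)) \<rho> w) \<longlonglongrightarrow> (LINT w|\<sigma>. indicator (ball x (sqrt \<rho>)) w)"
  proof (rule integral_dominated_convergence[where w="\<lambda>w. 1 * indicator (cball x R) w"])
    show "integrable \<sigma> (\<lambda>w. 1 * indicator (cball x R) w :: real)" by (rule integrable_cball[OF R(2)])
    show "AE w in \<sigma>. norm (u x (real (Suc k)) \<rho> w) \<le> 1 * indicator (cball x R) w" for k
      using u_outside[of "real (Suc k)" \<rho> R] u_bounds \<rho> R by (intro AE_I2) (auto simp: indicator_def)
    show "AE w in \<sigma>. (\<lambda>k. u x (real (Suc k)) \<rho> w) \<longlonglongrightarrow> indicator (ball x (sqrt \<rho>)) w"
    proof (rule AE_I2)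
      fix w
      have "(norm (w - x))\<^sup>2 / \<rho> < 1 \<longleftrightarrow> w \<in> ball x (sqrt \<rho>)"
      proof -
        have "(norm (w - x))\<^sup>2 < \<rho> \<longleftrightarrow> norm (w - x) < sqrt \<rho>"
          using real_sqrt_less_iff[of "(norm (w - x))\<^sup>2" \<rho>] by simp
        then show ?thesis using \<rho>(1) by (simp add: dist_norm norm_minus_commute)
      qed
      then show "(\<lambda>k. u x (real (Suc k)) \<rho> w) \<longlonglongrightarrow> indicator (ball x (sqrt \<rho>)) w"
        using LIMSEQ_Suc[OF flat_scaled_tendsto[of "(norm (w - x))\<^sup>2 / \<rho>"]]
        by (auto simp: u_def indicator_def simp del: of_nat_Suc)
    qed
    show "indicator (ball x (sqrt \<rho>)) \<in> borel_measurable \<sigma>"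
      by (rule borel_measurable_indicator) (simp add: sets_\<sigma>)
  qed (rule u_measurable)
  then show ?thesis by (simp add: G_def space_\<sigma>)
qed

section \<open>The mass ratio and the Lelong number\<close>

private definition M :: "complex ^ 'n \<Rightarrow> real \<Rightarrow> real" where
  "M x \<rho> = measure \<sigma> (ball x \<rho>) / \<rho> powr (2 * real CARD('n) / real m * (real m - 1))"

private lemma q_powr: "0 < s \<Longrightarrow> (s\<^sup>2) powr (- q) = 1 / s powr (2 * real CARD('n) / real m * (real m - 1))"
proof -
  assume s: "0 < s"
  have "(s\<^sup>2) powr (- q) = s powr (2 * (- q))"
    unfolding powr_powr[symmetric] using s by (simp add: powr_numeral)
  also have "2 * (- q) = - (2 * real CARD('n) / real m * (real m - 1))"
    using m1 by (simp add: q_def of_nat_diff)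
  finally show ?thesis by (simp add: powr_minus divide_inverse)
qed

text \<open>The limit of \<open>G_mono\<close> for increasing sharpness, taken at squared radii. The
  larger radius R leaves room for the strict inequality required there.\<close>

private lemma M_mono:
  assumes "0 < s" "s \<le> t" "t < R" "cball x R \<subseteq> \<Omega>"
  shows "M x s \<le> M x t"
proof -
  have R: "0 < R" and t: "0 < t" using assms by auto
  have s2: "0 < s\<^sup>2" "s\<^sup>2 \<le> t\<^sup>2" "t\<^sup>2 < R\<^sup>2"
    using assms t by (auto intro: power_mono power_strict_mono)
  have "measure \<sigma> (ball x (sqrt (s\<^sup>2))) * (s\<^sup>2) powr (- q) \<le> measure \<sigma> (ball x (sqrt (t\<^sup>2))) * (t\<^sup>2) powr (- q)"
  proof (rule LIMSEQ_le)
    show "(\<lambda>k. G x (real (Suc k)) (s\<^sup>2) * (s\<^sup>2) powr (- q)) \<longlonglongrightarrow> measure \<sigma> (ball x (sqrt (s\<^sup>2))) * (s\<^sup>2) powr (- q)"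
      using s2 R assms(4) by (intro tendsto_mult_right G_tendsto[where R=R]) auto
    show "(\<lambda>k. G x (real (Suc k)) (t\<^sup>2) * (t\<^sup>2) powr (- q)) \<longlonglongrightarrow> measure \<sigma> (ball x (sqrt (t\<^sup>2))) * (t\<^sup>2) powr (- q)"
      using s2 R assms(4) by (intro tendsto_mult_right G_tendsto[where R=R]) auto
    show "\<exists>N. \<forall>k\<ge>N. G x (real (Suc k)) (s\<^sup>2) * (s\<^sup>2) powr (- q) \<le> G x (real (Suc k)) (t\<^sup>2) * (t\<^sup>2) powr (- q)"
      using G_mono[OF _ s2 R assms(4)] by auto
  qed
  then show ?thesis using assms(1) t by (simp add: q_powr M_def)
qed

private lemma M_nonneg: "0 \<le> M x s"
  by (simp add: M_def)

text \<open>\<open>Lim\<close> only picks a limit if there is one, so convergence must be shown: the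
  ratio is monotone and bounded below by 0, hence tends to its infimum.\<close>

private lemma lelong_number_tendsto:
  assumes "0 < R" "cball x R \<subseteq> \<Omega>"
  shows "(M x \<longlongrightarrow> lelong_number \<Omega> m \<phi> x) (at_right 0)"
proof -
  have "(M x \<longlongrightarrow> Inf (M x ` ({0<..} \<inter> {..<R}))) (at 0 within ({0<..} \<inter> {..<R}))"
  proof (rule Lim_right_bound)
    show "M x a \<le> M x b" if "a \<in> {..<R}" "b \<in> {..<R}" "0 < a" "a \<le> b" for a b
      using that assms(2) by (intro M_mono[where R=R]) auto
    show "0 \<le> M x a" for a by (rule M_nonneg)
  qed
  moreover have "at 0 within ({0<..} \<inter> {..<R}) = at_right 0"
    by (rule at_within_nhd[of _ "{..<R}"]) (use assms in auto)
  ultimately have lim: "(M x \<longlongrightarrow> Inf (M x ` ({0<..} \<inter> {..<R}))) (at_right 0)" by simp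
  then have "Lim (at_right 0) (M x) = Inf (M x ` ({0<..} \<inter> {..<R}))"
    by (intro tendsto_Lim) auto
  then have "lelong_number \<Omega> m \<phi> x = Inf (M x ` ({0<..} \<inter> {..<R}))"
    unfolding lelong_number_def M_def[abs_def] .
  with lim show ?thesis by simp
qed

private lemma lelong_number_le:
  assumes "0 < s" "s < R" "cball x R \<subseteq> \<Omega>"
  shows "lelong_number \<Omega> m \<phi> x \<le> M x s"
proof (rule tendsto_upperbound[OF lelong_number_tendsto])
  show "\<forall>\<^sub>F t in at_right 0. M x t \<le> M x s"
    using eventually_at_right_less[of 0] eventually_at_right_real[OF assms(1)]
    by eventually_elim (use assms in \<open>auto intro: M_mono[where R=R]\<close>)
qed (use assms in auto)

lemma lelong_number_usc: "upper_semicontinuous_on \<Omega> (lelong_number \<Omega> m \<phi>)"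
  unfolding upper_semicontinuous_on_def
proof (intro ballI allI impI)
  fix x c assume x: "x \<in> \<Omega>" and c: "lelong_number \<Omega> m \<phi> x < c"
  obtain R where R: "0 < R" "cball x R \<subseteq> \<Omega>" using opn x open_contains_cball by blast
  let ?p = "2 * real CARD('n) / real m * (real m - 1)"
  have "\<forall>\<^sub>F t in at_right 0. M x t < c"
    using lelong_number_tendsto[OF R] c by (rule order_tendstoD)
  moreover have "\<forall>\<^sub>F t in at_right 0. t \<in> {0<..<R}" using R(1) by (rule eventually_at_right_real)
  ultimately have "\<forall>\<^sub>F t in at_right 0. M x t < c \<and> t \<in> {0<..<R}" by (rule eventually_conj)
  from eventually_happens'[OF trivial_limit_at_right_real this]
  obtain t where t: "0 < t" "t < R" "M x t < c" by auto
  \<comment> \<open>The ball stays fixed and only the power varies, so no continuity of the measure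
    is involved; the strict inequality leaves room for some s < t.\<close>
  have "((\<lambda>s. measure \<sigma> (ball x t) / s powr ?p) \<longlongrightarrow> M x t) (at_left t)"
    unfolding M_def using t(1) by (intro tendsto_intros) auto
  then have "\<forall>\<^sub>F s in at_left t. measure \<sigma> (ball x t) / s powr ?p < c"
    using t(3) by (rule order_tendstoD)
  moreover have "\<forall>\<^sub>F s in at_left t. s \<in> {0<..<t}" using t(1) by (rule eventually_at_left_real)
  ultimately have "\<forall>\<^sub>F s in at_left t. measure \<sigma> (ball x t) / s powr ?p < c \<and> s \<in> {0<..<t}"
    by (rule eventually_conj)
  from eventually_happens'[OF trivial_limit_at_left_real this]
  obtain s where s: "0 < s" "s < t" "measure \<sigma> (ball x t) / s powr ?p < c" by auto
  have "lelong_number \<Omega> m \<phi> z < c" if z: "dist z x < t - s" for z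
  proof -
    \<comment> \<open>This closed ball has radius greater than s, the room that
      \<open>lelong_number_le\<close> demands.\<close>
    have sub: "cball z (t - dist z x) \<subseteq> cball x t"
    proof
      fix y assume "y \<in> cball z (t - dist z x)"
      then show "y \<in> cball x t" using dist_triangle[of x y z] by (simp add: dist_commute)
    qed
    have tR: "cball x t \<subseteq> \<Omega>" using subset_cball[of t R x] R(2) t(2) by auto
    then have "cball z (t - dist z x) \<subseteq> \<Omega>" using sub by blast
    then have "lelong_number \<Omega> m \<phi> z \<le> M z s" using z s(1) by (intro lelong_number_le) auto
    also have "\<dots> \<le> measure \<sigma> (ball x t) / s powr ?p"
      unfolding M_def
    proof (rule divide_right_mono)
      have "ball z s \<subseteq> ball x t"
      proof
        fix y assume "y \<in> ball z s"
        then show "y \<in> ball x t" using z dist_triangle[of x y z] by (simp add: dist_commute)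
      qed
      moreover have "emeasure \<sigma> (ball x t) \<noteq> \<infinity>"
      proof -
        have "emeasure \<sigma> (ball x t) \<le> emeasure \<sigma> (cball x t)" by (intro emeasure_mono) (auto simp: sets_\<sigma>)
        also have "\<dots> < \<infinity>" by (rule tm(2)[OF compact_cball tR])
        finally show ?thesis by simp
      qed
      ultimately show "measure \<sigma> (ball z s) \<le> measure \<sigma> (ball x t)"
        by (intro measure_mono_fmeasurable) (auto simp: fmeasurable_def sets_\<sigma> less_top)
    qed simp
    finally show ?thesis using s(3) by simp
  qed
  then show "\<forall>\<^sub>F z in at x within \<Omega>. lelong_number \<Omega> m \<phi> z < c"
    unfolding eventually_at using s(2) by (intro exI[of _ "t - s"]) auto
qed

end

theorem corollary1:
  fixes \<Omega> :: "(complex ^ 'n) set" and \<phi> :: "complex ^ 'n \<Rightarrow> ereal" and m :: nat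
  assumes "1 \<le> m" and "m < CARD('n)"
    and "open \<Omega>"
    and "m_subharmonic_on \<Omega> m \<phi>"
  shows "upper_semicontinuous_on \<Omega> (lelong_number \<Omega> m \<phi>)"
proof -
  \<comment> \<open>From 1 \<le> m < n one gets n \<ge> 2, so the exponent n - 2 of \<beta> in the
    rank one term is a genuine one.\<close>
  have "CARD('n) = Suc (Suc (CARD('n) - 2))" using assms(1,2) by simp
  then show ?thesis by (rule lelong_number_usc[OF assms])
qed

end
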